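(* Let $P$ be an orthogonal projector acting on $\mathcal{H}$ and let $L$ be a linear operator on $\operatorname{Ker}P$ (extended by $0$ to all of $\mathcal H$) such that for some $\omega\ge 0$ $$-\operatorname{Re}\langle Lx,x\rangle_{\mathcal H}\le \omega\left(|x_d^+|^2+|x_d^-|^2\right)\qquad\text{for all }x=(x_d^+,x_d^-,x_t)\in\mathcal H=\mathcal H_d^+\oplus\mathcal H_d^-\oplus\mathcal H_t .$$ Then the operator $A_{P,L}$ is quasi-$m$-dissipative on $L^2(\mathsf E)$, and it is $m$-dissipative whenever $-L$ is dissipative. Accordingly, $A_{P,L}$ is the infinitesimal generator of a quasi-contractive (contractive, if $-L$ is dissipative) strongly continuous semigroup $(e^{tA_{P,L}})_{t\ge0}$ on $L^2(\mathsf E)$. If in addition $P$ and $L$ have only real entries, then the semigroup generated by $A_{P,L}$ is real.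
   Context: Setting. $\mathsf E=\mathsf E_d\sqcup\mathsf E_t$ is the finite edge set of a finite metric graph, with diffusion edges $\mathsf e_{d1},\dots,\mathsf e_{dD}$ identified with intervals $[0,a_{di}]$ and transport edges $\mathsf e_{t1},\dots,\mathsf e_{tT}$ identified with intervals $[0,a_{tj}]$, all lengths being positive and finite ($D=|\mathsf E_d|$, $T=|\mathsf E_t|$). $L^2(\mathsf E)=L^2(\mathsf E_d)\oplus L^2(\mathsf E_t)$, where $L^2(\mathsf E_d)=\bigoplus_i L^2(0,a_{di})$ and $L^2(\mathsf E_t)=\bigoplus_j L^2(0,a_{tj})$ (complex-valued functions), and $u\in L^2(\mathsf E)$ is written $u=(u_d,u_t)$ with components $u_{di}$, $u_{tj}$. $H^m(\mathsf E_d)=\bigoplus_i H^m(0,a_{di})$ and $H^m(\mathsf E_t)=\bigoplus_j H^m(0,a_{tj})$, with no boundary conditions. Boundary space. $\mathcal H=\mathcal H_d^+\oplus\mathcal H_d^-\oplus\mathcal H_t$ with $\mathcal H_d^\pm=\mathbb C^{D}$, $\mathcal H_t=\mathbb C^{T}$. For $u\in H^2(\mathsf E_d)\oplus H^1(\mathsf E_t)$ define $\underline u,\underline{\underline u}\in\mathcal H$ by $$\underline u=\begin{bmatrix}\{u_{di}(a_{di})\}_{i}\\ \{u_{di}(0)\}_{i}\\ 2^{-1/2}\{u_{tj}(a_{tj})+u_{tj}(0)\}_{j}\end{bmatrix},\qquad \underline{\underline u}=\begin{bmatrix}\{u_{di}'(a_{di})\}_{i}\\ \{-u_{di}'(0)\}_{i}\\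 2^{-1/2}\{-u_{tj}(a_{tj})+u_{tj}(0)\}_{j}\end{bmatrix}.$$ Operator. For an orthogonal projector $P$ on $\mathcal H$, with $P^\perp=\mathrm{Id}-P$, and a linear operator $L:\operatorname{Ker}P\to\operatorname{Ker}P$, extended by $0$ to $\mathcal H$ (still denoted $L$), set $$D(A_{P,L})=\{u\in H^2(\mathsf E_d)\oplus H^1(\mathsf E_t): P^\perp\underline{\underline u}+(L+P)\underline u=0\},\qquad A_{P,L}(u_d,u_t)=(u_d'',-u_t').$$ Terminology. A closed densely defined operator $A$ on a complex Hilbert space is $\omega$-quasi-dissipative if $\operatorname{Re}\langle Au,u\rangle\le\omega\|u\|^2$ for all $u\in D(A)$, and $\omega$-quasi-$m$-dissipative if moreover $\lambda-A$ is surjective for some $\lambda>\omega$; it is quasi-($m$-)dissipative if this holds for some $\omega\in\mathbb R$, and ($m$-)dissipative if this holds with $\omega=0$. A strongly continuous semigroup $(T(t))_{t\ge0}$ is quasi-contractive if $\|T(t)\|\le e^{\omega t}$ for all $t\ge 0$ and some $\omega\in\mathbb R$, and contractive if this holds with $\omega=0$. A semigroup on an $L^2$-space is real if each $T(t)$ maps (a.e.) real-valued functions to real-valued functions. "Real entries" refers to the matrices of $P$ and $L$ on $\mathcal H=\mathbb C^{2D+T}$ in the standard basis. *)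

theory Defs
  imports "HOL-Analysis.Analysis"
begin

section \<open>Complex inner product spaces\<close>

class complex_inner = real_inner +
  fixes scaleC :: "complex \<Rightarrow> 'a \<Rightarrow> 'a"  (infixr "*\<^sub>C" 75)
    and cinner :: "'a \<Rightarrow> 'a \<Rightarrow> complex"
  assumes scaleC_add_right: "c *\<^sub>C (x + y) = c *\<^sub>C x + c *\<^sub>C y"
    and scaleC_add_left: "(c + d) *\<^sub>C x = c *\<^sub>C x + d *\<^sub>C x"
    and scaleC_scaleC: "c *\<^sub>C d *\<^sub>C x = (c * d) *\<^sub>C x"
    and scaleC_of_real: "complex_of_real r *\<^sub>C x = r *\<^sub>R x"
    and cinner_add_left: "cinner (x + y) z = cinner x z + cinner y z"
    and cinner_scaleC_left: "cinner (c *\<^sub>C x) y = c * cinner x y"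
    and cinner_commute: "cinner x y = cnj (cinner y x)"
    and Re_cinner: "Re (cinner x y) = inner x y"

instantiation complex :: complex_inner
begin

definition scaleC_complex :: "complex \<Rightarrow> complex \<Rightarrow> complex"
  where "scaleC_complex c x = c * x"

definition cinner_complex :: "complex \<Rightarrow> complex \<Rightarrow> complex"
  where "cinner_complex x y = x * cnj y"

instance
  by standard
    (auto simp: scaleC_complex_def cinner_complex_def algebra_simps scaleR_conv_of_real
      inner_complex_def)

end

instantiation vec :: (complex_inner, finite) complex_inner
begin

definition scaleC_vec :: "complex \<Rightarrow> 'a ^ 'b \<Rightarrow> 'a ^ 'b"
  where "scaleC_vec c x = (\<chi> i. c *\<^sub>C x $ i)"

definition cinner_vec :: "'a ^ 'b \<Rightarrow> 'a ^ 'b \<Rightarrow> complex"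
  where "cinner_vec x y = (\<Sum>i\<in>UNIV. cinner (x $ i) (y $ i))"

instance
proof
  fix x y z :: "'a ^ 'b" and c d :: complex and r :: real
  show "cinner x y = cnj (cinner y x)"
    unfolding cinner_vec_def cnj_sum by (intro sum.cong refl cinner_commute)
qed (auto simp: scaleC_vec_def cinner_vec_def vec_eq_iff scaleC_add_right scaleC_add_left
      scaleC_scaleC scaleC_of_real cinner_add_left cinner_scaleC_left sum.distrib
      sum_distrib_left Re_cinner inner_vec_def)

end


section \<open>The space \<open>L\<^sup>2(\<real>)\<close> of complex-valued functions\<close>

definition sq_integrable :: "(real \<Rightarrow> complex) \<Rightarrow> bool"
  where "sq_integrable f \<longleftrightarrow>
    f \<in> borel_measurable lborel \<and> integrable lborel (\<lambda>x. (cmod (f x))\<^sup>2)"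

lemma sq_integrable_zero: "sq_integrable (\<lambda>x. 0)"
  by (simp add: sq_integrable_def)

lemma sq_integrable_add:
  assumes "sq_integrable f" "sq_integrable g"
  shows "sq_integrable (\<lambda>x. f x + g x)"
proof -
  have [measurable]: "f \<in> borel_measurable lborel" "g \<in> borel_measurable lborel"
    using assms by (auto simp: sq_integrable_def)
  have int: "integrable lborel (\<lambda>x. 2 * (cmod (f x))\<^sup>2 + 2 * (cmod (g x))\<^sup>2)"
    using assms by (auto simp: sq_integrable_def)
  have le: "(cmod (f x + g x))\<^sup>2 \<le> 2 * (cmod (f x))\<^sup>2 + 2 * (cmod (g x))\<^sup>2" for x
  proof -
    have "(cmod (f x + g x))\<^sup>2 \<le> (cmod (f x) + cmod (g x))\<^sup>2"
      by (rule power_mono[OF norm_triangle_ineq norm_ge_zero])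
    also have "\<dots> \<le> 2 * (cmod (f x))\<^sup>2 + 2 * (cmod (g x))\<^sup>2"
      using sum_squares_bound[of "cmod (f x)" "cmod (g x)"] by (simp add: power2_sum)
    finally show ?thesis .
  qed
  have "integrable lborel (\<lambda>x. (cmod (f x + g x))\<^sup>2)"
  proof (rule Bochner_Integration.integrable_bound[OF int])
    show "AE x in lborel. norm ((cmod (f x + g x))\<^sup>2)
        \<le> norm (2 * (cmod (f x))\<^sup>2 + 2 * (cmod (g x))\<^sup>2)"
      using le by (intro AE_I2) simp
  qed measurable
  then show ?thesis by (simp add: sq_integrable_def)
qed

lemma sq_integrable_mult:
  assumes "sq_integrable f"
  shows "sq_integrable (\<lambda>x. c * f x)"
  using assms by (auto simp: sq_integrable_def norm_mult power_mult_distrib)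

lemma integrable_mult_cnj:
  assumes "sq_integrable f" "sq_integrable g"
  shows "integrable lborel (\<lambda>x. f x * cnj (g x))"
proof -
  have [measurable]: "f \<in> borel_measurable lborel" "g \<in> borel_measurable lborel"
    using assms by (auto simp: sq_integrable_def)
  have [measurable]: "(\<lambda>x. cnj (g x)) \<in> borel_measurable lborel"
    by (rule borel_measurable_continuous_on[of cnj g, simplified])
      (intro continuous_intros | use \<open>g \<in> borel_measurable lborel\<close> in simp)+
  have int: "integrable lborel (\<lambda>x. (cmod (f x))\<^sup>2 + (cmod (g x))\<^sup>2)"
    using assms by (auto simp: sq_integrable_def)
  have le: "cmod (f x) * cmod (g x) \<le> (cmod (f x))\<^sup>2 + (cmod (g x))\<^sup>2" for x
  proof -
    have "2 * (cmod (f x) * cmod (g x)) \<le> (cmod (f x))\<^sup>2 + (cmod (g x))\<^sup>2"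
      using sum_squares_bound[of "cmod (f x)" "cmod (g x)"] by (simp only: mult.assoc)
    moreover have "0 \<le> cmod (f x) * cmod (g x)" by simp
    ultimately show ?thesis by linarith
  qed
  show ?thesis
  proof (rule Bochner_Integration.integrable_bound[OF int])
    show "AE x in lborel. norm (f x * cnj (g x)) \<le> norm ((cmod (f x))\<^sup>2 + (cmod (g x))\<^sup>2)"
      using le by (intro AE_I2) (simp add: norm_mult)
  qed measurable
qed

quotient_type l2 = "real \<Rightarrow> complex" / partial:
  "\<lambda>f g. sq_integrable f \<and> sq_integrable g \<and> (AE x in lborel. f x = g x)"
proof (rule part_equivpI)
  show "\<exists>f. sq_integrable f \<and> sq_integrable f \<and> (AE x in lborel. f x = f x)"
    using sq_integrable_zero by auto
qed (auto intro!: sympI transpI elim: eventually_mono eventually_elim2)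

instantiation l2 :: complex_inner
begin

lift_definition zero_l2 :: l2 is "\<lambda>x. 0"
  by (simp add: sq_integrable_zero)

lift_definition plus_l2 :: "l2 \<Rightarrow> l2 \<Rightarrow> l2" is "\<lambda>f g x. f x + g x"
  by (auto intro: sq_integrable_add elim: eventually_elim2)

lift_definition scaleC_l2 :: "complex \<Rightarrow> l2 \<Rightarrow> l2" is "\<lambda>c f x. c * f x"
  by (auto intro: sq_integrable_mult elim: eventually_mono)

lift_definition cinner_l2 :: "l2 \<Rightarrow> l2 \<Rightarrow> complex" is "\<lambda>f g. LINT x|lborel. f x * cnj (g x)"
proof -
  fix f f' g g' :: "real \<Rightarrow> complex"
  assume f: "sq_integrable f \<and> sq_integrable f' \<and> (AE x in lborel. f x = f' x)"
    and g: "sq_integrable g \<and> sq_integrable g' \<and> (AE x in lborel. g x = g' x)"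
  then have "AE x in lborel. f x * cnj (g x) = f' x * cnj (g' x)"
    by (auto elim: eventually_elim2)
  moreover have "(\<lambda>x. f x * cnj (g x)) \<in> borel_measurable lborel"
    "(\<lambda>x. f' x * cnj (g' x)) \<in> borel_measurable lborel"
    using f g by (simp_all only: borel_measurable_integrable integrable_mult_cnj)
  ultimately show "(LINT x|lborel. f x * cnj (g x)) = (LINT x|lborel. f' x * cnj (g' x))"
    by (intro integral_cong_AE)
qed

definition scaleR_l2 :: "real \<Rightarrow> l2 \<Rightarrow> l2"
  where "scaleR_l2 r u = complex_of_real r *\<^sub>C u"

definition uminus_l2 :: "l2 \<Rightarrow> l2"
  where "uminus_l2 u = (- 1) *\<^sub>C u"

definition minus_l2 :: "l2 \<Rightarrow> l2 \<Rightarrow> l2"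
  where "minus_l2 u v = u + (- v)"

definition inner_l2 :: "l2 \<Rightarrow> l2 \<Rightarrow> real"
  where "inner_l2 u v = Re (cinner u v)"

definition norm_l2 :: "l2 \<Rightarrow> real"
  where "norm_l2 u = sqrt (inner u u)"

definition dist_l2 :: "l2 \<Rightarrow> l2 \<Rightarrow> real"
  where "dist_l2 u v = norm (u - v)"

definition sgn_l2 :: "l2 \<Rightarrow> l2"
  where "sgn_l2 u = inverse (norm u) *\<^sub>R u"

definition uniformity_l2 :: "(l2 \<times> l2) filter"
  where "uniformity_l2 = (INF e\<in>{0 <..}. principal {(x, y). dist x y < e})"

definition open_l2 :: "l2 set \<Rightarrow> bool"
  where "open_l2 U \<longleftrightarrow> (\<forall>x\<in>U. eventually (\<lambda>(x', y). x' = x \<longrightarrow> y \<in> U) uniformity)"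

instance
proof
  fix x y z :: l2 and c d :: complex and r s :: real
  show add_assoc: "x + y + z = x + (y + z)"
    by transfer (auto intro!: sq_integrable_add simp: add.assoc)
  show "x + y = y + x"
    by transfer (auto intro!: sq_integrable_add simp: add.commute)
  show "0 + x = x"
    by transfer auto
  show "- x + x = 0"
    unfolding uminus_l2_def by transfer (auto simp: sq_integrable_zero)
  show "x - y = x + - y"
    by (simp add: minus_l2_def)
  show C_right: "c *\<^sub>C (x + y) = c *\<^sub>C x + c *\<^sub>C y" for c and x y :: l2
    by transfer (auto intro!: sq_integrable_add sq_integrable_mult simp: distrib_left)
  show C_left: "(c + d) *\<^sub>C x = c *\<^sub>C x + d *\<^sub>C x" for c d and x :: l2
    by transfer (auto intro!: sq_integrable_add sq_integrable_mult simp: distrib_right)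
  show CC: "c *\<^sub>C d *\<^sub>C x = (c * d) *\<^sub>C x" for c d and x :: l2
    by transfer (auto intro!: sq_integrable_mult simp: mult.assoc)
  show "complex_of_real r *\<^sub>C x = r *\<^sub>R x"
    by (simp add: scaleR_l2_def)
  show "r *\<^sub>R (x + y) = r *\<^sub>R x + r *\<^sub>R y"
    by (simp add: scaleR_l2_def C_right)
  show "(r + s) *\<^sub>R x = r *\<^sub>R x + s *\<^sub>R x"
    by (simp add: scaleR_l2_def C_left)
  show "r *\<^sub>R s *\<^sub>R x = (r * s) *\<^sub>R x"
    by (simp add: scaleR_l2_def CC)
  show "1 *\<^sub>R x = x"
    unfolding scaleR_l2_def by transfer auto
  show c_add: "cinner (x + y) z = cinner x z + cinner y z"
    by transfer (auto simp: distrib_right integrable_mult_cnj)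
  show c_scale: "cinner (c *\<^sub>C x) y = c * cinner x y" for c and x y :: l2
    by transfer (auto simp: mult.assoc)
  show c_comm: "cinner x y = cnj (cinner y x)" for x y :: l2
    by transfer (simp only: Bochner_Integration.integral_cnj[symmetric] complex_cnj_mult
        complex_cnj_cnj mult.commute)
  show "Re (cinner x y) = inner x y"
    by (simp add: inner_l2_def)
  show "inner x y = inner y x"
    using c_comm[of x y] by (simp add: inner_l2_def)
  show "inner (x + y) z = inner x z + inner y z"
    by (simp add: inner_l2_def c_add)
  show "inner (r *\<^sub>R x) y = r * inner x y"
    by (simp add: inner_l2_def scaleR_l2_def c_scale)
  have Re_int: "Re (LINT t|lborel. f t * cnj (f t)) = (LINT t|lborel. (cmod (f t))\<^sup>2)"
    for f :: "real \<Rightarrow> complex"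
    by (simp only: complex_norm_square[symmetric] integral_complex_of_real Re_complex_of_real)
  show "0 \<le> inner x x"
    unfolding inner_l2_def by transfer (simp add: Re_int)
  show "inner x x = 0 \<longleftrightarrow> x = 0"
    unfolding inner_l2_def
    by transfer
      (auto simp: Re_int sq_integrable_zero integral_nonneg_eq_0_iff_AE sq_integrable_def)
  show "norm x = sqrt (inner x x)"
    by (simp add: norm_l2_def)
  show "dist x y = norm (x - y)"
    by (simp add: dist_l2_def)
  show "sgn x = inverse (norm x) *\<^sub>R x"
    by (simp add: sgn_l2_def)
qed (simp_all add: uniformity_l2_def open_l2_def)

end


section \<open>Operators and semigroups on a Hilbert space\<close>

text \<open>
  The Hilbert spaces below are closed complex subspaces \<open>H\<close> of an ambient inner product space.
  An operator in \<open>H\<close> is given by its domain \<open>D\<close> and a function that is relevant on \<open>D\<close> only.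
\<close>

definition csubspace :: "'a::complex_inner set \<Rightarrow> bool"
  where "csubspace S \<longleftrightarrow> 0 \<in> S \<and> (\<forall>x\<in>S. \<forall>y\<in>S. x + y \<in> S) \<and> (\<forall>c. \<forall>x\<in>S. c *\<^sub>C x \<in> S)"

definition linear_operator_in :: "'a::complex_inner set \<Rightarrow> 'a set \<Rightarrow> ('a \<Rightarrow> 'a) \<Rightarrow> bool"
  where "linear_operator_in H D A \<longleftrightarrow>
    csubspace D \<and> D \<subseteq> H \<and> A ` D \<subseteq> H \<and>
    (\<forall>x\<in>D. \<forall>y\<in>D. A (x + y) = A x + A y) \<and> (\<forall>c. \<forall>x\<in>D. A (c *\<^sub>C x) = c *\<^sub>C A x)"

definition closed_operator :: "'a::complex_inner set \<Rightarrow> ('a \<Rightarrow> 'a) \<Rightarrow> bool"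
  where "closed_operator D A \<longleftrightarrow> closed {(x, A x) |x. x \<in> D}"

definition densely_defined :: "'a::complex_inner set \<Rightarrow> 'a set \<Rightarrow> bool"
  where "densely_defined H D \<longleftrightarrow> H \<subseteq> closure D"

definition quasi_dissipative_with ::
    "real \<Rightarrow> 'a::complex_inner set \<Rightarrow> 'a set \<Rightarrow> ('a \<Rightarrow> 'a) \<Rightarrow> bool"
  where "quasi_dissipative_with \<omega> H D A \<longleftrightarrow>
    linear_operator_in H D A \<and> closed_operator D A \<and> densely_defined H D \<and>
    (\<forall>u\<in>D. Re (cinner (A u) u) \<le> \<omega> * (norm u)\<^sup>2)"

definition quasi_m_dissipative_with ::
    "real \<Rightarrow> 'a::complex_inner set \<Rightarrow> 'a set \<Rightarrow> ('a \<Rightarrow> 'a) \<Rightarrow> bool"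
  where "quasi_m_dissipative_with \<omega> H D A \<longleftrightarrow>
    quasi_dissipative_with \<omega> H D A \<and> (\<exists>\<mu>>\<omega>. (\<lambda>u. \<mu> *\<^sub>R u - A u) ` D = H)"

definition dissipative :: "'a::complex_inner set \<Rightarrow> 'a set \<Rightarrow> ('a \<Rightarrow> 'a) \<Rightarrow> bool"
  where "dissipative H D A \<longleftrightarrow> quasi_dissipative_with 0 H D A"

definition m_dissipative :: "'a::complex_inner set \<Rightarrow> 'a set \<Rightarrow> ('a \<Rightarrow> 'a) \<Rightarrow> bool"
  where "m_dissipative H D A \<longleftrightarrow> quasi_m_dissipative_with 0 H D A"

definition quasi_m_dissipative :: "'a::complex_inner set \<Rightarrow> 'a set \<Rightarrow> ('a \<Rightarrow> 'a) \<Rightarrow> bool"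
  where "quasi_m_dissipative H D A \<longleftrightarrow> (\<exists>\<omega>. quasi_m_dissipative_with \<omega> H D A)"

definition C0_semigroup :: "'a::complex_inner set \<Rightarrow> (real \<Rightarrow> 'a \<Rightarrow> 'a) \<Rightarrow> bool"
  where "C0_semigroup H T \<longleftrightarrow>
    (\<forall>t\<ge>0. linear_operator_in H H (T t)) \<and>
    (\<forall>t\<ge>0. \<exists>K. \<forall>u\<in>H. norm (T t u) \<le> K * norm u) \<and>
    (\<forall>u\<in>H. T 0 u = u) \<and>
    (\<forall>s\<ge>0. \<forall>t\<ge>0. \<forall>u\<in>H. T (s + t) u = T s (T t u)) \<and>
    (\<forall>u\<in>H. ((\<lambda>t. T t u) \<longlongrightarrow> u) (at_right 0))"

definition is_generator ::
    "'a::complex_inner set \<Rightarrow> (real \<Rightarrow> 'a \<Rightarrow> 'a) \<Rightarrow> 'a set \<Rightarrow> ('a \<Rightarrow> 'a) \<Rightarrow> bool"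
  where "is_generator H T D A \<longleftrightarrow>
    D = {u \<in> H. \<exists>v. ((\<lambda>t. (1 / t) *\<^sub>R (T t u - u)) \<longlongrightarrow> v) (at_right 0)} \<and>
    (\<forall>u\<in>D. ((\<lambda>t. (1 / t) *\<^sub>R (T t u - u)) \<longlongrightarrow> A u) (at_right 0))"

definition growth_bounded :: "real \<Rightarrow> 'a::complex_inner set \<Rightarrow> (real \<Rightarrow> 'a \<Rightarrow> 'a) \<Rightarrow> bool"
  where "growth_bounded \<omega> H T \<longleftrightarrow> (\<forall>t\<ge>0. \<forall>u\<in>H. norm (T t u) \<le> exp (\<omega> * t) * norm u)"

definition quasi_contractive :: "'a::complex_inner set \<Rightarrow> (real \<Rightarrow> 'a \<Rightarrow> 'a) \<Rightarrow> bool"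
  where "quasi_contractive H T \<longleftrightarrow> (\<exists>\<omega>. growth_bounded \<omega> H T)"

definition contractive :: "'a::complex_inner set \<Rightarrow> (real \<Rightarrow> 'a \<Rightarrow> 'a) \<Rightarrow> bool"
  where "contractive H T \<longleftrightarrow> growth_bounded 0 H T"


section \<open>Sobolev spaces on an interval\<close>

text \<open>
  \<open>L\<^sup>2(0,b)\<close> is realised as the subspace of \<open>L\<^sup>2(\<real>)\<close> of classes vanishing almost everywhere
  outside the interval.
\<close>

definition L2_interval :: "real \<Rightarrow> l2 set"
  where "L2_interval b = {u. AE x in lborel. x \<notin> {0<..<b} \<longrightarrow> rep_l2 u x = 0}"

text \<open>\<open>test_function b \<phi> \<phi>'\<close>: \<open>\<phi>\<close> is continuously differentiable with derivative \<open>\<phi>'\<close> and has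
  compact support in \<open>(0,b)\<close>.\<close>

definition test_function :: "real \<Rightarrow> (real \<Rightarrow> complex) \<Rightarrow> (real \<Rightarrow> complex) \<Rightarrow> bool"
  where "test_function b \<phi> \<phi>' \<longleftrightarrow>
    (\<forall>x. (\<phi> has_vector_derivative \<phi>' x) (at x)) \<and> continuous_on UNIV \<phi>' \<and>
    (\<exists>s t. 0 < s \<and> t < b \<and> (\<forall>x. x \<notin> {s..t} \<longrightarrow> \<phi> x = 0))"

definition has_weak_derivative :: "real \<Rightarrow> l2 \<Rightarrow> l2 \<Rightarrow> bool"
  where "has_weak_derivative b u v \<longleftrightarrow>
    u \<in> L2_interval b \<and> v \<in> L2_interval b \<and>
    (\<forall>\<phi> \<phi>'. test_function b \<phi> \<phi>' \<longrightarrow>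
      (LINT x:{0<..<b}|lborel. rep_l2 u x * \<phi>' x) = - (LINT x:{0<..<b}|lborel. rep_l2 v x * \<phi> x))"

definition weak_derivative :: "real \<Rightarrow> l2 \<Rightarrow> l2"
  where "weak_derivative b u = (THE v. has_weak_derivative b u v)"

definition H1_interval :: "real \<Rightarrow> l2 set"
  where "H1_interval b = {u. \<exists>v. has_weak_derivative b u v}"

definition H2_interval :: "real \<Rightarrow> l2 set"
  where "H2_interval b = {u \<in> H1_interval b. weak_derivative b u \<in> H1_interval b}"

text \<open>The value at \<open>x \<in> [0,b]\<close> of the continuous representative on \<open>[0,b]\<close>.\<close>

definition trace_at :: "real \<Rightarrow> l2 \<Rightarrow> real \<Rightarrow> complex"
  where "trace_at b u x = (THE y. \<exists>g. continuous_on {0..b} g \<and>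
    (AE s in lborel. s \<in> {0<..<b} \<longrightarrow> g s = rep_l2 u s) \<and> y = g x)"


section \<open>The metric graph, its boundary space, and the operator\<close>

text \<open>
  The edges are the elements of a finite type \<open>'e\<close>; \<open>Ed\<close> is the set of diffusion edges, \<open>- Ed\<close> the
  set of transport edges (either may be empty), and \<open>a e\<close> is the length of the edge \<open>e\<close>.
\<close>

definition L2_graph :: "('e::finite \<Rightarrow> real) \<Rightarrow> (l2 ^ 'e) set"
  where "L2_graph a = {u. \<forall>e. u $ e \<in> L2_interval (a e)}"

text \<open>
  In the boundary index type \<open>'e + 'e + 'e\<close> the three summands carry the components in
  \<open>\<H>\<^sub>d\<^sup>+\<close>, \<open>\<H>\<^sub>d\<^sup>-\<close> and \<open>\<H>\<^sub>t\<close>. Only the indices in \<open>boundary_index Ed\<close>, of which there are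
  \<open>2 * card Ed + card (- Ed)\<close>, are meaningful; vectors and matrices vanish at all others.
\<close>

definition boundary_index :: "'e::finite set \<Rightarrow> ('e + 'e + 'e) set"
  where "boundary_index Ed = Inl ` Ed \<union> (Inr \<circ> Inl) ` Ed \<union> (Inr \<circ> Inr) ` (- Ed)"

definition boundary_space :: "'e::finite set \<Rightarrow> (complex ^ ('e + 'e + 'e)) set"
  where "boundary_space Ed = {x. \<forall>k. k \<notin> boundary_index Ed \<longrightarrow> x $ k = 0}"

definition boundary_matrix ::
    "'e::finite set \<Rightarrow> complex ^ ('e + 'e + 'e) ^ ('e + 'e + 'e) \<Rightarrow> bool"
  where "boundary_matrix Ed M \<longleftrightarrow>
    (\<forall>j k. j \<notin> boundary_index Ed \<or> k \<notin> boundary_index Ed \<longrightarrow> M $ j $ k = 0)"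

definition orthogonal_projector ::
    "'e::finite set \<Rightarrow> complex ^ ('e + 'e + 'e) ^ ('e + 'e + 'e) \<Rightarrow> bool"
  where "orthogonal_projector Ed P \<longleftrightarrow> boundary_matrix Ed P \<and> P ** P = P \<and>
    (\<forall>x\<in>boundary_space Ed. \<forall>y\<in>boundary_space Ed. cinner (P *v x) y = cinner x (P *v y))"

text \<open>\<open>L\<close> maps \<open>Ker P\<close> to itself and is the extension by zero on the range of \<open>P\<close>, the orthogonal
  complement of \<open>Ker P\<close>.\<close>

definition operator_on_kernel ::
    "'e::finite set \<Rightarrow> complex ^ ('e + 'e + 'e) ^ ('e + 'e + 'e) \<Rightarrow>
      complex ^ ('e + 'e + 'e) ^ ('e + 'e + 'e) \<Rightarrow> bool"
  where "operator_on_kernel Ed P L \<longleftrightarrow> boundary_matrix Ed L \<and>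
    (\<forall>x\<in>boundary_space Ed. P *v x = 0 \<longrightarrow> P *v (L *v x) = 0) \<and>
    (\<forall>x\<in>boundary_space Ed. L *v (P *v x) = 0)"

definition bvalues :: "('e::finite \<Rightarrow> real) \<Rightarrow> 'e set \<Rightarrow> l2 ^ 'e \<Rightarrow> complex ^ ('e + 'e + 'e)"
  where "bvalues a Ed u = (\<chi> k. case k of
      Inl e \<Rightarrow> if e \<in> Ed then trace_at (a e) (u $ e) (a e) else 0
    | Inr (Inl e) \<Rightarrow> if e \<in> Ed then trace_at (a e) (u $ e) 0 else 0
    | Inr (Inr e) \<Rightarrow> if e \<in> Ed then 0
        else (trace_at (a e) (u $ e) (a e) + trace_at (a e) (u $ e) 0) / complex_of_real (sqrt 2))"

definition bderivs :: "('e::finite \<Rightarrow> real) \<Rightarrow> 'e set \<Rightarrow> l2 ^ 'e \<Rightarrow> complex ^ ('e + 'e + 'e)"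
  where "bderivs a Ed u = (\<chi> k. case k of
      Inl e \<Rightarrow> if e \<in> Ed then trace_at (a e) (weak_derivative (a e) (u $ e)) (a e) else 0
    | Inr (Inl e) \<Rightarrow> if e \<in> Ed then - trace_at (a e) (weak_derivative (a e) (u $ e)) 0 else 0
    | Inr (Inr e) \<Rightarrow> if e \<in> Ed then 0
        else (- trace_at (a e) (u $ e) (a e) + trace_at (a e) (u $ e) 0) / complex_of_real (sqrt 2))"

definition graph_domain ::
    "('e::finite \<Rightarrow> real) \<Rightarrow> 'e set \<Rightarrow> complex ^ ('e + 'e + 'e) ^ ('e + 'e + 'e) \<Rightarrow>
      complex ^ ('e + 'e + 'e) ^ ('e + 'e + 'e) \<Rightarrow> (l2 ^ 'e) set"
  where "graph_domain a Ed P L = {u.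
    (\<forall>e\<in>Ed. u $ e \<in> H2_interval (a e)) \<and> (\<forall>e\<in>- Ed. u $ e \<in> H1_interval (a e)) \<and>
    (mat 1 - P) *v bderivs a Ed u + (L + P) *v bvalues a Ed u = 0}"

definition graph_operator :: "('e::finite \<Rightarrow> real) \<Rightarrow> 'e set \<Rightarrow> l2 ^ 'e \<Rightarrow> l2 ^ 'e"
  where "graph_operator a Ed u = (\<chi> e.
    if e \<in> Ed then weak_derivative (a e) (weak_derivative (a e) (u $ e))
    else - weak_derivative (a e) (u $ e))"

definition real_entries :: "complex ^ 'n ^ 'm \<Rightarrow> bool"
  where "real_entries M \<longleftrightarrow> (\<forall>j k. M $ j $ k \<in> \<real>)"

definition real_valued :: "l2 ^ 'e \<Rightarrow> bool"
  where "real_valued u \<longleftrightarrow> (\<forall>e. AE x in lborel. rep_l2 (u $ e) x \<in> \<real>)"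

definition real_semigroup :: "(l2 ^ 'e::finite) set \<Rightarrow> (real \<Rightarrow> l2 ^ 'e \<Rightarrow> l2 ^ 'e) \<Rightarrow> bool"
  where "real_semigroup H T \<longleftrightarrow> (\<forall>t\<ge>0. \<forall>u\<in>H. real_valued u \<longrightarrow> real_valued (T t u))"

end

theory Submission
  imports Defs
begin

text \<open>
  Integration by parts gives \<open>Re \<langle>A u, u\<rangle> = - Re \<langle>L x, x\<rangle> - \<parallel>u\<^sub>d'\<parallel>\<^sup>2\<close> on the domain, where \<open>x \<in> Ker P\<close>
  is the vector of boundary values of \<open>u\<close>. The hypothesis on \<open>L\<close> involves only the diffusion
  components of \<open>x\<close>, and these are controlled by \<open>\<epsilon> \<parallel>u\<^sub>d'\<parallel>\<^sup>2 + C \<parallel>u\<^sub>d\<parallel>\<^sup>2\<close>, so that \<open>A\<close> is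
  quasi-dissipative. For \<open>\<mu>\<close> beyond the dissipativity constant the equation \<open>\<mu> u - A u = f\<close> is
  solved on each edge with arbitrary initial data; the boundary condition is then a square linear
  system for these data, which is injective by dissipativity and hence solvable. The Lumer--Phillips
  theorem provides the semigroup as the limit of the implicit Euler scheme. The resolvents commute with
  complex conjugation if \<open>P\<close> and \<open>L\<close> are real, and so does every limit of products of them; since a
  dissipative operator generates at most one semigroup, any semigroup generated by \<open>A\<close> is real.
\<close>

section \<open>The Lumer--Phillips theorem in Hilbert space\<close>

text \<open>On a transport edge the form \<open>Re (cinner (A u) u)\<close> yields only boundary
  terms: there is no \<open>- (norm u')\<^sup>2\<close> to absorb anything, and end values are not
  bounded by the norm of u, so a growth bound can draw on diffusion values alone. The weights 1 /
  sqrt 2 in the boundary vectors turn these boundary terms into the standard pairing of the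
  transport components, so that one pairing of \<open>bderivs\<close> with \<open>bvalues\<close>
  treats all edges alike. The Euler scheme suits the claim on real functions because its
  approximations are powers of resolvents: a closed set preserved by the resolvents is preserved by
  the limit. The error of the scheme is governed by A^2, hence convergence is first proved on the
  domain of A^2 and then extended by contractivity. Reality is claimed for an arbitrary semigroup
  generated by A, of which each single operator is known to be bounded but nothing uniform in time;
  local boundedness, and with it continuity of orbits, must be recovered by a uniform boundedness
  argument before two orbits can be compared.\<close>

lemma csubspace_imp_subspace: "csubspace S \<Longrightarrow> subspace S"
  by (metis csubspace_def scaleC_of_real subspace_def)

lemma csubspace_scaleC: "csubspace S \<Longrightarrow> x \<in> S \<Longrightarrow> c *\<^sub>C x \<in> S"
  by (simp add: csubspace_def)

lemma cinner_scaleC_right: "cinner x (c *\<^sub>C y) = cnj c * cinner x y"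
  by (metis cinner_commute cinner_scaleC_left complex_cnj_mult)

lemma norm_scaleC: "norm (c *\<^sub>C x) = cmod c * norm x"
proof -
  have "(norm (c *\<^sub>C x))\<^sup>2 = Re (cinner (c *\<^sub>C x) (c *\<^sub>C x))"
    by (simp add: Re_cinner power2_norm_eq_inner)
  also have "\<dots> = Re (complex_of_real ((cmod c)\<^sup>2) * cinner x x)"
    by (simp only: cinner_scaleC_left cinner_scaleC_right complex_norm_square mult_ac)
  also have "\<dots> = (cmod c * norm x)\<^sup>2"
    by (simp add: Re_cinner power_mult_distrib power2_norm_eq_inner)
  finally show ?thesis by (simp add: power2_eq_iff_nonneg)
qed

lemma scaleC_diff_right: "c *\<^sub>C (x - y) = c *\<^sub>C x - c *\<^sub>C y"
  by (metis add_diff_cancel diff_add_cancel scaleC_add_right)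

lemma bounded_linear_scaleC: "bounded_linear (\<lambda>x. c *\<^sub>C x)"
proof (rule bounded_linear_intro)
  show "c *\<^sub>C r *\<^sub>R x = r *\<^sub>R c *\<^sub>C x" for r x
    by (simp add: scaleC_of_real[symmetric] scaleC_scaleC mult.commute)
  show "norm (c *\<^sub>C x) \<le> norm x * cmod c" for x
    by (simp add: norm_scaleC)
qed (rule scaleC_add_right)

lemmas tendsto_scaleC = bounded_linear.tendsto[OF bounded_linear_scaleC]

text \<open>A minimising sequence for the distance from f to M converges to some g in the closure of
  M, and f - g is orthogonal to M, so the hypothesis makes it 0. This serves to derive density of
  the domain from dissipativity.\<close>

lemma closed_subspace_dense_if_orthogonal_trivial:
  fixes M :: "'a::{real_inner, banach} set"
  assumes M: "subspace M" and HM: "subspace H" "closed H" "M \<subseteq> H"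
    and triv: "\<And>h. h \<in> H \<Longrightarrow> (\<And>w. w \<in> M \<Longrightarrow> inner h w = 0) \<Longrightarrow> h = 0"
  shows "H \<subseteq> closure M"
proof
  fix f assume f: "f \<in> H"
  define d where "d = infdist f M"
  have M0: "M \<noteq> {}" using subspace_0[OF M] by auto
  have d0: "0 \<le> d" by (simp add: d_def infdist_nonneg)
  have dle: "d \<le> norm (f - w)" if "w \<in> M" for w
    using infdist_le[OF that, of f] by (simp add: d_def dist_norm)
  have "\<exists>w\<in>M. norm (f - w) < d + e" if "e > 0" for e
  proof -
    have "infdist f M < d + e" using that by (simp add: d_def)
    then show ?thesis
      using M0 cInf_lessD[of "dist f ` M" "d + e"] by (auto simp: infdist_def dist_norm image_def)
  qed
  then have "\<forall>n. \<exists>w\<in>M. norm (f - w) < d + 1 / real (Suc n)" by simp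
  then obtain w where wM: "\<And>n. w n \<in> M" and w: "\<And>n. norm (f - w n) < d + 1 / real (Suc n)"
    by metis
  have lim: "(\<lambda>n. norm (f - w n)) \<longlonglongrightarrow> d"
  proof (rule tendsto_sandwich[of "\<lambda>n. d" _ _ "\<lambda>n. d + 1 / real (Suc n)"])
    show "(\<lambda>n. d + 1 / real (Suc n)) \<longlonglongrightarrow> d"
      using LIMSEQ_inverse_real_of_nat_add[of d] by (simp add: inverse_eq_divide)
  qed (use dle wM w in \<open>auto intro!: always_eventually less_imp_le\<close>)
  have par: "(norm (w m - w n))\<^sup>2 \<le> 2 * ((norm (f - w m))\<^sup>2 - d\<^sup>2) + 2 * ((norm (f - w n))\<^sup>2 - d\<^sup>2)"
    for m n
  proof -
    \<comment> \<open>Parallelogram law: the midpoint of two near-minimisers lies in M again, thus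
      at distance at least d, which leaves little room between them.\<close>
    have "(1/2) *\<^sub>R (w m + w n) \<in> M"
      by (intro subspace_scale[OF M] subspace_add[OF M] wM)
    from dle[OF this] have "d\<^sup>2 \<le> (norm (f - (1/2) *\<^sub>R (w m + w n)))\<^sup>2"
      using d0 by (intro power_mono)
    then show ?thesis
      by (simp add: power2_norm_eq_inner inner_diff_left inner_diff_right inner_add_left
          inner_add_right inner_commute algebra_simps)
  qed
  have "Cauchy w"
  proof (rule metric_CauchyI)
    fix e :: real assume e: "e > 0"
    have "(\<lambda>n. (norm (f - w n))\<^sup>2 - d\<^sup>2) \<longlonglongrightarrow> d\<^sup>2 - d\<^sup>2"
      by (intro tendsto_intros lim)
    then have "\<forall>\<^sub>F n in sequentially. (norm (f - w n))\<^sup>2 - d\<^sup>2 < e\<^sup>2 / 4"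
      by (rule order_tendstoD) (use e in simp)
    then obtain N where N: "\<And>n. n \<ge> N \<Longrightarrow> (norm (f - w n))\<^sup>2 - d\<^sup>2 < e\<^sup>2 / 4"
      by (auto simp: eventually_sequentially)
    have "dist (w m) (w n) < e" if "m \<ge> N" "n \<ge> N" for m n
    proof -
      have "(norm (w m - w n))\<^sup>2 < e\<^sup>2"
        using par[of m n] N[OF that(1)] N[OF that(2)] by argo
      then show ?thesis using e by (simp add: dist_norm power_less_imp_less_base)
    qed
    then show "\<exists>N. \<forall>m\<ge>N. \<forall>n\<ge>N. dist (w m) (w n) < e" by blast
  qed
  then obtain g where g: "w \<longlonglongrightarrow> g" by (auto simp: Cauchy_convergent_iff convergent_def)
  then have gc: "g \<in> closure M" using wM by (auto simp: closure_sequential)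
  have gH: "g \<in> H" using closed_sequentially[OF HM(2) _ g] wM HM(3) by blast
  have "(\<lambda>n. norm (f - w n)) \<longlonglongrightarrow> norm (f - g)" by (intro tendsto_intros g)
  with lim have nd: "norm (f - g) = d" using LIMSEQ_unique by blast
  have "f - g = 0"
  proof (rule triv)
    show "f - g \<in> H" by (rule subspace_diff[OF HM(1) f gH])
    fix v assume v: "v \<in> M"
    have ge: "d \<le> norm (f - g - r *\<^sub>R v)" for r
    proof (rule tendsto_lowerbound)
      show "(\<lambda>n. norm (f - w n - r *\<^sub>R v)) \<longlonglongrightarrow> norm (f - g - r *\<^sub>R v)" by (intro tendsto_intros g)
      have "d \<le> norm (f - (w n + r *\<^sub>R v))" for n
        by (intro dle subspace_add[OF M] subspace_scale[OF M] wM v)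
      then show "\<forall>\<^sub>F n in sequentially. d \<le> norm (f - w n - r *\<^sub>R v)"
        by (simp add: diff_diff_add)
    qed simp
    show "inner (f - g) v = 0"
    proof (cases "v = 0")
      case False
      \<comment> \<open>The minimiser of \<open>norm (f - g - r *\<^sub>R v)\<close> over r; it
        would lower the squared distance by
        \<open>(inner (f - g) v)\<^sup>2 / (norm v)\<^sup>2\<close>.\<close>
      define r where "r = inner (f - g) v / (norm v)\<^sup>2"
      have "d\<^sup>2 \<le> (norm (f - g - r *\<^sub>R v))\<^sup>2" using ge d0 by (intro power_mono)
      also have "\<dots> = (norm (f - g))\<^sup>2 - 2 * r * inner (f - g) v + r * r * (norm v)\<^sup>2"
        by (simp add: power2_norm_eq_inner inner_diff_left inner_diff_right inner_commute algebra_simps)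
      also have "\<dots> = d\<^sup>2 - (inner (f - g) v)\<^sup>2 / (norm v)\<^sup>2"
        using False by (simp add: nd r_def power2_eq_square field_simps)
      finally show ?thesis using False by (simp add: divide_le_0_iff)
    qed simp
  qed
  with gc show "f \<in> closure M" by simp
qed

lemma convergent_if_geometric_steps:
  fixes f :: "nat \<Rightarrow> 'a::banach"
  assumes "\<And>k. norm (f (Suc k) - f k) \<le> C * (1/2) ^ k"
  shows "convergent f"
proof -
  have "summable (\<lambda>k. f (Suc k) - f k)"
    by (rule summable_comparison_test'[of "\<lambda>k. C * (1/2) ^ k" 0])
      (use assms in \<open>auto intro: summable_mult summable_geometric\<close>)
  then have "convergent (\<lambda>n. f n - f 0)"
    by (simp add: summable_iff_convergent sum_lessThan_telescope)
  then show ?thesis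
    using convergent_add_const_iff[of "- f 0" f] by (simp add: add.commute)
qed

text \<open>The range condition is demanded for all h > 0 and not for one, because the application
  solves the resolvent equation for every \<mu> beyond the growth constant; no continuation in the
  resolvent parameter is then involved. As \<open>inner\<close> is the real part of
  \<open>cinner\<close>, dissipativity can be stated with the real inner product.\<close>

locale m_dissipative_operator =
  fixes H D :: "'a::{complex_inner, banach} set" and A :: "'a \<Rightarrow> 'a"
  assumes closed_H: "closed H" and csubspace_H: "csubspace H"
    and linear_A: "linear_operator_in H D A"
    and inner_A_le_0: "u \<in> D \<Longrightarrow> inner (A u) u \<le> 0"
    and range_cond: "h > 0 \<Longrightarrow> f \<in> H \<Longrightarrow> \<exists>u\<in>D. u - h *\<^sub>R A u = f"
begin

lemma subspace_H: "subspace H" and subspace_D: "subspace D" and D_sub: "D \<subseteq> H"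
  and csubspace_D: "csubspace D"
  using csubspace_H linear_A csubspace_imp_subspace by (auto simp: linear_operator_in_def)

lemma A_in_H: "u \<in> D \<Longrightarrow> A u \<in> H"
  and A_add: "u \<in> D \<Longrightarrow> v \<in> D \<Longrightarrow> A (u + v) = A u + A v"
  and A_scaleC: "u \<in> D \<Longrightarrow> A (c *\<^sub>C u) = c *\<^sub>C A u"
  using linear_A by (auto simp: linear_operator_in_def)

lemma A_scaleR: "u \<in> D \<Longrightarrow> A (r *\<^sub>R u) = r *\<^sub>R A u"
  by (metis A_scaleC scaleC_of_real)

lemma A_diff: "u \<in> D \<Longrightarrow> v \<in> D \<Longrightarrow> A (u - v) = A u - A v"
  using A_add[of "u - v" v] subspace_diff[OF subspace_D, of u v] by simp

text \<open>Test with u and drop the nonnegative term \<open>- h * inner (A u) u\<close>. Uniqueness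
  for the resolvent equation and contractivity of the resolvent both come from here.\<close>

lemma norm_le_norm_resolvent:
  assumes "u \<in> D" "h \<ge> 0" shows "norm u \<le> norm (u - h *\<^sub>R A u)"
proof -
  have "norm u * norm u \<le> inner (u - h *\<^sub>R A u) u"
    using inner_A_le_0[OF assms(1)] assms(2)
    by (simp add: inner_diff_left power2_norm_eq_inner flip: power2_eq_square)
      (simp add: mult_nonneg_nonpos)
  also have "\<dots> \<le> norm (u - h *\<^sub>R A u) * norm u" by (rule norm_cauchy_schwarz)
  finally show ?thesis by (cases "u = 0") auto
qed

lemma resolvent_unique:
  assumes "u \<in> D" "v \<in> D" "h \<ge> 0" "u - h *\<^sub>R A u = v - h *\<^sub>R A v" shows "u = v"
proof -
  have "(u - v) - h *\<^sub>R A (u - v) = (u - h *\<^sub>R A u) - (v - h *\<^sub>R A v)"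
    by (simp add: A_diff assms(1,2) scaleR_diff_right)
  then have "(u - v) - h *\<^sub>R A (u - v) = 0" using assms(4) by (simp only: diff_self)
  then show ?thesis
    using norm_le_norm_resolvent[OF subspace_diff[OF subspace_D assms(1,2)] assms(3)] by simp
qed

text \<open>The resolvent (1 - h A)^(-1) on H, that is, one implicit Euler step of size h.\<close>

definition J :: "real \<Rightarrow> 'a \<Rightarrow> 'a" where "J h f = (THE u. u \<in> D \<and> u - h *\<^sub>R A u = f)"

lemma J_unique:
  assumes "u \<in> D" "h > 0" "u - h *\<^sub>R A u = f" shows "J h f = u"
  unfolding J_def
proof (rule the_equality)
  fix v assume "v \<in> D \<and> v - h *\<^sub>R A v = f"
  then show "v = u" using resolvent_unique[of v u h] assms by simp
qed (use assms in simp)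

lemma J_in_D: "h > 0 \<Longrightarrow> f \<in> H \<Longrightarrow> J h f \<in> D"
  and J_eq: "h > 0 \<Longrightarrow> f \<in> H \<Longrightarrow> J h f - h *\<^sub>R A (J h f) = f"
  by (metis range_cond J_unique)+

lemma J_in_H: "h > 0 \<Longrightarrow> f \<in> H \<Longrightarrow> J h f \<in> H"
  using J_in_D D_sub by auto

lemma norm_J_le: "h > 0 \<Longrightarrow> f \<in> H \<Longrightarrow> norm (J h f) \<le> norm f"
  by (metis norm_le_norm_resolvent J_in_D J_eq less_imp_le)

lemma J_add:
  assumes "h > 0" "f \<in> H" "g \<in> H" shows "J h (f + g) = J h f + J h g"
proof (rule J_unique)
  have "J h f + J h g - h *\<^sub>R A (J h f + J h g)
      = (J h f - h *\<^sub>R A (J h f)) + (J h g - h *\<^sub>R A (J h g))"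
    using assms by (simp add: J_in_D A_add scaleR_add_right)
  then show "J h f + J h g - h *\<^sub>R A (J h f + J h g) = f + g" using assms by (simp add: J_eq)
qed (use assms in \<open>auto intro: subspace_add[OF subspace_D] J_in_D\<close>)

lemma J_scaleC:
  assumes "h > 0" "f \<in> H" shows "J h (c *\<^sub>C f) = c *\<^sub>C J h f"
proof (rule J_unique)
  have "c *\<^sub>C f = c *\<^sub>C (J h f - h *\<^sub>R A (J h f))" using assms by (simp add: J_eq)
  then show "c *\<^sub>C J h f - h *\<^sub>R A (c *\<^sub>C J h f) = c *\<^sub>C f"
    using assms by (simp add: A_scaleC J_in_D scaleC_diff_right scaleC_scaleC mult.commute
        flip: scaleC_of_real)
qed (use assms J_in_D csubspace_D in \<open>auto intro: csubspace_scaleC\<close>)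

lemma J_diff:
  assumes "h > 0" "f \<in> H" "g \<in> H" shows "J h (f - g) = J h f - J h g"
  using J_add[OF assms(1) subspace_diff[OF subspace_H assms(2,3)] assms(3)]
  unfolding diff_add_cancel eq_diff_eq by (rule sym)

text \<open>The resolvent equation reads \<open>A y = (1/h) *\<^sub>R (y - x)\<close> for y =
  \<open>J h x\<close>, so A y is in D when x is, and applying A once more gives the
  commutation.\<close>

lemma A_J:
  assumes "h > 0" "x \<in> D" shows "A (J h x) \<in> D" and "A (J h x) = J h (A x)"
proof -
  let ?y = "J h x"
  have xH: "x \<in> H" using assms D_sub by auto
  have yD: "?y \<in> D" using J_in_D assms xH by simp
  have "?y - h *\<^sub>R A ?y = x" using J_eq assms xH by simp
  then have "?y - x = h *\<^sub>R A ?y" by (simp add: diff_eq_eq eq_diff_eq add.commute)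
  then have e: "A ?y = (1/h) *\<^sub>R (?y - x)" using assms by simp
  show 1: "A ?y \<in> D"
    unfolding e by (intro subspace_scale[OF subspace_D] subspace_diff[OF subspace_D] yD assms)
  have "A (A ?y) = (1/h) *\<^sub>R (A ?y - A x)"
    by (subst e) (simp add: A_scaleR A_diff yD assms subspace_diff[OF subspace_D])
  then have "A ?y - h *\<^sub>R A (A ?y) = A x" using assms by simp
  then show "A ?y = J h (A x)" by (rule J_unique[OF 1 assms(1), symmetric])
qed

lemma J_minus_id:
  assumes "h > 0" "x \<in> D" shows "J h x - x = h *\<^sub>R J h (A x)"
proof -
  have swap: "p - q = r \<Longrightarrow> p - r = q" for p q r :: 'a by auto
  have "x \<in> H" using assms D_sub by blast
  then show ?thesis using swap[OF J_eq[OF assms(1)]] A_J(2)[OF assms] by (simp only:)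
qed

lemma norm_J_minus_id_le:
  assumes "h > 0" "x \<in> D" shows "norm (J h x - x) \<le> h * norm (A x)"
  unfolding J_minus_id[OF assms] using assms(1) norm_J_le[OF assms(1) A_in_H[OF assms(2)]] by simp

text \<open>If h is orthogonal to D, then u = \<open>J 1 h\<close>, itself in D, satisfies 0 = (u -
  A u, u), whence (u, u) = (A u, u) <= 0 and u = 0.\<close>

lemma D_dense: "H \<subseteq> closure D"
proof (rule closed_subspace_dense_if_orthogonal_trivial[OF subspace_D subspace_H closed_H D_sub])
  fix h assume h: "h \<in> H" and o: "\<And>w. w \<in> D \<Longrightarrow> inner h w = 0"
  have u: "J 1 h \<in> D" by (rule J_in_D[OF zero_less_one h])
  have e: "J 1 h - A (J 1 h) = h" using J_eq[OF zero_less_one h] by (simp only: scaleR_one)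
  have "0 = inner (J 1 h - A (J 1 h)) (J 1 h)" using o[OF u] by (simp only: e)
  then have "inner (J 1 h) (J 1 h) \<le> 0"
    using inner_A_le_0[OF u] unfolding inner_diff_left by linarith
  then have "J 1 h = 0" using inner_gt_zero_iff[of "J 1 h"] by linarith
  then show "h = 0" using e A_scaleR[of 0 0] subspace_0[OF subspace_D] by simp
qed

text \<open>The resolvent supplies the candidate: for a limit (x, y) of graph points, w =
  \<open>J 1 (x - y)\<close> is in D, and the resolvent estimate makes the first components converge
  to w, so x = w.\<close>

lemma closed_A: "closed_operator D A"
  unfolding closed_operator_def closed_sequential_limits
proof (intro allI impI, elim conjE)
  fix p l assume p: "\<forall>n. p n \<in> {(x, A x) |x. x \<in> D}" and lim: "p \<longlonglongrightarrow> l"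
  define u where "u n = fst (p n)" for n
  have u: "u n \<in> D" "p n = (u n, A (u n))" for n using p[rule_format, of n] by (auto simp: u_def)
  have lu: "u \<longlonglongrightarrow> fst l" and lA: "(\<lambda>n. A (u n)) \<longlonglongrightarrow> snd l"
    using tendsto_fst[OF lim] tendsto_snd[OF lim] by (simp_all add: u)
  have H: "fst l \<in> H" "snd l \<in> H"
    using closed_sequentially[OF closed_H _ lu] closed_sequentially[OF closed_H _ lA] u A_in_H D_sub
    by auto
  define w where "w = J 1 (fst l - snd l)"
  have w: "w \<in> D" "w - A w = fst l - snd l"
    using J_in_D[OF zero_less_one subspace_diff[OF subspace_H H]]
      J_eq[OF zero_less_one subspace_diff[OF subspace_H H]]
    by (simp_all only: w_def scaleR_one)
  have "u \<longlonglongrightarrow> w"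
  proof (rule LIM_zero_cancel, rule Lim_null_comparison)
    have "norm (u n - w) \<le> norm ((u n - A (u n)) - (fst l - snd l))" for n
    proof -
      have "(u n - w) - 1 *\<^sub>R A (u n - w) = (u n - A (u n)) - (w - A w)"
        by (simp add: A_diff u w(1))
      then show ?thesis
        using norm_le_norm_resolvent[OF subspace_diff[OF subspace_D u(1)[of n] w(1)], of 1]
        by (simp only: w(2))
    qed
    then show "\<forall>\<^sub>F n in sequentially. norm (u n - w) \<le> norm ((u n - A (u n)) - (fst l - snd l))"
      by simp
    show "(\<lambda>n. norm ((u n - A (u n)) - (fst l - snd l))) \<longlonglongrightarrow> 0"
      by (rule tendsto_norm_zero, rule LIM_zero, rule tendsto_diff[OF lu lA])
  qed
  then have "w = fst l" using LIMSEQ_unique lu by blast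
  then show "l \<in> {(x, A x) |x. x \<in> D}" using w by (auto intro!: exI[of _ w] prod_eqI)
qed

section \<open>Powers of the resolvent and comparison of step sizes\<close>

lemma J_pow_in_H: "h > 0 \<Longrightarrow> x \<in> H \<Longrightarrow> (J h ^^ n) x \<in> H"
  by (induction n) (auto intro: J_in_H)

lemma J_pow_in_D: "h > 0 \<Longrightarrow> x \<in> D \<Longrightarrow> (J h ^^ n) x \<in> D"
  by (induction n) (use D_sub in \<open>auto intro!: J_in_D\<close>)

lemma norm_J_pow_le: "h > 0 \<Longrightarrow> x \<in> H \<Longrightarrow> norm ((J h ^^ n) x) \<le> norm x"
proof (induction n)
  case (Suc n)
  then show ?case using norm_J_le[OF Suc.prems(1) J_pow_in_H[OF Suc.prems], of n] by simp
qed simp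

lemma J_pow_add: "h > 0 \<Longrightarrow> x \<in> H \<Longrightarrow> y \<in> H \<Longrightarrow> (J h ^^ n) (x + y) = (J h ^^ n) x + (J h ^^ n) y"
  by (induction n) (simp_all add: J_add J_pow_in_H)

lemma J_pow_diff: "h > 0 \<Longrightarrow> x \<in> H \<Longrightarrow> y \<in> H \<Longrightarrow> (J h ^^ n) (x - y) = (J h ^^ n) x - (J h ^^ n) y"
  by (induction n) (simp_all add: J_diff J_pow_in_H)

lemma J_pow_scaleC: "h > 0 \<Longrightarrow> x \<in> H \<Longrightarrow> (J h ^^ n) (c *\<^sub>C x) = c *\<^sub>C (J h ^^ n) x"
  by (induction n) (simp_all add: J_scaleC J_pow_in_H)

lemma A_J_pow: "h > 0 \<Longrightarrow> x \<in> D \<Longrightarrow> A ((J h ^^ n) x) = (J h ^^ n) (A x)"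
  by (induction n) (simp_all add: A_J(2) J_pow_in_D)

lemma norm_J_pow_diff_le:
  "h > 0 \<Longrightarrow> x \<in> H \<Longrightarrow> y \<in> H \<Longrightarrow> norm ((J h ^^ n) x - (J h ^^ n) y) \<le> norm (x - y)"
  using norm_J_pow_le[of h "x - y" n] subspace_diff[OF subspace_H, of x y] by (simp add: J_pow_diff)

text \<open>Since A commutes with the powers, \<open>norm (A ((J h ^^ n) x))\<close> never exceeds
  \<open>norm (A x)\<close>: each step of size h moves by at most h times that speed.\<close>

lemma norm_J_pow_minus_id_le:
  assumes "h > 0" "x \<in> D" shows "norm ((J h ^^ n) x - x) \<le> real n * h * norm (A x)"
proof (induction n)
  case (Suc n)
  have "norm (J h ((J h ^^ n) x) - (J h ^^ n) x) \<le> h * norm (A ((J h ^^ n) x))"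
    by (rule norm_J_minus_id_le[OF assms(1) J_pow_in_D[OF assms]])
  also have "\<dots> \<le> h * norm (A x)"
    using assms norm_J_pow_le[OF assms(1) A_in_H[OF assms(2)]] by (simp add: A_J_pow)
  finally have "norm ((J h ^^ Suc n) x - (J h ^^ n) x) \<le> h * norm (A x)" by simp
  then have "norm (((J h ^^ Suc n) x - (J h ^^ n) x) + ((J h ^^ n) x - x))
      \<le> h * norm (A x) + real n * h * norm (A x)"
    using Suc by (intro norm_triangle_le add_mono)
  then show ?case by (simp add: algebra_simps)
qed simp

text \<open>Two steps of size h against one of size 2 h: z = \<open>J h (J h x)\<close> solves the
  equation of the double step up to the residual \<open>h\<^sup>2 *\<^sub>R A (A z)\<close>, and the
  resolvent estimate bounds the error by the residual.\<close>

lemma J_twice_minus_J_double: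
  assumes h: "h > 0" and x: "x \<in> D" "A x \<in> D"
  shows "norm (J h (J h x) - J (2 * h) x) \<le> h\<^sup>2 * norm (A (A x))"
proof -
  have xH: "x \<in> H" and AxH: "A x \<in> H" and AAxH: "A (A x) \<in> H"
    using x D_sub A_in_H by auto
  define y where "y = J h x"
  define z where "z = J h y"
  have y: "y \<in> D" and yH: "y \<in> H" using J_in_D[OF h xH] D_sub by (auto simp: y_def)
  have z: "z \<in> D" using J_in_D[OF h yH] by (simp add: z_def)
  have yx: "y - h *\<^sub>R A y = x" using J_eq[OF h xH] by (simp only: y_def)
  have zy: "z - h *\<^sub>R A z = y" using J_eq[OF h yH] by (simp only: z_def)
  have Az: "A z = J h (J h (A x))" by (simp add: z_def A_J(2)[OF h y[unfolded y_def]] y_def A_J(2)[OF h x(1)])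
  have AzD: "A z \<in> D" unfolding z_def by (rule A_J(1)[OF h y])
  \<comment> \<open>A^2 commutes with the resolvents as well, so the residual can be measured at the
    initial value x.\<close>
  have "A (A z) = J h (J h (A (A x)))"
    using A_J(2)[OF h J_in_D[OF h AxH]] A_J(2)[OF h x(2)] by (simp add: Az)
  then have n: "norm (A (A z)) \<le> norm (A (A x))"
    using norm_J_le[OF h J_in_H[OF h AAxH]] norm_J_le[OF h AAxH] by simp
  have Azy: "A y = A z - h *\<^sub>R A (A z)"
  proof -
    have "A (z - h *\<^sub>R A z) = A z - h *\<^sub>R A (A z)"
      by (simp add: A_diff[OF z subspace_scale[OF subspace_D AzD]] A_scaleR[OF AzD])
    then show ?thesis unfolding zy .
  qed
  define w where "w = J (2 * h) x"
  have h2: "2 * h > 0" using h by simp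
  have w: "w \<in> D" using J_in_D[OF h2 xH] by (simp add: w_def)
  have wx: "w - (2 * h) *\<^sub>R A w = x" using J_eq[OF h2 xH] by (simp add: w_def)
  have "z - (2 * h) *\<^sub>R A z = x - h\<^sup>2 *\<^sub>R A (A z)"
  proof -
    have "z - (2 * h) *\<^sub>R A z = y - h *\<^sub>R A z"
      unfolding zy[symmetric] by (simp add: diff_diff_eq flip: scaleR_add_left)
    also have "\<dots> = (x + h *\<^sub>R A y) - h *\<^sub>R A z" unfolding yx[symmetric] by simp
    also have "\<dots> = x + h *\<^sub>R (A y - A z)" by (simp add: scaleR_diff_right)
    also have "\<dots> = x - h\<^sup>2 *\<^sub>R A (A z)" by (simp add: Azy power2_eq_square)
    finally show ?thesis .
  qed
  then have "(z - w) - (2 * h) *\<^sub>R A (z - w) = - (h\<^sup>2 *\<^sub>R A (A z))"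
  proof -
    have "(z - w) - (2 * h) *\<^sub>R A (z - w) = (z - (2 * h) *\<^sub>R A z) - (w - (2 * h) *\<^sub>R A w)"
      by (simp add: A_diff[OF z w] scaleR_diff_right)
    also have "\<dots> = - (h\<^sup>2 *\<^sub>R A (A z))"
      unfolding wx \<open>z - (2 * h) *\<^sub>R A z = x - h\<^sup>2 *\<^sub>R A (A z)\<close> by simp
    finally show ?thesis .
  qed
  then have "norm (z - w) \<le> norm (h\<^sup>2 *\<^sub>R A (A z))"
    using norm_le_norm_resolvent[OF subspace_diff[OF subspace_D z w], of "2 * h"] h by simp
  also have "\<dots> \<le> h\<^sup>2 * norm (A (A x))" using n by (simp add: mult_left_mono)
  finally show ?thesis by (simp only: w_def z_def y_def)
qed

text \<open>The local errors of order h^2 are carried forward by contractions and merely add up.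
  With n h bounded by a fixed time the total is of order h.\<close>

lemma J_pow_double_minus_J_double_pow:
  assumes h: "h > 0" and x: "x \<in> D" "A x \<in> D"
  shows "norm ((J h ^^ (2 * n)) x - (J (2 * h) ^^ n) x) \<le> real n * h\<^sup>2 * norm (A (A x))"
proof (induction n)
  case (Suc n)
  have h2: "2 * h > 0" using h by simp
  have xH: "x \<in> H" and AAxH: "A (A x) \<in> H" using x D_sub A_in_H by auto
  define p where "p = (J h ^^ (2 * n)) x"
  define q where "q = (J (2 * h) ^^ n) x"
  have pH: "p \<in> H" by (simp add: p_def J_pow_in_H h xH)
  have q: "q \<in> D" by (simp add: q_def J_pow_in_D h x)
  have Aq: "A q = (J (2 * h) ^^ n) (A x)" unfolding q_def by (rule A_J_pow[OF h2 x(1)])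
  have AqD: "A q \<in> D" unfolding Aq by (rule J_pow_in_D[OF h2 x(2)])
  have AAq: "norm (A (A q)) \<le> norm (A (A x))"
    unfolding Aq A_J_pow[OF h2 x(2)] by (rule norm_J_pow_le[OF h2 AAxH])
  have qH: "q \<in> H" using q D_sub by auto
  have "norm (J h (J h p) - J h (J h q)) \<le> norm (p - q)"
    using norm_J_pow_diff_le[OF h pH qH, of 2] by (simp add: numeral_2_eq_2)
  also have "\<dots> \<le> real n * h\<^sup>2 * norm (A (A x))" using Suc by (simp only: p_def q_def)
  finally have 1: "norm (J h (J h p) - J h (J h q)) \<le> real n * h\<^sup>2 * norm (A (A x))" .
  have "norm (J h (J h q) - J (2 * h) q) \<le> h\<^sup>2 * norm (A (A q))"
    by (rule J_twice_minus_J_double[OF h q AqD])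
  also have "\<dots> \<le> h\<^sup>2 * norm (A (A x))" using AAq by (simp add: mult_left_mono)
  finally have "norm ((J h (J h p) - J h (J h q)) + (J h (J h q) - J (2 * h) q))
      \<le> real n * h\<^sup>2 * norm (A (A x)) + h\<^sup>2 * norm (A (A x))"
    using 1 by (intro norm_triangle_le add_mono)
  then have "norm (J h (J h p) - J (2 * h) q) \<le> real (Suc n) * h\<^sup>2 * norm (A (A x))"
    by (simp add: distrib_right distrib_left)
  then show ?case by (simp add: p_def q_def)
qed simp

lemma J_tendsto:
  assumes "x \<in> D" shows "(\<lambda>n. J (1 / real (Suc n)) x) \<longlonglongrightarrow> x"
proof (rule LIM_zero_cancel, rule Lim_null_comparison)
  show "\<forall>\<^sub>F n in sequentially. norm (J (1 / real (Suc n)) x - x) \<le> 1 / real (Suc n) * norm (A x)"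
    by (intro always_eventually allI norm_J_minus_id_le assms) simp
  show "(\<lambda>n. 1 / real (Suc n) * norm (A x)) \<longlonglongrightarrow> 0"
    using tendsto_mult_left_zero[OF LIMSEQ_inverse_real_of_nat, of "norm (A x)"]
    by (simp add: inverse_eq_divide)
qed

text \<open>Comparing step sizes costs A^2, so convergence starts on the domain of A^2. That domain
  is dense because small resolvent steps map D into it and tend to the identity on D.\<close>

lemma D2_dense: "H \<subseteq> closure {x \<in> D. A x \<in> D}"
proof -
  have "x \<in> closure {x \<in> D. A x \<in> D}" if x: "x \<in> D" for x
    unfolding closure_sequential
  proof (intro exI conjI allI)
    fix n show "J (1 / real (Suc n)) x \<in> {x \<in> D. A x \<in> D}"
      using A_J(1)[of "1 / real (Suc n)", OF _ x] J_in_D[of "1 / real (Suc n)" x] x D_sub by auto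
  qed (rule J_tendsto[OF x])
  then have "closure D \<subseteq> closure {x \<in> D. A x \<in> D}" by (intro closure_minimal) auto
  then show ?thesis using D_dense by blast
qed

text \<open>The time steps \<open>2\<^sup>-\<^sup>k\<close> do not depend on \<open>t\<close>: this makes the semigroup law of the limit a matter
  of rounding.\<close>

definition euler :: "nat \<Rightarrow> real \<Rightarrow> 'a \<Rightarrow> 'a"
  where "euler k t = J (1 / 2 ^ k) ^^ nat \<lfloor>t * 2 ^ k\<rfloor>"

definition sg :: "real \<Rightarrow> 'a \<Rightarrow> 'a"
  where "sg t x = lim (\<lambda>k. euler k t x)"

text \<open>Halving the step doubles the number of steps up to rounding: the bulk is a comparison of
  two steps h with one step 2 h, and a possible odd step costs \<open>h * norm (A x)\<close>. Both
  contributions are geometric in k and hence summable.\<close>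

lemma norm_euler_Suc_minus_euler:
  assumes t: "t \<ge> 0" and x: "x \<in> D" "A x \<in> D"
  shows "norm (euler (Suc k) t x - euler k t x) \<le> (norm (A x) + t * norm (A (A x))) * (1/2) ^ k"
proof -
  define h :: real where "h = 1 / 2 ^ Suc k"
  have h: "h > 0" and h2: "2 * h = 1 / 2 ^ k" by (auto simp: h_def)
  define n where "n = nat \<lfloor>t * 2 ^ k\<rfloor>"
  define m where "m = nat \<lfloor>t * 2 ^ Suc k\<rfloor>"
  have nle: "real n \<le> t * 2 ^ k" using t by (simp add: n_def)
  have xH: "x \<in> H" using x D_sub by auto
  \<comment> \<open>Rounding down after doubling gives 2 n or 2 n + 1.\<close>
  have nm: "m = 2 * n \<or> m = Suc (2 * n)"
  proof -
    have "0 \<le> t * 2 ^ k" using t by simp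
    then have "real n \<le> t * 2 ^ k" "t * 2 ^ k < real n + 1" "real m \<le> 2 * (t * 2 ^ k)"
      "2 * (t * 2 ^ k) < real m + 1"
      by (simp_all add: n_def m_def mult_ac)
    then have "2 * real n < real m + 1" "real m < 2 * real n + 2" by linarith+
    then show ?thesis by linarith
  qed
  have "norm ((J h ^^ m) x - (J h ^^ (2 * n)) x) \<le> h * norm (A x)"
  proof (cases "m = 2 * n")
    case False
    then have "m = 2 * n + 1" using nm by simp
    then have "(J h ^^ m) x = (J h ^^ (2 * n)) (J h x)" by (simp add: funpow_swap1)
    then have "norm ((J h ^^ m) x - (J h ^^ (2 * n)) x) \<le> norm (J h x - x)"
      using norm_J_pow_diff_le[OF h J_in_H[OF h xH] xH, of "2 * n"] by simp
    also have "\<dots> \<le> h * norm (A x)" by (rule norm_J_minus_id_le[OF h x(1)])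
    finally show ?thesis .
  qed (use h in simp)
  then have "norm (((J h ^^ m) x - (J h ^^ (2 * n)) x) + ((J h ^^ (2 * n)) x - (J (2 * h) ^^ n) x))
      \<le> h * norm (A x) + real n * h\<^sup>2 * norm (A (A x))"
    by (intro norm_triangle_le add_mono J_pow_double_minus_J_double_pow[OF h x])
  then have "norm (euler (Suc k) t x - euler k t x) \<le> h * norm (A x) + real n * h\<^sup>2 * norm (A (A x))"
    by (simp add: euler_def n_def m_def h2) (simp add: h_def)
  also have "\<dots> \<le> (1/2)^k * norm (A x) + (t * (1/2)^k) * norm (A (A x))"
  proof (intro add_mono mult_right_mono)
    have "real n * h\<^sup>2 \<le> (t * 2 ^ k) * h\<^sup>2" using nle by (intro mult_right_mono) auto
    also have "\<dots> = t * ((1/2)^k * (1/4))" by (simp add: h_def power2_eq_square power_one_over field_simps)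
    also have "\<dots> \<le> t * (1/2)^k" using t by (intro mult_left_mono) auto
    finally show "real n * h\<^sup>2 \<le> t * (1/2)^k" .
  qed (auto simp: h_def power_one_over field_simps)
  finally show ?thesis by (simp add: algebra_simps)
qed

section \<open>The limit of the Euler scheme\<close>

lemma euler_in_H: "x \<in> H \<Longrightarrow> euler k t x \<in> H"
  by (simp add: euler_def J_pow_in_H)

lemma norm_euler_le: "x \<in> H \<Longrightarrow> norm (euler k t x) \<le> norm x"
  by (simp add: euler_def norm_J_pow_le)

lemma norm_euler_diff_le: "x \<in> H \<Longrightarrow> y \<in> H \<Longrightarrow> norm (euler k t x - euler k t y) \<le> norm (x - y)"
  by (simp add: euler_def norm_J_pow_diff_le)

text \<open>Increments are geometric on the domain of A^2; all approximations are contractions, so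
  the Cauchy property passes to the closure of that domain, which contains H.\<close>

lemma euler_tendsto:
  assumes t: "t \<ge> 0" and x: "x \<in> H" shows "(\<lambda>k. euler k t x) \<longlonglongrightarrow> sg t x"
proof -
  have "Cauchy (\<lambda>k. euler k t x)"
  proof (rule metric_CauchyI)
    fix e :: real assume e: "e > 0"
    obtain y where y: "y \<in> D" "A y \<in> D" and yx: "dist y x < e / 3"
      using D2_dense x e unfolding closure_approachable subset_iff
      by (metis (no_types, lifting) divide_pos_pos mem_Collect_eq zero_less_numeral)
    have yH: "y \<in> H" using y D_sub by auto
    have "convergent (\<lambda>k. euler k t y)"
      by (rule convergent_if_geometric_steps) (rule norm_euler_Suc_minus_euler[OF t y])
    then have "Cauchy (\<lambda>k. euler k t y)" by (simp add: Cauchy_convergent_iff)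
    then obtain N where N: "\<And>m n. m \<ge> N \<Longrightarrow> n \<ge> N \<Longrightarrow> dist (euler m t y) (euler n t y) < e / 3"
      using e metric_CauchyD[of _ "e/3"] by (metis divide_pos_pos zero_less_numeral)
    have "dist (euler m t x) (euler n t x) < e" if "m \<ge> N" "n \<ge> N" for m n
    proof -
      have "dist (euler m t x) (euler n t x) \<le> dist (euler m t x) (euler m t y)
          + dist (euler m t y) (euler n t y) + dist (euler n t y) (euler n t x)"
        by metric
      moreover have "dist (euler m t x) (euler m t y) \<le> dist y x"
        using norm_euler_diff_le[OF x yH] by (simp add: dist_norm norm_minus_commute)
      moreover have "dist (euler n t y) (euler n t x) \<le> dist y x"
        using norm_euler_diff_le[OF yH x] by (simp add: dist_norm)
      ultimately show ?thesis using N[OF that] yx by linarith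
    qed
    then show "\<exists>N. \<forall>m\<ge>N. \<forall>n\<ge>N. dist (euler m t x) (euler n t x) < e" by blast
  qed
  then show ?thesis by (simp add: sg_def Cauchy_convergent_iff convergent_LIMSEQ_iff)
qed

text \<open>Each approximation is a power of a resolvent, so invariance of a closed set survives the
  limit. It is used for H itself and later for the real-valued functions.\<close>

lemma sg_in_closed:
  assumes "t \<ge> 0" "x \<in> H" "closed R" "x \<in> R" and inv: "\<And>h f. h > 0 \<Longrightarrow> f \<in> H \<Longrightarrow> f \<in> R \<Longrightarrow> J h f \<in> R"
  shows "sg t x \<in> R"
proof (rule closed_sequentially[OF assms(3) _ euler_tendsto[OF assms(1,2)]])
  fix k
  have "(J (1 / 2 ^ k) ^^ n) x \<in> R" for n
    using assms by (induction n) (auto intro!: inv J_pow_in_H)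
  then show "euler k t x \<in> R" by (simp add: euler_def)
qed

lemma sg_in_H: "t \<ge> 0 \<Longrightarrow> x \<in> H \<Longrightarrow> sg t x \<in> H"
  by (rule sg_in_closed[OF _ _ closed_H]) (auto intro: J_in_H)

lemma norm_sg_le: "t \<ge> 0 \<Longrightarrow> x \<in> H \<Longrightarrow> norm (sg t x) \<le> norm x"
  by (rule tendsto_upperbound[OF tendsto_norm[OF euler_tendsto]]) (auto simp: norm_euler_le)

lemma sg_add:
  assumes "t \<ge> 0" "x \<in> H" "y \<in> H" shows "sg t (x + y) = sg t x + sg t y"
proof (rule LIMSEQ_unique[OF euler_tendsto])
  show "(\<lambda>k. euler k t (x + y)) \<longlonglongrightarrow> sg t x + sg t y"
    using tendsto_add[OF euler_tendsto euler_tendsto, of t x t y] assms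
    by (simp add: euler_def J_pow_add)
qed (use assms subspace_add[OF subspace_H] in auto)

lemma sg_scaleC:
  assumes "t \<ge> 0" "x \<in> H" shows "sg t (c *\<^sub>C x) = c *\<^sub>C sg t x"
proof (rule LIMSEQ_unique[OF euler_tendsto])
  show "(\<lambda>k. euler k t (c *\<^sub>C x)) \<longlonglongrightarrow> c *\<^sub>C sg t x"
    using tendsto_scaleC[OF euler_tendsto, of t x c] assms
    by (simp add: euler_def J_pow_scaleC)
qed (use assms csubspace_scaleC[OF csubspace_H] in auto)

lemma sg_0: "x \<in> H \<Longrightarrow> sg 0 x = x"
  using LIMSEQ_unique[OF euler_tendsto[of 0 x], of x] by (simp add: euler_def)

lemma sg_diff:
  assumes "t \<ge> 0" "x \<in> H" "y \<in> H" shows "sg t (x - y) = sg t x - sg t y"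
  using sg_add[OF assms(1) subspace_diff[OF subspace_H assms(2,3)] assms(3)]
  unfolding diff_add_cancel eq_diff_eq by (rule sym)

text \<open>On a common grid the rounded step numbers of s and t add up to that of s + t or fall one
  short. The extra step moves x by at most \<open>norm (A x) / 2 ^ k\<close>, an estimate that
  requires x in D.\<close>

lemma sg_semigroup_D:
  assumes st: "s \<ge> 0" "t \<ge> 0" and x: "x \<in> D" shows "sg (s + t) x = sg s (sg t x)"
proof (rule LIMSEQ_unique[OF euler_tendsto])
  have xH: "x \<in> H" using x D_sub by auto
  show "0 \<le> s + t" "x \<in> H" using st xH by auto
  have d: "norm (euler k (s + t) x - euler k s (euler k t x)) \<le> norm (A x) * (1/2) ^ k" for k
  proof -
    define h :: real where "h = 1 / 2 ^ k"
    have h: "h > 0" by (simp add: h_def)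
    define m where "m = nat \<lfloor>s * 2 ^ k\<rfloor>"
    define n where "n = nat \<lfloor>t * 2 ^ k\<rfloor>"
    define p where "p = nat \<lfloor>(s + t) * 2 ^ k\<rfloor>"
    have "p = m + n \<or> p = Suc (m + n)"
    proof -
      have "0 \<le> s * 2 ^ k" "0 \<le> t * 2 ^ k" using st by auto
      then have "real m \<le> s * 2 ^ k" "s * 2 ^ k < real m + 1" "real n \<le> t * 2 ^ k"
        "t * 2 ^ k < real n + 1" "real p \<le> s * 2 ^ k + t * 2 ^ k" "s * 2 ^ k + t * 2 ^ k < real p + 1"
        by (simp_all add: m_def n_def p_def distrib_right)
      then have "real m + real n < real p + 1" "real p < real m + real n + 2" by linarith+
      then show ?thesis by linarith
    qed
    then have "norm ((J h ^^ p) x - (J h ^^ (m + n)) x) \<le> h * norm (A x)"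
    proof
      assume "p = Suc (m + n)"
      then have "norm ((J h ^^ p) x - (J h ^^ (m + n)) x) \<le> norm (J h x - x)"
        using norm_J_pow_diff_le[OF h J_in_H[OF h xH] xH, of "m + n"] by (simp add: funpow_swap1)
      also have "\<dots> \<le> h * norm (A x)" by (rule norm_J_minus_id_le[OF h x])
      finally show ?thesis .
    qed (use h in simp)
    then show ?thesis
      by (simp add: euler_def h_def m_def n_def p_def funpow_add power_one_over mult.commute)
  qed
  show "(\<lambda>k. euler k (s + t) x) \<longlonglongrightarrow> sg s (sg t x)"
  proof (rule LIM_zero_cancel, rule Lim_null_comparison)
    show "\<forall>\<^sub>F k in sequentially. norm (euler k (s + t) x - sg s (sg t x)) \<le>
        norm (A x) * (1/2) ^ k + norm (euler k t x - sg t x) + norm (euler k s (sg t x) - sg s (sg t x))"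
    proof (intro always_eventually allI)
      fix k
      have "norm (euler k s (euler k t x) - euler k s (sg t x)) \<le> norm (euler k t x - sg t x)"
        using st xH by (intro norm_euler_diff_le euler_in_H sg_in_H)
      then have "norm ((euler k (s + t) x - euler k s (euler k t x)) +
          (euler k s (euler k t x) - euler k s (sg t x)) + (euler k s (sg t x) - sg s (sg t x))) \<le>
        norm (A x) * (1/2) ^ k + norm (euler k t x - sg t x) + norm (euler k s (sg t x) - sg s (sg t x))"
        using d by (intro norm_triangle_le add_mono order_refl)
      then show "norm (euler k (s + t) x - sg s (sg t x)) \<le>
        norm (A x) * (1/2) ^ k + norm (euler k t x - sg t x) + norm (euler k s (sg t x) - sg s (sg t x))"
        by simp
    qed
    have "(\<lambda>k. norm (A x) * (1/2) ^ k + norm (euler k t x - sg t x)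
        + norm (euler k s (sg t x) - sg s (sg t x))) \<longlonglongrightarrow> norm (A x) * 0 + 0 + 0"
      by (intro tendsto_add tendsto_mult_left LIMSEQ_power_zero tendsto_norm_zero LIM_zero
          euler_tendsto sg_in_H st xH) simp
    then show "(\<lambda>k. norm (A x) * (1/2) ^ k + norm (euler k t x - sg t x)
        + norm (euler k s (sg t x) - sg s (sg t x))) \<longlonglongrightarrow> 0" by simp
  qed
qed

lemma D_approx:
  assumes "x \<in> H" "e > 0" obtains y where "y \<in> D" "norm (y - x) < e"
proof -
  have "x \<in> closure D" using D_dense assms(1) by blast
  then show ?thesis using that assms(2) by (auto simp: closure_approachable dist_norm)
qed

lemma sg_semigroup:
  assumes st: "s \<ge> 0" "t \<ge> 0" and x: "x \<in> H" shows "sg (s + t) x = sg s (sg t x)"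
proof -
  have "norm (sg (s + t) x - sg s (sg t x)) \<le> 2 * e" if e: "e > 0" for e
  proof -
    obtain y where y: "y \<in> D" "norm (y - x) < e" using D_approx[OF x e] .
    have yH: "y \<in> H" using y D_sub by auto
    note H = sg_in_H[OF st(2)] x yH subspace_diff[OF subspace_H x yH]
    have st': "0 \<le> s + t" using st by simp
    have 1: "norm (sg (s + t) x - sg (s + t) y) \<le> norm (x - y)"
      using norm_sg_le[OF st' H(4)] by (simp only: sg_diff[OF st' x yH])
    have "norm (sg s (sg t (x - y))) \<le> norm (x - y)"
      using norm_sg_le[OF st(1) sg_in_H[OF st(2) H(4)]] norm_sg_le[OF st(2) H(4)] by linarith
    then have 2: "norm (sg s (sg t x) - sg s (sg t y)) \<le> norm (x - y)"
      using st x yH by (simp add: sg_diff sg_in_H)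
    have "norm (sg (s + t) x - sg s (sg t x)) =
        norm ((sg (s + t) x - sg (s + t) y) - (sg s (sg t x) - sg s (sg t y)))"
      by (simp add: sg_semigroup_D[OF st y(1)])
    also have "\<dots> \<le> norm (x - y) + norm (x - y)"
      using 1 2 by (rule norm_triangle_le_diff[OF add_mono])
    finally show ?thesis using y(2) by (simp add: norm_minus_commute)
  qed
  then have "norm (sg (s + t) x - sg s (sg t x)) / 2 \<le> 0 + e" if "e > 0" for e
    using that by force
  then have "norm (sg (s + t) x - sg s (sg t x)) / 2 \<le> 0" by (rule field_le_epsilon)
  then show ?thesis by simp
qed

text \<open>Orbits from D leave their starting point at bounded speed; approximation from D then
  gives strong continuity at 0.\<close>

lemma norm_sg_minus_id_le:
  assumes t: "t \<ge> 0" and x: "x \<in> D" shows "norm (sg t x - x) \<le> t * norm (A x)"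
proof (rule tendsto_upperbound)
  have xH: "x \<in> H" using x D_sub by auto
  show "(\<lambda>k. norm (euler k t x - x)) \<longlonglongrightarrow> norm (sg t x - x)"
    by (intro tendsto_intros euler_tendsto t xH)
  show "\<forall>\<^sub>F k in sequentially. norm (euler k t x - x) \<le> t * norm (A x)"
  proof (intro always_eventually allI)
    fix k :: nat
    have "norm (euler k t x - x) \<le> real (nat \<lfloor>t * 2 ^ k\<rfloor>) * (1 / 2 ^ k) * norm (A x)"
      unfolding euler_def by (rule norm_J_pow_minus_id_le[OF _ x]) simp
    also have "\<dots> \<le> t * norm (A x)"
    proof (rule mult_right_mono)
      have "real (nat \<lfloor>t * 2 ^ k\<rfloor>) \<le> t * 2 ^ k" using t by simp
      then show "real (nat \<lfloor>t * 2 ^ k\<rfloor>) * (1 / 2 ^ k) \<le> t" by (simp add: divide_le_eq)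
    qed simp
    finally show "norm (euler k t x - x) \<le> t * norm (A x)" .
  qed
qed simp

end

section \<open>Orbits and uniqueness of semigroups\<close>

text \<open>The Baire argument, with closed balls on which some \<open>T i\<close> exceeds \<open>k\<close>.\<close>

lemma uniform_boundedness_on:
  fixes T :: "'i \<Rightarrow> 'a::banach \<Rightarrow> 'b::real_normed_vector"
  assumes closed: "closed H" and sub: "subspace H"
    and add: "\<And>i x y. x \<in> H \<Longrightarrow> y \<in> H \<Longrightarrow> T i (x + y) = T i x + T i y"
    and scale: "\<And>i r x. x \<in> H \<Longrightarrow> T i (r *\<^sub>R x) = r *\<^sub>R T i x"
    and bdd: "\<And>i. \<exists>K. \<forall>x\<in>H. norm (T i x) \<le> K * norm x"
    and ptw: "\<And>x. x \<in> H \<Longrightarrow> \<exists>B. \<forall>i. norm (T i x) \<le> B"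
  shows "\<exists>M. \<forall>i. \<forall>x\<in>H. norm (T i x) \<le> M * norm x"
proof (rule ccontr)
  assume "\<not> ?thesis"
  then have bad: "\<exists>i. \<exists>x\<in>H. norm (T i x) > M * norm x" for M by (auto simp: not_le)
  have diff: "T i (x - y) = T i x - T i y" if "x \<in> H" "y \<in> H" for i x y
    using add[of "x - y" y i] subspace_diff[OF sub that] that by simp
  define P where "P k p q \<longleftrightarrow> cball (fst q) (snd q) \<subseteq> cball (fst p) (snd p) \<and> snd q \<le> snd p / 2 \<and>
    (\<exists>i. \<forall>y\<in>cball (fst q) (snd q) \<inter> H. norm (T i y) \<ge> real k)" for k and p q :: "'a \<times> real"
  have "\<exists>f. \<forall>k. (fst (f k) \<in> H \<and> snd (f k) > 0) \<and> P k (f k) (f (Suc k))"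
  proof (rule dependent_nat_choice)
    show "\<exists>p::'a \<times> real. fst p \<in> H \<and> snd p > 0"
      using subspace_0[OF sub] by (intro exI[of _ "(0, 1)"]) simp
  next
    fix p :: "'a \<times> real" and k assume p: "fst p \<in> H \<and> snd p > 0"
    define x where "x = fst p"
    define r where "r = snd p"
    have x: "x \<in> H" and r: "r > 0" using p by (auto simp: x_def r_def)
    obtain i z0 where z0: "z0 \<in> H" and i: "norm (T i z0) > (real k + 1) / (r / 2) * norm z0"
      using bad by blast
    have nz: "norm z0 > 0"
    proof (rule ccontr)
      assume "\<not> norm z0 > 0"
      then have "z0 = 0" by simp
      then show False using i scale[of 0 i 0] subspace_0[OF sub] by simp
    qed
    \<comment> \<open>Rescaled to half the radius: by the choice of z0 its image exceeds k + 1, and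
      both x + z and x - z stay inside the ball.\<close>
    define z where "z = (r / 2 / norm z0) *\<^sub>R z0"
    have z: "z \<in> H" using z0 sub by (simp add: z_def subspace_scale)
    have nzz: "norm z = r / 2" using nz r by (simp add: z_def)
    have Tz: "norm (T i z) > real k + 1"
    proof -
      have "real k + 1 = (r / 2 / norm z0) * ((real k + 1) / (r / 2) * norm z0)"
        using nz r by simp
      also have "\<dots> < (r / 2 / norm z0) * norm (T i z0)"
        using i nz r by (intro mult_strict_left_mono) auto
      also have "\<dots> = norm (T i z)" using r by (simp add: z_def scale z0)
      finally show ?thesis .
    qed
    \<comment> \<open>\<open>2 *\<^sub>R T i z\<close> is the difference of the values at x + z and
      x - z, so one of the two values is at least as large in norm as that at z.\<close>
    have "\<exists>x'\<in>H. norm (x' - x) \<le> r / 2 \<and> norm (T i x') > real k + 1"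
    proof (cases "norm (T i (x + z)) > real k + 1")
      case True
      then show ?thesis using x z nzz sub by (intro bexI[of _ "x + z"]) (auto simp: subspace_add)
    next
      case False
      have "2 * norm (T i z) = norm (T i (x + z) - T i (x - z))"
        by (simp add: add diff x z flip: scaleR_2)
      also have "\<dots> \<le> norm (T i (x + z)) + norm (T i (x - z))" by (rule norm_triangle_ineq4)
      finally have "norm (T i (x - z)) > real k + 1" using False Tz by linarith
      then show ?thesis using x z nzz sub by (intro bexI[of _ "x - z"]) (auto simp: subspace_diff)
    qed
    then obtain x' where x': "x' \<in> H" "norm (x' - x) \<le> r / 2" "norm (T i x') > real k + 1"
      by blast
    obtain K where K: "\<And>x. x \<in> H \<Longrightarrow> norm (T i x) \<le> K * norm x" using bdd by blast
    \<comment> \<open>On this ball \<open>T i\<close> varies by at most 1, so the bound k + 1 at the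
      centre leaves k throughout; r / 2 ensures nesting and halving. The given K may be negative,
      hence the absolute value.\<close>
    define r' where "r' = min (r / 2) (1 / (\<bar>K\<bar> + 1))"
    have r': "r' > 0" "r' \<le> r / 2" "r' \<le> 1 / (\<bar>K\<bar> + 1)" using r by (auto simp: r'_def)
    have low: "norm (T i y) \<ge> real k" if y: "y \<in> cball x' r'" "y \<in> H" for y
    proof -
      have "norm (T i (y - x')) \<le> K * norm (y - x')" by (intro K subspace_diff[OF sub] y x')
      also have "\<dots> \<le> (\<bar>K\<bar> + 1) * (1 / (\<bar>K\<bar> + 1))"
        using y r'(3) by (intro mult_mono) (auto simp: dist_norm norm_minus_commute)
      also have "\<dots> = 1" by simp
      finally have "norm (T i y - T i x') \<le> 1" by (simp add: diff y x')
      then show ?thesis using x'(3) norm_triangle_ineq3[of "T i y" "T i x'"] by linarith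
    qed
    have "cball x' r' \<subseteq> cball x r"
    proof
      fix y assume "y \<in> cball x' r'"
      then show "y \<in> cball x r"
        using x'(2) r'(2) dist_triangle[of x y x'] by (simp add: dist_norm norm_minus_commute)
    qed
    then have "P k p (x', r')" using low r'(2) by (auto simp: P_def x_def r_def intro!: exI[of _ i])
    then show "\<exists>q. (fst q \<in> H \<and> snd q > 0) \<and> P k p q"
      using x'(1) r'(1) by (intro exI[of _ "(x', r')"]) simp
  qed
  then obtain f where f: "\<And>k. fst (f k) \<in> H" "\<And>k. snd (f k) > 0" "\<And>k. P k (f k) (f (Suc k))"
    by blast
  define S where "S k = cball (fst (f k)) (snd (f k)) \<inter> H" for k
  have rad: "snd (f k) \<le> snd (f 0) * (1/2) ^ k" for k
  proof (induction k)
    case (Suc k)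
    have "snd (f (Suc k)) \<le> snd (f k) / 2" using f(3)[of k] by (simp add: P_def)
    then show ?case using Suc by simp
  qed simp
  obtain a where a: "\<And>k. a \<in> S k"
  proof (rule decreasing_closed_nest[of S])
    show "closed (S k)" for k using closed by (auto simp: S_def)
    show "S k \<noteq> {}" for k using f(1,2)[of k] by (force simp: S_def)
    have "S (Suc k) \<subseteq> S k" for k using f(3)[of k] by (auto simp: S_def P_def)
    then show "S n \<subseteq> S m" if "m \<le> n" for m n using that by (rule lift_Suc_antimono_le)
    fix e :: real assume e: "e > 0"
    have "(\<lambda>k. 2 * (snd (f 0) * (1/2) ^ k)) \<longlonglongrightarrow> 2 * (snd (f 0) * 0)"
      by (intro tendsto_mult_left LIMSEQ_power_zero) simp
    then have "\<forall>\<^sub>F k in sequentially. 2 * (snd (f 0) * (1/2) ^ k) < e"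
      using e by (intro order_tendstoD) auto
    then obtain k where k: "2 * (snd (f 0) * (1/2) ^ k) < e" by (auto simp: eventually_sequentially)
    have "dist x y < e" if "x \<in> S k" "y \<in> S k" for x y
      using that rad[of k] k dist_triangle3[of x y "fst (f k)"] by (auto simp: S_def)
    then show "\<exists>n. \<forall>x\<in>S n. \<forall>y\<in>S n. dist x y < e" by blast
  qed (blast intro: that)
  have aH: "a \<in> H" using a[of 0] by (simp add: S_def)
  obtain B where B: "\<And>i. norm (T i a) \<le> B" using ptw[OF aH] by blast
  obtain k where k: "real k > B" using reals_Archimedean2 by blast
  obtain i where "norm (T i a) \<ge> real k" using f(3)[of k] a[of "Suc k"] unfolding P_def S_def by blast
  then show False using B[of i] k by linarith
qed

text \<open>Orbits come with a right derivative only, so the mean value theorem is not at hand. A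
  slope e > 0 is subtracted, and at the last point where the function is still at most its initial
  value the right derivative pushes that point further.\<close>

lemma nonincreasing_if_right_derivative_nonpos:
  fixes \<phi> :: "real \<Rightarrow> real"
  assumes cont: "continuous_on {0..} \<phi>" and t: "t \<ge> 0"
    and der: "\<And>s. s \<ge> 0 \<Longrightarrow> \<exists>l\<le>0. ((\<lambda>h. (\<phi> (s + h) - \<phi> s) / h) \<longlongrightarrow> l) (at_right 0)"
  shows "\<phi> t \<le> \<phi> 0"
proof (rule field_le_epsilon)
  fix e0 :: real assume e0: "e0 > 0"
  \<comment> \<open>The denominator t + 1 keeps e positive and e t at most e0, also for t =
    0.\<close>
  define e where "e = e0 / (t + 1)"
  have e: "e > 0" "e * t \<le> e0" using e0 t by (auto simp: e_def divide_simps)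
  define g where "g s = \<phi> s - e * s" for s
  have contg: "continuous_on {0..t} g"
    unfolding g_def by (intro continuous_intros continuous_on_subset[OF cont]) auto
  have "g t \<le> g 0"
  proof (rule ccontr)
    assume gt: "\<not> g t \<le> g 0"
    define S where "S = {s \<in> {0..t}. g s \<le> g 0}"
    have "compact S"
      unfolding S_def compact_eq_bounded_closed
      using continuous_closed_preimage[OF contg closed_atLeastAtMost closed_atMost, of "g 0"]
      by (auto simp: vimage_def Int_def intro: bounded_subset[OF bounded_closed_interval[of 0 t]])
    moreover have "0 \<in> S" using t by (simp add: S_def)
    ultimately obtain c where c: "c \<in> S" "\<And>s. s \<in> S \<Longrightarrow> s \<le> c"
      using compact_attains_sup[of S] by blast
    have ct: "c < t" "c \<ge> 0" using c(1) gt by (auto simp: S_def order_less_le)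
    obtain l where l: "l \<le> 0" "((\<lambda>h. (\<phi> (c + h) - \<phi> c) / h) \<longlongrightarrow> l) (at_right 0)"
      using der[OF ct(2)] by blast
    have "\<forall>\<^sub>F h in at_right 0. (\<phi> (c + h) - \<phi> c) / h < e"
      using l e by (intro order_tendstoD(2)[OF l(2)]) simp
    moreover have "\<forall>\<^sub>F h in at_right 0. h \<in> {0<..<t - c}"
      using ct by (intro eventually_at_right_real) simp
    ultimately have "\<forall>\<^sub>F h in at_right 0. (\<phi> (c + h) - \<phi> c) / h < e \<and> h \<in> {0<..<t - c}"
      by eventually_elim simp
    then obtain h where h: "(\<phi> (c + h) - \<phi> c) / h < e" "0 < h" "h < t - c"
      using eventually_happens'[OF trivial_limit_at_right_real] by fastforce
    have "\<phi> (c + h) - \<phi> c < e * h" using h by (simp add: divide_less_eq)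
    then have "g (c + h) \<le> g 0" using c(1) by (simp add: g_def S_def distrib_left)
    then have "c + h \<in> S" using h ct by (simp add: S_def)
    then show False using c(2)[of "c + h"] h by simp
  qed
  then show "\<phi> t \<le> \<phi> 0 + e0" using e by (simp add: g_def)
qed

context
  fixes H :: "'a::{complex_inner, banach} set" and T
  assumes closed: "closed H" and cs: "csubspace H" and C0: "C0_semigroup H T"
begin

section \<open>Local boundedness, continuity and right differentiability of orbits\<close>

lemma C0_lin: "t \<ge> 0 \<Longrightarrow> linear_operator_in H H (T t)"
  and C0_bounded: "t \<ge> 0 \<Longrightarrow> \<exists>K. \<forall>u\<in>H. norm (T t u) \<le> K * norm u"
  and C0_zero: "u \<in> H \<Longrightarrow> T 0 u = u"
  and C0_semigroup_law: "s \<ge> 0 \<Longrightarrow> t \<ge> 0 \<Longrightarrow> u \<in> H \<Longrightarrow> T (s + t) u = T s (T t u)"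
  and C0_cont: "u \<in> H \<Longrightarrow> ((\<lambda>t. T t u) \<longlongrightarrow> u) (at_right 0)"
  using C0 by (auto simp: C0_semigroup_def)

lemma C0_in: "t \<ge> 0 \<Longrightarrow> u \<in> H \<Longrightarrow> T t u \<in> H"
  and C0_add: "t \<ge> 0 \<Longrightarrow> u \<in> H \<Longrightarrow> v \<in> H \<Longrightarrow> T t (u + v) = T t u + T t v"
  and C0_scaleR: "t \<ge> 0 \<Longrightarrow> u \<in> H \<Longrightarrow> T t (r *\<^sub>R u) = r *\<^sub>R T t u"
  using C0_lin[of t] by (auto simp: linear_operator_in_def simp flip: scaleC_of_real)

lemma C0_diff:
  assumes "t \<ge> 0" "u \<in> H" "v \<in> H" shows "T t (u - v) = T t u - T t v"
  using C0_add[OF assms(1) subspace_diff[OF csubspace_imp_subspace[OF cs] assms(2,3)] assms(3)]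
  unfolding diff_add_cancel eq_diff_eq by (rule sym)

text \<open>The definition bounds each operator separately. If no common bound held near 0, there
  would be times tending to 0 along which the operators are unbounded; but along them every orbit
  converges, and uniform boundedness gives a contradiction.\<close>

lemma C0_locally_bounded:
  obtains d M where "d > 0" "M \<ge> 0" "\<And>t u. t \<in> {0..d} \<Longrightarrow> u \<in> H \<Longrightarrow> norm (T t u) \<le> M * norm u"
proof -
  have "\<exists>n. \<forall>t\<in>{0..1 / real (Suc n)}. \<forall>u\<in>H. norm (T t u) \<le> real (Suc n) * norm u"
  proof (rule ccontr)
    assume "\<not> ?thesis"
    then have "\<forall>n. \<exists>t u. t \<in> {0..1 / real (Suc n)} \<and> u \<in> H \<and> norm (T t u) > real (Suc n) * norm u"
      unfolding not_ex not_all not_le ball_simps bex_simps by meson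
    then obtain t u where t: "\<And>n. t n \<in> {0..1 / real (Suc n)}" and u: "\<And>n. u n \<in> H"
      and big: "\<And>n. norm (T (t n) (u n)) > real (Suc n) * norm (u n)" by metis
    have t0: "t n \<ge> 0" for n using t[of n] by simp
    \<comment> \<open>The limit at 0 is one-sided, so time 0 must be ruled out: there the operator
      is the identity and cannot exceed the factor \<open>Suc n\<close>.\<close>
    have tpos: "t n > 0" for n
    proof (rule ccontr)
      assume "\<not> t n > 0"
      then have "t n = 0" using t0[of n] by simp
      then have "norm (u n) > real (Suc n) * norm (u n)" using big[of n] C0_zero[OF u] by simp
      moreover have "1 * norm (u n) \<le> real (Suc n) * norm (u n)" by (intro mult_right_mono) auto
      ultimately show False by simp
    qed
    have "t \<longlonglongrightarrow> 0"
    proof (rule tendsto_sandwich[of "\<lambda>n. 0" _ _ "\<lambda>n. 1 / real (Suc n)"])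
      show "(\<lambda>n. 1 / real (Suc n)) \<longlonglongrightarrow> 0"
        using LIMSEQ_inverse_real_of_nat by (simp add: inverse_eq_divide)
    qed (use t in auto)
    then have flim: "filterlim t (at_right 0) sequentially"
      using tpos by (intro tendsto_imp_filterlim_at_right) auto
    have "\<exists>M. \<forall>n. \<forall>x\<in>H. norm (T (t n) x) \<le> M * norm x"
    proof (rule uniform_boundedness_on[OF closed csubspace_imp_subspace[OF cs]])
      fix x assume x: "x \<in> H"
      have "(\<lambda>n. T (t n) x) \<longlonglongrightarrow> x" by (rule filterlim_compose[OF C0_cont[OF x] flim])
      then have "Bseq (\<lambda>n. T (t n) x)" using convergentI convergent_imp_Bseq by blast
      then show "\<exists>B. \<forall>n. norm (T (t n) x) \<le> B" by (auto simp: Bseq_def)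
    qed (use t0 in \<open>auto simp: C0_add C0_scaleR intro: C0_bounded\<close>)
    then obtain M where M: "\<And>n x. x \<in> H \<Longrightarrow> norm (T (t n) x) \<le> M * norm x" by blast
    obtain n where n: "real n > M" using reals_Archimedean2 by blast
    have "real (Suc n) * norm (u n) < M * norm (u n)"
      using big[of n] M[OF u, of n n] by linarith
    moreover have "M * norm (u n) \<le> real (Suc n) * norm (u n)" using n by (intro mult_right_mono) auto
    ultimately show False by simp
  qed
  then obtain n where "\<forall>t\<in>{0..1 / real (Suc n)}. \<forall>u\<in>H. norm (T t u) \<le> real (Suc n) * norm u" ..
  then show ?thesis by (intro that[of "1 / real (Suc n)" "real (Suc n)"]) auto
qed

lemma C0_bounded_on_interval:
  "\<exists>K\<ge>0. \<forall>t\<in>{0..s}. \<forall>u\<in>H. norm (T t u) \<le> K * norm u"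
proof -
  obtain d M where d: "d > 0" "M \<ge> 0" and dM: "\<And>t u. t \<in> {0..d} \<Longrightarrow> u \<in> H \<Longrightarrow> norm (T t u) \<le> M * norm u"
    using C0_locally_bounded by blast
  have "\<exists>K\<ge>0. \<forall>t\<in>{0..real n * d}. \<forall>u\<in>H. norm (T t u) \<le> K * norm u" for n
  proof (induction n)
    case 0
    then show ?case using C0_zero by (intro exI[of _ 1]) auto
  next
    case (Suc n)
    then obtain K where K: "K \<ge> 0" "\<And>t u. t \<in> {0..real n * d} \<Longrightarrow> u \<in> H \<Longrightarrow> norm (T t u) \<le> K * norm u"
      by blast
    \<comment> \<open>K serves the times already covered, K M the new piece of length at most d; the
      sum serves both.\<close>
    have "norm (T t u) \<le> (K + K * M) * norm u" if t: "t \<in> {0..real (Suc n) * d}" and u: "u \<in> H" for t u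
    proof (cases "t \<le> real n * d")
      case True
      then have "norm (T t u) \<le> K * norm u" using K(2) t u by simp
      moreover have "0 \<le> K * M * norm u" using K d by simp
      ultimately show ?thesis by (simp add: distrib_right)
    next
      case False
      define q where "q = t - real n * d"
      have q: "q \<in> {0..d}" using False t by (simp add: q_def algebra_simps)
      have nd: "real n * d \<ge> 0" using d by simp
      have e: "T t u = T (real n * d) (T q u)"
        using C0_semigroup_law[OF nd _ u, of q] q by (simp add: q_def)
      have "norm (T t u) \<le> K * norm (T q u)"
        unfolding e using K(2) C0_in[of q u] q u nd by simp
      also have "\<dots> \<le> K * (M * norm u)" using dM[OF q u] K(1) by (rule mult_left_mono)
      also have "\<dots> \<le> (K + K * M) * norm u" using K by (simp add: distrib_right)
      finally show ?thesis .
    qed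
    then show ?case using K d by (intro exI[of _ "K + K * M"]) auto
  qed
  moreover obtain n where "s / d < real n" using reals_Archimedean2 by blast
  then have "s \<le> real n * d" using d by (simp add: divide_less_eq)
  ultimately show ?thesis by (meson atLeastatMost_subset_iff order_refl subset_iff)
qed

text \<open>Continuity from the left passes through the operator T p at a moving time p, which calls
  for a bound uniform on [0, s + 1]; the + 1 leaves room to the right of s.\<close>

lemma C0_continuous_on:
  assumes u: "u \<in> H" shows "continuous_on {0..} (\<lambda>t. T t u)"
  unfolding continuous_on_iff
proof (intro ballI allI impI)
  fix s e :: real assume s: "s \<in> {0..}" and e: "e > 0"
  obtain K where K: "K \<ge> 0" "\<And>t v. t \<in> {0..s + 1} \<Longrightarrow> v \<in> H \<Longrightarrow> norm (T t v) \<le> K * norm v"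
    using C0_bounded_on_interval[of "s + 1"] by blast
  have "\<forall>\<^sub>F h in at_right 0. dist (T h u) u < e / (K + 1)"
    using tendstoD[OF C0_cont[OF u]] e K by simp
  then obtain b where b: "b > 0" "\<And>h. 0 < h \<Longrightarrow> h < b \<Longrightarrow> dist (T h u) u < e / (K + 1)"
    unfolding eventually_at_right_field by auto
  have key: "dist (T q u) (T p u) < e" if pq: "0 \<le> p" "p \<le> q" "q - p < b" "q \<le> s + 1" for p q
  proof -
    have h: "q - p \<ge> 0" using pq by simp
    have eq: "T q u = T p (T (q - p) u)" using C0_semigroup_law[OF pq(1) h u] by simp
    have "dist (T q u) (T p u) = norm (T p (T (q - p) u - u))"
      unfolding eq C0_diff[OF pq(1) C0_in[OF h u] u] by (rule dist_norm)
    also have "\<dots> \<le> K * norm (T (q - p) u - u)"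
      using pq by (intro K(2) subspace_diff[OF csubspace_imp_subspace[OF cs]] C0_in h u) auto
    also have "\<dots> \<le> K * (e / (K + 1))"
    proof (rule mult_left_mono[OF _ K(1)])
      show "norm (T (q - p) u - u) \<le> e / (K + 1)"
        using b(2)[of "q - p"] pq e K(1) C0_zero[OF u]
        by (cases "q = p") (auto simp: dist_norm less_imp_le)
    qed
    also have "\<dots> < e" using e K(1) by (simp add: divide_less_eq)
    finally show ?thesis .
  qed
  have "dist (T t u) (T s u) < e" if "t \<in> {0..}" "dist t s < min b 1" for t
  proof (cases "t \<le> s")
    case True
    then show ?thesis using key[of t s] that s by (simp add: dist_real_def dist_commute)
  next
    case False
    then show ?thesis using key[of s t] that s by (simp add: dist_real_def)
  qed
  then show "\<exists>d>0. \<forall>t\<in>{0..}. dist t s < d \<longrightarrow> dist (T t u) (T s u) < e"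
    using b(1) by (intro exI[of _ "min b 1"]) auto
qed

text \<open>T t is bounded and commutes with the difference quotient at 0, so it carries the
  derivative from 0 to t. Read as a difference quotient of the orbit of T t u, the same limit puts T
  t u in the domain.\<close>

lemma generator_orbit:
  assumes gen: "is_generator H T D A" and u: "u \<in> D" and t: "t \<ge> 0"
  shows "T t u \<in> D" and "((\<lambda>h. (1 / h) *\<^sub>R (T (t + h) u - T t u)) \<longlongrightarrow> A (T t u)) (at_right 0)"
proof -
  have DH: "D \<subseteq> H" using gen by (auto simp: is_generator_def)
  have uH: "u \<in> H" using u DH by auto
  have sub: "subspace H" by (rule csubspace_imp_subspace[OF cs])
  have ev: "\<forall>\<^sub>F h in at_right 0. h > (0::real)" by (simp add: eventually_at_right_less)
  have lim: "((\<lambda>h. (1 / h) *\<^sub>R (T h u - u)) \<longlongrightarrow> A u) (at_right 0)"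
    using gen u by (auto simp: is_generator_def)
  \<comment> \<open>The notion of generator does not say that A maps into H; closedness of H gives
    it, and T t is known to be linear and bounded on H only.\<close>
  have AuH: "A u \<in> H"
  proof (rule Lim_in_closed_set[OF closed _ trivial_limit_at_right_real lim])
    show "\<forall>\<^sub>F h in at_right 0. (1 / h) *\<^sub>R (T h u - u) \<in> H"
      using ev by eventually_elim (auto intro!: subspace_scale[OF sub] subspace_diff[OF sub] C0_in uH)
  qed
  obtain K where K: "\<And>v. v \<in> H \<Longrightarrow> norm (T t v) \<le> K * norm v" using C0_bounded[OF t] by blast
  have "((\<lambda>h. T t ((1 / h) *\<^sub>R (T h u - u))) \<longlongrightarrow> T t (A u)) (at_right 0)"
  proof (rule LIM_zero_cancel, rule Lim_null_comparison)
    show "((\<lambda>h. K * norm ((1 / h) *\<^sub>R (T h u - u) - A u)) \<longlongrightarrow> 0) (at_right 0)"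
      by (rule tendsto_mult_right_zero, rule tendsto_norm_zero, rule LIM_zero, rule lim)
    show "\<forall>\<^sub>F h in at_right 0. norm (T t ((1 / h) *\<^sub>R (T h u - u)) - T t (A u))
        \<le> K * norm ((1 / h) *\<^sub>R (T h u - u) - A u)"
      using ev
    proof eventually_elim
      case (elim h)
      then have H: "(1 / h) *\<^sub>R (T h u - u) \<in> H"
        by (auto intro!: subspace_scale[OF sub] subspace_diff[OF sub] C0_in uH)
      show ?case
        unfolding C0_diff[OF t H AuH, symmetric] by (rule K[OF subspace_diff[OF sub H AuH]])
    qed
  qed
  then have lim1: "((\<lambda>h. (1 / h) *\<^sub>R (T (t + h) u - T t u)) \<longlongrightarrow> T t (A u)) (at_right 0)"
  proof (rule Lim_transform_eventually)
    show "\<forall>\<^sub>F h in at_right 0. T t ((1 / h) *\<^sub>R (T h u - u)) = (1 / h) *\<^sub>R (T (t + h) u - T t u)"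
      using ev
    proof eventually_elim
      case (elim h)
      then have h: "h \<ge> 0" by simp
      show ?case
        by (simp add: C0_scaleR[OF t subspace_diff[OF sub C0_in[OF h uH] uH]]
            C0_diff[OF t C0_in[OF h uH] uH] C0_semigroup_law[OF t h uH])
    qed
  qed
  have lim2: "((\<lambda>h. (1 / h) *\<^sub>R (T h (T t u) - T t u)) \<longlongrightarrow> T t (A u)) (at_right 0)"
  proof (rule Lim_transform_eventually[OF lim1])
    show "\<forall>\<^sub>F h in at_right 0. (1 / h) *\<^sub>R (T (t + h) u - T t u) = (1 / h) *\<^sub>R (T h (T t u) - T t u)"
      using ev by eventually_elim (simp add: C0_semigroup_law[OF _ t uH] add.commute[of t])
  qed
  then show D: "T t u \<in> D"
    using gen C0_in[OF t uH] by (auto simp: is_generator_def)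
  have "((\<lambda>h. (1 / h) *\<^sub>R (T h (T t u) - T t u)) \<longlongrightarrow> A (T t u)) (at_right 0)"
    using gen D by (auto simp: is_generator_def)
  then have "A (T t u) = T t (A u)" by (rule tendsto_unique[OF trivial_limit_at_right_real _ lim2])
  then show "((\<lambda>h. (1 / h) *\<^sub>R (T (t + h) u - T t u)) \<longlongrightarrow> A (T t u)) (at_right 0)"
    using lim1 by simp
qed

end

text \<open>Uniqueness needs only dissipativity: the squared norm of the difference of two orbits is
  continuous with nonpositive right derivative.\<close>

lemma C0_semigroup_unique:
  fixes H :: "'a::{complex_inner, banach} set"
  assumes H: "closed H" "csubspace H"
    and T: "C0_semigroup H T" "is_generator H T D A" and S: "C0_semigroup H S" "is_generator H S D A"
    and lin: "linear_operator_in H D A" and dense: "H \<subseteq> closure D"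
    and dis: "\<And>u. u \<in> D \<Longrightarrow> inner (A u) u \<le> 0"
    and t: "t \<ge> 0" and u: "u \<in> H"
  shows "T t u = S t u"
proof -
  have DH: "D \<subseteq> H" and sD: "subspace D"
    using lin csubspace_imp_subspace by (auto simp: linear_operator_in_def)
  have AD: "A (x - y) = A x - A y" if "x \<in> D" "y \<in> D" for x y
  proof -
    have "A (x - y + y) = A (x - y) + A y"
      using lin that subspace_diff[OF sD that] unfolding linear_operator_in_def by blast
    then show ?thesis by simp
  qed
  have onD: "T t x = S t x" if x: "x \<in> D" for x
  proof -
    have xH: "x \<in> H" using x DH by auto
    define w where "w s = T s x - S s x" for s
    have contw: "continuous_on {0..} w"
      unfolding w_def
      by (intro continuous_on_diff C0_continuous_on[OF H T(1) xH] C0_continuous_on[OF H S(1) xH])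
    have "inner (w t) (w t) \<le> inner (w 0) (w 0)"
    proof (rule nonincreasing_if_right_derivative_nonpos[of "\<lambda>s. inner (w s) (w s)", OF _ t])
      show "continuous_on {0..} (\<lambda>s. inner (w s) (w s))" by (intro continuous_on_inner contw)
      fix s :: real assume s: "s \<ge> 0"
      have D: "T s x \<in> D" "S s x \<in> D"
        by (rule generator_orbit[OF H T x s], rule generator_orbit[OF H S x s])
      then have wD: "w s \<in> D" by (simp add: w_def subspace_diff[OF sD])
      have "((\<lambda>h. (1 / h) *\<^sub>R (T (s + h) x - T s x) - (1 / h) *\<^sub>R (S (s + h) x - S s x))
          \<longlongrightarrow> A (T s x) - A (S s x)) (at_right 0)"
        by (intro tendsto_diff generator_orbit(2)[OF H T x s] generator_orbit(2)[OF H S x s])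
      then have lim: "((\<lambda>h. (1 / h) *\<^sub>R (w (s + h) - w s)) \<longlongrightarrow> A (w s)) (at_right 0)"
        by (simp add: w_def AD[OF D] scaleR_diff_right algebra_simps)
      have "continuous_on {0..} (\<lambda>h. w (s + h))"
        by (rule continuous_on_compose2[OF contw]) (use s in \<open>auto intro!: continuous_intros\<close>)
      then have "((\<lambda>h. w (s + h)) \<longlongrightarrow> w (s + 0)) (at 0 within {0..})"
        unfolding continuous_on_def by (metis atLeast_iff order_refl)
      then have lim2: "((\<lambda>h. w (s + h)) \<longlongrightarrow> w s) (at_right 0)"
        by (auto intro: tendsto_within_subset)
      \<comment> \<open>A difference of squares written as a product: the right derivative and the
        continuity of w then suffice.\<close>
      have "((\<lambda>h. inner ((1 / h) *\<^sub>R (w (s + h) - w s)) (w (s + h) + w s))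
          \<longlongrightarrow> inner (A (w s)) (w s + w s)) (at_right 0)"
        by (intro tendsto_inner tendsto_add lim lim2 tendsto_const)
      then have "((\<lambda>h. (inner (w (s + h)) (w (s + h)) - inner (w s) (w s)) / h)
          \<longlongrightarrow> 2 * inner (A (w s)) (w s)) (at_right 0)"
        by (simp add: inner_diff_left inner_add_right inner_commute diff_divide_distrib algebra_simps)
      then show "\<exists>l\<le>0. ((\<lambda>h. (inner (w (s + h)) (w (s + h)) - inner (w s) (w s)) / h) \<longlongrightarrow> l) (at_right 0)"
        using dis[OF wD] by (intro exI conjI) auto
    qed
    also have "w 0 = 0" using C0_zero[OF H T(1) xH] C0_zero[OF H S(1) xH] by (simp add: w_def)
    finally have "inner (w t) (w t) \<le> 0" by simp
    then have "w t = 0" by (metis inner_gt_zero_iff not_less)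
    then show ?thesis by (simp add: w_def)
  qed
  obtain x where x: "\<And>n. x n \<in> D" "x \<longlonglongrightarrow> u"
    using dense u unfolding closure_sequential subset_iff by blast
  \<comment> \<open>From the dense domain to H, by boundedness of the operators at the one time
    t.\<close>
  have ext: "(\<lambda>n. R t (x n)) \<longlonglongrightarrow> R t u" if R: "C0_semigroup H R" for R
  proof -
    obtain K where K: "\<And>v. v \<in> H \<Longrightarrow> norm (R t v) \<le> K * norm v"
      using C0_bounded[OF H R t] by blast
    have xH: "x n \<in> H" for n using x DH by auto
    show ?thesis
    proof (rule LIM_zero_cancel, rule Lim_null_comparison)
      show "\<forall>\<^sub>F n in sequentially. norm (R t (x n) - R t u) \<le> K * norm (x n - u)"
        unfolding C0_diff[OF H R t xH u, symmetric]
        by (intro always_eventually allI K subspace_diff[OF csubspace_imp_subspace[OF H(2)]] xH u)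
      show "(\<lambda>n. K * norm (x n - u)) \<longlonglongrightarrow> 0"
        by (rule tendsto_mult_right_zero, rule tendsto_norm_zero, rule LIM_zero, rule x)
    qed
  qed
  show ?thesis
    using LIMSEQ_unique[OF ext[OF T(1)]] ext[OF S(1)] onD[OF x(1)] by simp
qed

context m_dissipative_operator
begin

section \<open>The Euler limit is a strongly continuous semigroup with the given generator\<close>

lemma C0_semigroup_sg: "C0_semigroup H sg"
  unfolding C0_semigroup_def
proof (intro conjI allI impI ballI)
  fix u assume u: "u \<in> H"
  show "((\<lambda>t. sg t u) \<longlongrightarrow> u) (at_right 0)"
  proof (rule tendstoI)
    fix e :: real assume e: "e > 0"
    then have e3: "e / 3 > 0" by simp
    obtain y where y: "y \<in> D" "norm (y - u) < e / 3" using D_approx[OF u e3] .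
    have yH: "y \<in> H" using y D_sub by auto
    have "((\<lambda>t. t * norm (A y)) \<longlongrightarrow> 0 * norm (A y)) (at_right 0)"
      by (intro tendsto_intros)
    then have "\<forall>\<^sub>F t in at_right 0. t * norm (A y) < e / 3"
      using e by (intro order_tendstoD) auto
    moreover have "\<forall>\<^sub>F t in at_right 0. t > (0::real)" by (simp add: eventually_at_right_less)
    ultimately show "\<forall>\<^sub>F t in at_right 0. dist (sg t u) u < e"
    proof eventually_elim
      case (elim t)
      then have t: "t \<ge> 0" by simp
      have "norm (sg t (u - y)) \<le> norm (u - y)"
        by (rule norm_sg_le[OF t subspace_diff[OF subspace_H u yH]])
      then have "norm (sg t u - sg t y) \<le> norm (y - u)"
        by (simp add: sg_diff[OF t u yH] norm_minus_commute)
      moreover have "norm (sg t y - y) < e / 3"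
        using norm_sg_minus_id_le[OF t y(1)] elim by linarith
      moreover have "norm ((sg t u - sg t y) + (sg t y - y) + (y - u))
          \<le> norm (sg t u - sg t y) + norm (sg t y - y) + norm (y - u)"
        by (intro norm_triangle_le add_right_mono norm_triangle_ineq)
      ultimately show ?case using y(2) by (simp add: dist_norm)
    qed
  qed
next
  fix t :: real assume t: "t \<ge> 0"
  show "linear_operator_in H H (sg t)"
    using csubspace_H t by (auto simp: linear_operator_in_def sg_in_H sg_add sg_scaleC)
  show "\<exists>K. \<forall>u\<in>H. norm (sg t u) \<le> K * norm u"
    using norm_sg_le[OF t] by (intro exI[of _ 1]) simp
qed (simp_all add: sg_0 sg_semigroup)

text \<open>Step n + 1 adds \<open>h *\<^sub>R (J h ^^ Suc n) (A x)\<close>, so its error against h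
  A x is the motion of A x under the powers. As A x may lie outside D, this motion is measured
  through a neighbour y in D. The fixed N makes the bound the same for all steps, so that it sums
  linearly.\<close>

lemma J_pow_first_order:
  assumes h: "h > 0" and x: "x \<in> D" and y: "y \<in> D" and "n \<le> N"
  shows "norm ((J h ^^ n) x - x - (real n * h) *\<^sub>R A x)
    \<le> real n * h * (real N * h * norm (A y) + 2 * norm (A x - y))"
  using \<open>n \<le> N\<close>
proof (induction n)
  case (Suc n)
  let ?C = "real N * h * norm (A y) + 2 * norm (A x - y)"
  have AxH: "A x \<in> H" and yH: "y \<in> H" using A_in_H x y D_sub by auto
  have step: "(J h ^^ Suc n) x - (J h ^^ n) x = h *\<^sub>R (J h ^^ Suc n) (A x)"
    using J_minus_id[OF h J_pow_in_D[OF h x, of n]] by (simp add: A_J_pow[OF h x])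
  have "norm ((J h ^^ Suc n) y - y) \<le> real (Suc n) * h * norm (A y)"
    by (rule norm_J_pow_minus_id_le[OF h y])
  also have "\<dots> \<le> real N * h * norm (A y)"
    using Suc.prems h by (intro mult_right_mono) auto
  finally have "norm (((J h ^^ Suc n) (A x) - (J h ^^ Suc n) y) + ((J h ^^ Suc n) y - y) + (y - A x))
      \<le> norm (A x - y) + real N * h * norm (A y) + norm (y - A x)"
    by (intro norm_triangle_le add_mono norm_J_pow_diff_le[OF h AxH yH] order_refl)
  then have "norm ((J h ^^ Suc n) (A x) - A x) \<le> ?C" by (simp add: norm_minus_commute)
  then have "norm (h *\<^sub>R ((J h ^^ Suc n) (A x) - A x)) \<le> h * ?C" using h by simp
  then have "norm (((J h ^^ n) x - x - (real n * h) *\<^sub>R A x) + h *\<^sub>R ((J h ^^ Suc n) (A x) - A x))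
      \<le> real n * h * ?C + h * ?C"
    using Suc by (intro norm_triangle_le add_mono) auto
  also have "((J h ^^ n) x - x - (real n * h) *\<^sub>R A x) + h *\<^sub>R ((J h ^^ Suc n) (A x) - A x)
      = ((J h ^^ n) x - x - (real n * h) *\<^sub>R A x) + ((J h ^^ Suc n) x - (J h ^^ n) x) - h *\<^sub>R A x"
    unfolding step by (simp add: scaleR_diff_right)
  also have "\<dots> = (J h ^^ Suc n) x - x - (real (Suc n) * h) *\<^sub>R A x"
    by (simp add: scaleR_add_left distrib_right)
  finally show ?case by (simp add: distrib_right)
qed simp

text \<open>The limit of the estimate for powers: the elapsed grid time tends to t from below, and
  the error is quadratic in t up to a term controlled by the choice of y.\<close>

lemma sg_first_order:
  assumes t: "t \<ge> 0" and x: "x \<in> D" and y: "y \<in> D"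
  shows "norm (sg t x - x - t *\<^sub>R A x) \<le> t * (t * norm (A y) + 2 * norm (A x - y))"
proof (rule tendsto_upperbound)
  have xH: "x \<in> H" using x D_sub by auto
  define s where "s k = real (nat \<lfloor>t * 2 ^ k\<rfloor>) * (1 / 2 ^ k)" for k :: nat
  have s: "s k \<le> t" "s k \<ge> t - (1/2) ^ k" "s k \<ge> 0" for k
  proof -
    have "real (nat \<lfloor>t * 2 ^ k\<rfloor>) \<le> t * 2 ^ k" "real (nat \<lfloor>t * 2 ^ k\<rfloor>) \<ge> t * 2 ^ k - 1"
      using t by simp_all
    then have "s k \<le> t * 2 ^ k * (1 / 2 ^ k)" "s k \<ge> (t * 2 ^ k - 1) * (1 / 2 ^ k)"
      unfolding s_def by (intro mult_right_mono; simp)+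
    then show "s k \<le> t" "s k \<ge> t - (1/2) ^ k" "s k \<ge> 0"
      by (simp_all add: s_def power_one_over diff_divide_distrib)
  qed
  have "(\<lambda>k. t - (1/2) ^ k) \<longlonglongrightarrow> t - 0" by (intro tendsto_intros LIMSEQ_power_zero) simp
  then have "s \<longlonglongrightarrow> t"
    by (intro tendsto_sandwich[of "\<lambda>k. t - (1/2) ^ k" s _ "\<lambda>k. t"]) (use s in auto)
  then show "(\<lambda>k. norm (euler k t x - x - s k *\<^sub>R A x)) \<longlonglongrightarrow> norm (sg t x - x - t *\<^sub>R A x)"
    by (intro tendsto_norm tendsto_diff tendsto_scaleR euler_tendsto t xH tendsto_const)
  show "\<forall>\<^sub>F k in sequentially. norm (euler k t x - x - s k *\<^sub>R A x)
      \<le> t * (t * norm (A y) + 2 * norm (A x - y))"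
  proof (intro always_eventually allI)
    fix k
    have "norm (euler k t x - x - s k *\<^sub>R A x) \<le> s k * (s k * norm (A y) + 2 * norm (A x - y))"
      unfolding euler_def s_def by (rule J_pow_first_order[OF _ x y]) simp_all
    also have "\<dots> \<le> t * (t * norm (A y) + 2 * norm (A x - y))"
      using s[of k] t by (intro mult_mono add_mono) auto
    finally show "norm (euler k t x - x - s k *\<^sub>R A x) \<le> t * (t * norm (A y) + 2 * norm (A x - y))" .
  qed
qed simp

lemma sg_derivative:
  assumes x: "x \<in> D" shows "((\<lambda>t. (1 / t) *\<^sub>R (sg t x - x)) \<longlongrightarrow> A x) (at_right 0)"
proof (rule tendstoI)
  fix e :: real assume e: "e > 0"
  then have e4: "e / 4 > 0" by simp
  \<comment> \<open>y is fixed before t: it keeps \<open>2 * norm (A x - y)\<close> below e / 2 once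
    and for all, and t then only has to be small against \<open>norm (A y)\<close>.\<close>
  obtain y where y: "y \<in> D" "norm (y - A x) < e / 4" using D_approx[OF A_in_H[OF x] e4] .
  have "((\<lambda>t. t * norm (A y)) \<longlongrightarrow> 0 * norm (A y)) (at_right 0)" by (intro tendsto_intros)
  then have "\<forall>\<^sub>F t in at_right 0. t * norm (A y) < e / 2" using e by (intro order_tendstoD) auto
  moreover have "\<forall>\<^sub>F t in at_right 0. t > (0::real)" by (simp add: eventually_at_right_less)
  ultimately show "\<forall>\<^sub>F t in at_right 0. dist ((1 / t) *\<^sub>R (sg t x - x)) (A x) < e"
  proof eventually_elim
    case (elim t)
    have "(1 / t) *\<^sub>R (sg t x - x) - A x = (1 / t) *\<^sub>R (sg t x - x - t *\<^sub>R A x)"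
      using elim by (simp add: scaleR_diff_right)
    then have "norm ((1 / t) *\<^sub>R (sg t x - x) - A x) = (1 / t) * norm (sg t x - x - t *\<^sub>R A x)"
      using elim by simp
    also have "\<dots> \<le> (1 / t) * (t * (t * norm (A y) + 2 * norm (A x - y)))"
      using elim by (intro mult_left_mono sg_first_order x y) auto
    also have "\<dots> = t * norm (A y) + 2 * norm (y - A x)" using elim by (simp add: norm_minus_commute)
    also have "\<dots> < e" using elim y(2) by simp
    finally show ?case by (simp add: dist_norm)
  qed
qed

text \<open>The generator cannot have a larger domain. If the orbit of u has derivative v at 0, take
  w in D with w - A w = u - v; then d = u - w has derivative d at 0, while contractivity forces
  (derivative, d) <= 0. Hence d = 0.\<close>

lemma generator_sg: "is_generator H sg D A"
  unfolding is_generator_def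
proof (intro conjI ballI)
  show "D = {u \<in> H. \<exists>v. ((\<lambda>t. (1 / t) *\<^sub>R (sg t u - u)) \<longlongrightarrow> v) (at_right 0)}"
  proof
    show "D \<subseteq> {u \<in> H. \<exists>v. ((\<lambda>t. (1 / t) *\<^sub>R (sg t u - u)) \<longlongrightarrow> v) (at_right 0)}"
      using D_sub sg_derivative by blast
    show "{u \<in> H. \<exists>v. ((\<lambda>t. (1 / t) *\<^sub>R (sg t u - u)) \<longlongrightarrow> v) (at_right 0)} \<subseteq> D"
    proof clarify
      fix u v assume u: "u \<in> H" and lim: "((\<lambda>t. (1 / t) *\<^sub>R (sg t u - u)) \<longlongrightarrow> v) (at_right 0)"
      have ev: "\<forall>\<^sub>F t in at_right 0. t > (0::real)" by (simp add: eventually_at_right_less)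
      have v: "v \<in> H"
      proof (rule Lim_in_closed_set[OF closed_H _ trivial_limit_at_right_real lim])
        show "\<forall>\<^sub>F t in at_right 0. (1 / t) *\<^sub>R (sg t u - u) \<in> H"
          using ev by eventually_elim
            (auto intro!: subspace_scale[OF subspace_H] subspace_diff[OF subspace_H] sg_in_H u)
      qed
      define w where "w = J 1 (u - v)"
      have uv: "u - v \<in> H" by (rule subspace_diff[OF subspace_H u v])
      have w: "w \<in> D" "w - A w = u - v"
        using J_in_D[OF zero_less_one uv] J_eq[OF zero_less_one uv] by (simp_all only: w_def scaleR_one)
      have wH: "w \<in> H" using w D_sub by auto
      define d where "d = u - w"
      have dH: "d \<in> H" unfolding d_def by (rule subspace_diff[OF subspace_H u wH])
      have d: "v - A w = d"
      proof -
        have "v - A w - d = (w - A w) - (u - v)" by (simp add: d_def)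
        then show ?thesis unfolding w(2) by simp
      qed
      have "((\<lambda>t. (1 / t) *\<^sub>R (sg t u - u) - (1 / t) *\<^sub>R (sg t w - w)) \<longlongrightarrow> d) (at_right 0)"
        unfolding d[symmetric] by (intro tendsto_diff lim sg_derivative w)
      then have limd: "((\<lambda>t. (1 / t) *\<^sub>R (sg t d - d)) \<longlongrightarrow> d) (at_right 0)"
      proof (rule Lim_transform_eventually)
        show "\<forall>\<^sub>F t in at_right 0. (1 / t) *\<^sub>R (sg t u - u) - (1 / t) *\<^sub>R (sg t w - w)
            = (1 / t) *\<^sub>R (sg t d - d)"
          using ev by eventually_elim (simp add: d_def sg_diff u wH flip: scaleR_diff_right)
      qed
      have "inner d d \<le> 0"
      proof (rule tendsto_upperbound)
        show "((\<lambda>t. inner ((1 / t) *\<^sub>R (sg t d - d)) d) \<longlongrightarrow> inner d d) (at_right 0)"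
          by (intro tendsto_inner limd tendsto_const)
        show "\<forall>\<^sub>F t in at_right 0. inner ((1 / t) *\<^sub>R (sg t d - d)) d \<le> 0"
          using ev
        proof eventually_elim
          case (elim t)
          have "inner (sg t d) d \<le> norm (sg t d) * norm d" by (rule norm_cauchy_schwarz)
          also have "\<dots> \<le> norm d * norm d" using elim by (intro mult_right_mono norm_sg_le dH) auto
          finally show ?case
            using elim by (simp add: inner_diff_left divide_le_0_iff power2_norm_eq_inner flip: power2_eq_square)
        qed
      qed simp
      then have "d = 0" using inner_gt_zero_iff[of d] by linarith
      then show "u \<in> D" using w(1) by (simp add: d_def)
    qed
  qed
qed (rule sg_derivative)

end

section \<open>Exponential rescaling of a semigroup\<close>

lemma exp_shift_difference_quotient:
  fixes f :: "real \<Rightarrow> 'a::real_normed_vector"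
  assumes "((\<lambda>t. (1 / t) *\<^sub>R (f t - u)) \<longlongrightarrow> v) (at_right 0)"
  shows "((\<lambda>t. (1 / t) *\<^sub>R (exp (c * t) *\<^sub>R f t - u)) \<longlongrightarrow> v + c *\<^sub>R u) (at_right 0)"
proof -
  have "((\<lambda>t. exp (c * t)) has_real_derivative c) (at 0)"
    by (auto intro!: derivative_eq_intros)
  then have "((\<lambda>t. (exp (c * t) - 1) / t) \<longlongrightarrow> c) (at 0)" by (simp add: DERIV_def)
  then have 1: "((\<lambda>t. (exp (c * t) - 1) / t) \<longlongrightarrow> c) (at_right 0)"
    by (rule tendsto_within_subset) simp
  have 2: "((\<lambda>t. exp (c * t)) \<longlongrightarrow> exp (c * 0)) (at_right 0)" by (intro tendsto_intros)
  have "((\<lambda>t. exp (c * t) *\<^sub>R ((1 / t) *\<^sub>R (f t - u)) + ((exp (c * t) - 1) / t) *\<^sub>R u)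
      \<longlongrightarrow> exp (c * 0) *\<^sub>R v + c *\<^sub>R u) (at_right 0)"
    by (intro tendsto_add tendsto_scaleR 1 2 assms tendsto_const)
  then show ?thesis
    by (simp add: scaleR_diff_right scaleR_diff_left diff_divide_distrib)
qed

lemma is_generator_exp_shift:
  assumes gen: "is_generator H T D A" and B: "\<And>u. u \<in> D \<Longrightarrow> B u = A u + c *\<^sub>R u"
  shows "is_generator H (\<lambda>t u. exp (c * t) *\<^sub>R T t u) D B"
  unfolding is_generator_def
proof (intro conjI ballI)
  have D: "D = {u \<in> H. \<exists>v. ((\<lambda>t. (1 / t) *\<^sub>R (T t u - u)) \<longlongrightarrow> v) (at_right 0)}"
    using gen by (simp add: is_generator_def)
  have "(\<exists>v. ((\<lambda>t. (1 / t) *\<^sub>R (exp (c * t) *\<^sub>R T t u - u)) \<longlongrightarrow> v) (at_right 0)) \<longleftrightarrow>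
      (\<exists>v. ((\<lambda>t. (1 / t) *\<^sub>R (T t u - u)) \<longlongrightarrow> v) (at_right 0))" for u
  proof
    assume "\<exists>v. ((\<lambda>t. (1 / t) *\<^sub>R (exp (c * t) *\<^sub>R T t u - u)) \<longlongrightarrow> v) (at_right 0)"
    then obtain v where "((\<lambda>t. (1 / t) *\<^sub>R (exp (c * t) *\<^sub>R T t u - u)) \<longlongrightarrow> v) (at_right 0)" ..
    \<comment> \<open>Shifting by - c undoes the shift, so the same lemma gives both inclusions of
      the domains.\<close>
    from exp_shift_difference_quotient[OF this, of "- c"]
    show "\<exists>v. ((\<lambda>t. (1 / t) *\<^sub>R (T t u - u)) \<longlongrightarrow> v) (at_right 0)"
      by (auto simp flip: exp_add)
  next
    assume "\<exists>v. ((\<lambda>t. (1 / t) *\<^sub>R (T t u - u)) \<longlongrightarrow> v) (at_right 0)"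
    then obtain v where "((\<lambda>t. (1 / t) *\<^sub>R (T t u - u)) \<longlongrightarrow> v) (at_right 0)" ..
    from exp_shift_difference_quotient[OF this, of c]
    show "\<exists>v. ((\<lambda>t. (1 / t) *\<^sub>R (exp (c * t) *\<^sub>R T t u - u)) \<longlongrightarrow> v) (at_right 0)" ..
  qed
  then show "D = {u \<in> H. \<exists>v. ((\<lambda>t. (1 / t) *\<^sub>R (exp (c * t) *\<^sub>R T t u - u)) \<longlongrightarrow> v) (at_right 0)}"
    using D by simp
  fix u assume u: "u \<in> D"
  then have "((\<lambda>t. (1 / t) *\<^sub>R (T t u - u)) \<longlongrightarrow> A u) (at_right 0)"
    using gen by (simp add: is_generator_def)
  then show "((\<lambda>t. (1 / t) *\<^sub>R (exp (c * t) *\<^sub>R T t u - u)) \<longlongrightarrow> B u) (at_right 0)"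
    unfolding B[OF u] by (rule exp_shift_difference_quotient)
qed

lemma C0_semigroup_exp_shift:
  assumes C0: "C0_semigroup H T" and H: "csubspace H"
  shows "C0_semigroup H (\<lambda>t u. exp (c * t) *\<^sub>R T t u)"
  unfolding C0_semigroup_def
proof (intro conjI allI impI ballI)
  have T_lin: "linear_operator_in H H (T t)" if "t \<ge> 0" for t using C0 that by (simp add: C0_semigroup_def)
  have T_scaleR: "T t (r *\<^sub>R u) = r *\<^sub>R T t u" if "t \<ge> 0" "u \<in> H" for t r u
    using T_lin[OF that(1)] that(2) by (simp add: linear_operator_in_def flip: scaleC_of_real)
  have T_in: "T t u \<in> H" if "t \<ge> 0" "u \<in> H" for t u
    using T_lin[OF that(1)] that(2) by (auto simp: linear_operator_in_def)
  {
    fix t :: real assume t: "t \<ge> 0"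
    show "linear_operator_in H H (\<lambda>u. exp (c * t) *\<^sub>R T t u)"
      using T_lin[OF t] csubspace_scaleC[OF H]
      by (auto simp: linear_operator_in_def scaleC_add_right scaleC_scaleC mult.commute image_subset_iff
          simp flip: scaleC_of_real)
    obtain K where "\<forall>u\<in>H. norm (T t u) \<le> K * norm u" using C0 t by (auto simp: C0_semigroup_def)
    then show "\<exists>K. \<forall>u\<in>H. norm (exp (c * t) *\<^sub>R T t u) \<le> K * norm u"
      by (intro exI[of _ "exp (c * t) * K"]) (simp add: mult.assoc)
  }
  show "exp (c * 0) *\<^sub>R T 0 u = u" if "u \<in> H" for u
    using C0 that by (simp add: C0_semigroup_def)
  show "exp (c * (s + t)) *\<^sub>R T (s + t) u = exp (c * s) *\<^sub>R T s (exp (c * t) *\<^sub>R T t u)"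
    if "s \<ge> 0" "t \<ge> 0" "u \<in> H" for s t u
    using C0 that by (simp add: C0_semigroup_def T_scaleR T_in distrib_left exp_add)
  show "((\<lambda>t. exp (c * t) *\<^sub>R T t u) \<longlongrightarrow> u) (at_right 0)" if "u \<in> H" for u
  proof -
    have "((\<lambda>t. exp (c * t)) \<longlongrightarrow> exp (c * 0)) (at_right 0)" by (intro tendsto_intros)
    then have "((\<lambda>t. exp (c * t) *\<^sub>R T t u) \<longlongrightarrow> exp (c * 0) *\<^sub>R u) (at_right 0)"
      using C0 that by (intro tendsto_scaleR) (auto simp: C0_semigroup_def)
    then show ?thesis by simp
  qed
qed

text \<open>The dissipative case applied to B = A - \<omega>, then rescaled by exp (\<omega> t). The
  third conclusion concerns any semigroup generated by A and a closed set R preserved by the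
  resolvents; stability of R under real multiples absorbs the factor exp (\<omega> t) and the
  normalisation of the resolvents. R will be the set of real-valued functions.\<close>

theorem lumer_phillips:
  fixes H D :: "'a::{complex_inner, banach} set"
  assumes closed: "closed H" and cs: "csubspace H" and lin: "linear_operator_in H D A"
    and dis: "\<And>u. u \<in> D \<Longrightarrow> Re (cinner (A u) u) \<le> \<omega> * (norm u)\<^sup>2"
    and surj: "\<And>\<mu> f. \<mu> > \<omega> \<Longrightarrow> f \<in> H \<Longrightarrow> \<exists>u\<in>D. \<mu> *\<^sub>R u - A u = f"
  shows "quasi_m_dissipative_with \<omega> H D A"
    and "\<exists>T. C0_semigroup H T \<and> is_generator H T D A \<and> growth_bounded \<omega> H T"
    and "\<lbrakk>C0_semigroup H T; is_generator H T D A; closed R; \<And>r u. u \<in> R \<Longrightarrow> r *\<^sub>R u \<in> R;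
      \<And>\<mu> u. \<mu> > \<omega> \<Longrightarrow> u \<in> D \<Longrightarrow> \<mu> *\<^sub>R u - A u \<in> R \<Longrightarrow> u \<in> R; t \<ge> 0; u \<in> H; u \<in> R\<rbrakk> \<Longrightarrow> T t u \<in> R"
proof -
  define B where "B u = A u - \<omega> *\<^sub>R u" for u
  have DH: "D \<subseteq> H" and csD: "csubspace D" and sH: "subspace H"
    using lin cs csubspace_imp_subspace by (auto simp: linear_operator_in_def)
  \<comment> \<open>With \<mu> = 1 / h + \<omega>, the step sizes h > 0 correspond exactly to the
    values \<mu> > \<omega>.\<close>
  have res: "u - h *\<^sub>R B u = h *\<^sub>R ((1 / h + \<omega>) *\<^sub>R u - A u)" if "h > 0" for h u
    using that by (simp add: B_def scaleR_diff_right scaleR_add_left scaleR_add_right distrib_left)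
  interpret m_dissipative_operator H D B
  proof
    show "linear_operator_in H D B"
      unfolding linear_operator_in_def
    proof (intro conjI ballI allI)
      show "B ` D \<subseteq> H"
        using lin DH by (auto simp: B_def linear_operator_in_def intro!: subspace_diff[OF sH] subspace_scale[OF sH])
      show "B (x + y) = B x + B y" if "x \<in> D" "y \<in> D" for x y
        using lin that by (simp add: B_def linear_operator_in_def scaleR_add_right)
      show "B (c *\<^sub>C x) = c *\<^sub>C B x" if "x \<in> D" for c x
        using lin that
        by (simp add: B_def linear_operator_in_def scaleC_diff_right scaleC_scaleC mult.commute
            flip: scaleC_of_real)
    qed (use csD DH in auto)
    show "inner (B u) u \<le> 0" if "u \<in> D" for u
      using dis[OF that] by (simp add: B_def inner_diff_left Re_cinner power2_norm_eq_inner)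
    show "\<exists>u\<in>D. u - h *\<^sub>R B u = f" if "h > 0" "f \<in> H" for h f
    proof -
      have "1 / h + \<omega> > \<omega>" "(1 / h) *\<^sub>R f \<in> H" using that subspace_scale[OF sH] by auto
      then obtain u where "u \<in> D" "(1 / h + \<omega>) *\<^sub>R u - A u = (1 / h) *\<^sub>R f" using surj by blast
      then show ?thesis using that(1) by (intro bexI[of _ u]) (simp_all add: res)
    qed
  qed (rule closed, rule cs)
  have A: "A u = B u + \<omega> *\<^sub>R u" for u by (simp add: B_def)
  \<comment> \<open>The continuous shear (x, y) to (x, y - \<omega> x) carries the graph of A to
    that of B.\<close>
  have closedA: "closed_operator D A"
    unfolding closed_operator_def closed_sequential_limits
  proof (intro allI impI, elim conjE)
    fix p l assume p: "\<forall>n. p n \<in> {(x, A x) |x. x \<in> D}" and lim: "p \<longlonglongrightarrow> l"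
    have p': "snd (p n) = A (fst (p n))" "fst (p n) \<in> D" for n
      using p[rule_format, of n] by auto
    have c: "(\<lambda>n. (fst (p n), snd (p n) - \<omega> *\<^sub>R fst (p n))) \<longlonglongrightarrow> (fst l, snd l - \<omega> *\<^sub>R fst l)"
      by (rule tendsto_Pair[OF tendsto_fst[OF lim] tendsto_diff[OF tendsto_snd[OF lim]
            tendsto_scaleR[OF tendsto_const tendsto_fst[OF lim]]]])
    have m: "(fst (p n), snd (p n) - \<omega> *\<^sub>R fst (p n)) \<in> {(x, B x) |x. x \<in> D}" for n
      using p'[of n] by (auto simp: B_def)
    have "(fst l, snd l - \<omega> *\<^sub>R fst l) \<in> {(x, B x) |x. x \<in> D}"
      by (rule closed_sequentially[OF closed_A[unfolded closed_operator_def] m c])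
    then have "fst l \<in> D" "snd l = A (fst l)" by (auto simp: B_def)
    then show "l \<in> {(x, A x) |x. x \<in> D}" by (auto intro!: exI[of _ "fst l"] prod_eqI)
  qed
  have "(\<lambda>u. (\<omega> + 1) *\<^sub>R u - A u) ` D = H"
  proof
    show "(\<lambda>u. (\<omega> + 1) *\<^sub>R u - A u) ` D \<subseteq> H"
      using lin DH by (auto simp: linear_operator_in_def intro!: subspace_diff[OF sH] subspace_scale[OF sH])
    show "H \<subseteq> (\<lambda>u. (\<omega> + 1) *\<^sub>R u - A u) ` D"
    proof
      fix f assume "f \<in> H"
      then obtain u where "u \<in> D" "(\<omega> + 1) *\<^sub>R u - A u = f" using surj[of "\<omega> + 1" f] by auto
      then show "f \<in> (\<lambda>u. (\<omega> + 1) *\<^sub>R u - A u) ` D" by blast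
    qed
  qed
  then show "quasi_m_dissipative_with \<omega> H D A"
    unfolding quasi_m_dissipative_with_def quasi_dissipative_with_def densely_defined_def
    using lin closedA D_dense dis by (auto intro!: exI[of _ "\<omega> + 1"])
  let ?T = "\<lambda>t u. exp (\<omega> * t) *\<^sub>R sg t u"
  have T: "C0_semigroup H ?T" "is_generator H ?T D A"
    by (rule C0_semigroup_exp_shift[OF C0_semigroup_sg cs], rule is_generator_exp_shift[OF generator_sg A])
  moreover have "growth_bounded \<omega> H ?T"
    by (auto simp: growth_bounded_def norm_sg_le)
  ultimately show "\<exists>T. C0_semigroup H T \<and> is_generator H T D A \<and> growth_bounded \<omega> H T" by blast
  show "T t u \<in> R" if C0: "C0_semigroup H T" and gen: "is_generator H T D A" and R: "closed R"
      "\<And>r u. u \<in> R \<Longrightarrow> r *\<^sub>R u \<in> R"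
    and inv: "\<And>\<mu> u. \<mu> > \<omega> \<Longrightarrow> u \<in> D \<Longrightarrow> \<mu> *\<^sub>R u - A u \<in> R \<Longrightarrow> u \<in> R"
    and t: "t \<ge> 0" and u: "u \<in> H" "u \<in> R"
  proof -
    have "B u = A u + (- \<omega>) *\<^sub>R u" for u by (simp add: B_def)
    \<comment> \<open>The rescaled T and the Euler limit have the same generator, so uniqueness
      identifies them.\<close>
    then have "exp (- \<omega> * t) *\<^sub>R T t u = sg t u"
      using C0_semigroup_unique[OF closed cs C0_semigroup_exp_shift[OF C0 cs, of "- \<omega>"]
          is_generator_exp_shift[OF gen] C0_semigroup_sg generator_sg linear_A D_dense
          inner_A_le_0 t u(1)] by simp
    then have "exp (\<omega> * t) *\<^sub>R (exp (- \<omega> * t) *\<^sub>R T t u) = exp (\<omega> * t) *\<^sub>R sg t u" by simp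
    then have "T t u = exp (\<omega> * t) *\<^sub>R sg t u" by (simp flip: exp_add)
    moreover have "sg t u \<in> R"
    proof (rule sg_in_closed[OF t u(1) R(1) u(2)])
      fix h f assume h: "h > (0::real)" and f: "f \<in> H" "f \<in> R"
      have "h *\<^sub>R ((1 / h + \<omega>) *\<^sub>R J h f - A (J h f)) = f"
        unfolding res[OF h, symmetric] by (rule J_eq[OF h f(1)])
      then have "(1 / h) *\<^sub>R f = (1 / h) *\<^sub>R (h *\<^sub>R ((1 / h + \<omega>) *\<^sub>R J h f - A (J h f)))" by (simp only:)
      also have "\<dots> = (1 / h + \<omega>) *\<^sub>R J h f - A (J h f)" using h by simp
      finally have m: "(1 / h + \<omega>) *\<^sub>R J h f - A (J h f) \<in> R"
        by (rule subst[of _ _ "\<lambda>v. v \<in> R"]) (rule R(2)[OF f(2)])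
      show "J h f \<in> R" by (rule inv[OF _ J_in_D[OF h f(1)] m]) (simp add: h)
    qed
    ultimately show ?thesis by (simp only: R(2))
  qed
qed

section \<open>Completeness of \<open>L\<^sup>2\<close>\<close>

lemma sq_integrable_rep: "sq_integrable (rep_l2 u)"
  using Quotient_rep_reflp[OF Quotient_l2, of u] by simp

lemma rep_l2_measurable [measurable]: "rep_l2 u \<in> borel_measurable lborel"
  using sq_integrable_rep[of u] by (simp add: sq_integrable_def)

lemma rep_l2_measurable_borel [measurable]: "rep_l2 u \<in> borel_measurable borel"
  using rep_l2_measurable[of u] by simp

lemma abs_l2_rep: "abs_l2 (rep_l2 u) = u"
  using Quotient_abs_rep[OF Quotient_l2] .

lemma rep_abs_l2: "sq_integrable f \<Longrightarrow> AE x in lborel. rep_l2 (abs_l2 f) x = f x"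
  using Quotient_rep_abs[OF Quotient_l2, of f] by auto

lemma l2_eqI: "AE x in lborel. rep_l2 u x = rep_l2 v x \<Longrightarrow> u = v"
  using Quotient_rel_rep[OF Quotient_l2, of u v] sq_integrable_rep by auto

lemma rep_zero_l2: "AE x in lborel. rep_l2 0 x = 0"
  unfolding zero_l2_def by (simp add: rep_abs_l2 sq_integrable_zero)

lemma rep_add_l2: "AE x in lborel. rep_l2 (u + v) x = rep_l2 u x + rep_l2 v x"
  using rep_abs_l2[OF sq_integrable_add[OF sq_integrable_rep sq_integrable_rep], of u v]
    plus_l2.abs_eq[of "rep_l2 u" "rep_l2 v"] by (simp add: sq_integrable_rep abs_l2_rep)

lemma rep_scaleC_l2: "AE x in lborel. rep_l2 (c *\<^sub>C u) x = c * rep_l2 u x"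
  using rep_abs_l2[OF sq_integrable_mult[OF sq_integrable_rep], of c u]
    scaleC_l2.abs_eq[of "rep_l2 u" c] by (simp add: sq_integrable_rep abs_l2_rep)

lemma rep_uminus_l2: "AE x in lborel. rep_l2 (- u) x = - rep_l2 u x"
  using rep_scaleC_l2[of "-1" u] by (simp add: uminus_l2_def)

lemma rep_diff_l2: "AE x in lborel. rep_l2 (u - v) x = rep_l2 u x - rep_l2 v x"
  using rep_add_l2[of u "- v"] rep_uminus_l2[of v] by eventually_elim simp

lemma cinner_l2_rep: "cinner u v = (LINT x|lborel. rep_l2 u x * cnj (rep_l2 v x))"
  using cinner_l2.abs_eq[of "rep_l2 u" "rep_l2 v"] by (simp add: sq_integrable_rep abs_l2_rep)

lemma norm_l2_rep: "(norm u)\<^sup>2 = (LINT x|lborel. (cmod (rep_l2 u x))\<^sup>2)"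
proof -
  have "(norm u)\<^sup>2 = Re (cinner u u)" by (simp add: Re_cinner power2_norm_eq_inner)
  also have "\<dots> = (LINT x|lborel. (cmod (rep_l2 u x))\<^sup>2)"
    by (simp only: cinner_l2_rep complex_norm_square[symmetric] integral_complex_of_real Re_complex_of_real)
  finally show ?thesis .
qed

lemma ennreal_norm_l2_rep: "ennreal ((norm u)\<^sup>2) = (\<integral>\<^sup>+x. ennreal ((cmod (rep_l2 u x))\<^sup>2) \<partial>lborel)"
  unfolding norm_l2_rep using sq_integrable_rep[of u]
  by (intro nn_integral_eq_integral[symmetric]) (auto simp: sq_integrable_def)

lemma ennreal_norm_diff_l2_rep:
  "ennreal ((norm (u - v))\<^sup>2) = (\<integral>\<^sup>+x. ennreal ((cmod (rep_l2 u x - rep_l2 v x))\<^sup>2) \<partial>lborel)"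
  unfolding ennreal_norm_l2_rep
  by (rule nn_integral_cong_AE) (use rep_diff_l2[of u v] in eventually_elim, simp)

lemma sq_integrable_cong:
  assumes "sq_integrable f" "g \<in> borel_measurable lborel" "\<And>x. cmod (g x) \<le> cmod (f x)"
  shows "sq_integrable g"
proof -
  have [measurable]: "g \<in> borel_measurable lborel" by fact
  have "integrable lborel (\<lambda>x. (cmod (g x))\<^sup>2)"
  proof (rule Bochner_Integration.integrable_bound)
    show "integrable lborel (\<lambda>x. (cmod (f x))\<^sup>2)" using assms by (simp add: sq_integrable_def)
    show "AE x in lborel. norm ((cmod (g x))\<^sup>2) \<le> norm ((cmod (f x))\<^sup>2)"
      using assms(3) by (simp add: power_mono)
  qed measurable
  then show ?thesis using assms(2) by (simp add: sq_integrable_def)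
qed

text \<open>Young's inequality for |g k| = (2^(k/2) |g k|) 2^(-k/2). On a line of infinite measure
  square integrability bounds no L1 norm of the increments, so absolute summability is reached
  pointwise through weighted squares.\<close>

lemma summable_if_weighted_squares_summable:
  fixes g :: "nat \<Rightarrow> real"
  assumes "summable (\<lambda>k. 2 ^ k * (g k)\<^sup>2)"
  shows "summable (\<lambda>k. \<bar>g k\<bar>)"
proof (rule summable_comparison_test')
  have "summable (\<lambda>k. (1/2 :: real) ^ k)" by (rule summable_geometric) simp
  then show "summable (\<lambda>k. 2 ^ k * (g k)\<^sup>2 + (1/2) ^ k)" using assms by (rule summable_add[rotated])
  fix k
  define a :: real where "a = sqrt 2 ^ k"
  have a: "a > 0" "a\<^sup>2 = 2 ^ k" by (simp_all add: a_def power2_eq_square flip: power_mult_distrib)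
  have "\<bar>g k\<bar> = \<bar>a * g k\<bar> * (1 / a)" using a by (simp add: abs_mult)
  also have "\<dots> \<le> (a * g k)\<^sup>2 + (1 / a)\<^sup>2"
  proof -
    have "2 * (\<bar>a * g k\<bar> * (1 / a)) \<le> (a * g k)\<^sup>2 + (1 / a)\<^sup>2"
      using sum_squares_bound[of "\<bar>a * g k\<bar>" "1 / a"] by (simp add: mult.assoc)
    moreover have "0 \<le> \<bar>a * g k\<bar> * (1 / a)" using a by simp
    ultimately show ?thesis by linarith
  qed
  also have "\<dots> = 2 ^ k * (g k)\<^sup>2 + (1/2) ^ k"
    using a by (simp add: power_mult_distrib power_one_over power_divide)
  finally show "norm \<bar>g k\<bar> \<le> 2 ^ k * (g k)\<^sup>2 + (1/2) ^ k" by simp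
qed

text \<open>The weighted squares 2^k |X (k+1) - X k|^2 have integrals at most 2^(-k). Their sum is
  therefore finite almost everywhere, and there the increments are absolutely summable.\<close>

lemma l2_fast_Cauchy_AE_convergent:
  fixes X :: "nat \<Rightarrow> l2"
  assumes X: "\<And>k. norm (X (Suc k) - X k) \<le> (1/2) ^ k"
  shows "AE x in lborel. convergent (\<lambda>k. rep_l2 (X k) x)"
proof -
  let ?g = "\<lambda>k x. cmod (rep_l2 (X (Suc k)) x - rep_l2 (X k) x)"
  have "(\<integral>\<^sup>+x. (\<Sum>k. ennreal (2 ^ k * (?g k x)\<^sup>2)) \<partial>lborel)
      = (\<Sum>k. \<integral>\<^sup>+x. ennreal (2 ^ k * (?g k x)\<^sup>2) \<partial>lborel)"
    by (intro nn_integral_suminf) measurable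
  also have "\<dots> = (\<Sum>k. ennreal (2 ^ k * (norm (X (Suc k) - X k))\<^sup>2))"
    by (intro suminf_cong) (simp add: ennreal_mult ennreal_norm_diff_l2_rep nn_integral_cmult)
  also have "\<dots> \<le> (\<Sum>k. ennreal ((1/2) ^ k))"
  proof (intro suminf_le ennreal_leI)
    fix k
    have "2 ^ k * (norm (X (Suc k) - X k))\<^sup>2 \<le> 2 ^ k * ((1/2) ^ k)\<^sup>2"
      using X[of k] by (intro mult_left_mono power_mono) auto
    also have "\<dots> = (1/2 :: real) ^ k"
      by (simp add: power2_eq_square power_one_over)
    finally show "2 ^ k * (norm (X (Suc k) - X k))\<^sup>2 \<le> (1/2) ^ k" .
  qed auto
  also have "\<dots> = ennreal (\<Sum>k. (1/2) ^ k)"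
    by (rule suminf_ennreal2) (auto intro: summable_geometric)
  also have "\<dots> < \<infinity>" by simp
  finally have "(\<integral>\<^sup>+x. (\<Sum>k. ennreal (2 ^ k * (?g k x)\<^sup>2)) \<partial>lborel) \<noteq> \<infinity>" by simp
  then have "AE x in lborel. (\<Sum>k. ennreal (2 ^ k * (?g k x)\<^sup>2)) \<noteq> \<infinity>"
    by (intro nn_integral_PInf_AE) measurable
  then show ?thesis
  proof eventually_elim
    case (elim x)
    then have "summable (\<lambda>k. 2 ^ k * (?g k x)\<^sup>2)"
      by (intro summable_suminf_not_top) auto
    then have "summable (\<lambda>k. \<bar>?g k x\<bar>)" by (rule summable_if_weighted_squares_summable)
    then have "summable (\<lambda>k. rep_l2 (X (Suc k)) x - rep_l2 (X k) x)"
      unfolding abs_norm_cancel by (rule summable_norm_cancel)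
    then have "convergent (\<lambda>n. rep_l2 (X n) x - rep_l2 (X 0) x)"
      by (simp add: summable_iff_convergent sum_lessThan_telescope[of "\<lambda>i. rep_l2 (X i) x"])
    then show ?case
      using convergent_add_const_iff[of "- rep_l2 (X 0) x" "\<lambda>n. rep_l2 (X n) x"]
      by (simp add: add.commute)
  qed
qed

text \<open>Fatou's lemma bounds the distance from the pointwise limit f to X j by the Cauchy bound.
  This first puts f - X N, hence f, in L2 and then gives convergence in norm.\<close>

lemma l2_Cauchy_limit_if_AE_convergent:
  fixes X :: "nat \<Rightarrow> l2"
  assumes C: "Cauchy X" and conv: "AE x in lborel. convergent (\<lambda>k. rep_l2 (X k) x)"
  shows "convergent X"
proof -
  define f where "f x = lim (\<lambda>k. rep_l2 (X k) x)" for x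
  have [measurable]: "f \<in> borel_measurable lborel"
    unfolding f_def by (rule borel_measurable_lim_metric) measurable
  have lim: "AE x in lborel. (\<lambda>k. rep_l2 (X k) x) \<longlonglongrightarrow> f x"
    using conv by eventually_elim (simp add: f_def convergent_LIMSEQ_iff)
  have est: "(\<integral>\<^sup>+x. ennreal ((cmod (f x - rep_l2 (X j) x))\<^sup>2) \<partial>lborel) \<le> ennreal (e\<^sup>2)"
    if e: "\<And>k. k \<ge> j \<Longrightarrow> norm (X k - X j) \<le> e" "e \<ge> 0" for j e
  proof -
    have "(\<integral>\<^sup>+x. ennreal ((cmod (f x - rep_l2 (X j) x))\<^sup>2) \<partial>lborel)
        = (\<integral>\<^sup>+x. liminf (\<lambda>k. ennreal ((cmod (rep_l2 (X k) x - rep_l2 (X j) x))\<^sup>2)) \<partial>lborel)"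
    proof (rule nn_integral_cong_AE)
      show "AE x in lborel. ennreal ((cmod (f x - rep_l2 (X j) x))\<^sup>2)
          = liminf (\<lambda>k. ennreal ((cmod (rep_l2 (X k) x - rep_l2 (X j) x))\<^sup>2))"
        using lim
      proof eventually_elim
        case (elim x)
        have "(\<lambda>k. ennreal ((cmod (rep_l2 (X k) x - rep_l2 (X j) x))\<^sup>2))
            \<longlonglongrightarrow> ennreal ((cmod (f x - rep_l2 (X j) x))\<^sup>2)"
          by (intro tendsto_ennrealI tendsto_intros elim)
        then show ?case by (intro lim_imp_Liminf[symmetric]) auto
      qed
    qed
    also have "\<dots> \<le> liminf (\<lambda>k. \<integral>\<^sup>+x. ennreal ((cmod (rep_l2 (X k) x - rep_l2 (X j) x))\<^sup>2) \<partial>lborel)"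
      by (rule nn_integral_liminf) measurable
    also have "\<dots> = liminf (\<lambda>k. ennreal ((norm (X k - X j))\<^sup>2))"
      by (simp add: ennreal_norm_diff_l2_rep)
    also have "\<dots> \<le> limsup (\<lambda>k. ennreal ((norm (X k - X j))\<^sup>2))" by (rule Liminf_le_Limsup) simp
    also have "\<dots> \<le> ennreal (e\<^sup>2)"
    proof (rule Limsup_bounded)
      show "\<forall>\<^sub>F k in sequentially. ennreal ((norm (X k - X j))\<^sup>2) \<le> ennreal (e\<^sup>2)"
        using eventually_ge_at_top[of j] by eventually_elim (intro ennreal_leI power_mono e, auto)
    qed
    finally show ?thesis .
  qed
  have Cj: "\<exists>N. \<forall>j\<ge>N. \<forall>k\<ge>j. norm (X k - X j) \<le> e" if e: "e > 0" for e
  proof -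
    obtain N where "\<And>m n. m \<ge> N \<Longrightarrow> n \<ge> N \<Longrightarrow> dist (X m) (X n) < e"
      using metric_CauchyD[OF C e] by blast
    then show ?thesis by (intro exI[of _ N]) (auto simp: dist_norm less_imp_le)
  qed
  obtain N where N: "\<And>k. k \<ge> N \<Longrightarrow> norm (X k - X N) \<le> 1" using Cj[of 1] by auto
  have "integrable lborel (\<lambda>x. (cmod (f x - rep_l2 (X N) x))\<^sup>2)"
    using est[OF N] by (intro integrableI_nonneg) (auto intro: le_less_trans)
  then have "sq_integrable (\<lambda>x. f x - rep_l2 (X N) x)" by (simp add: sq_integrable_def)
  from sq_integrable_add[OF this sq_integrable_rep[of "X N"]]
  have f: "sq_integrable f" by simp
  have "X \<longlonglongrightarrow> abs_l2 f"
  proof (rule LIMSEQ_I)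
    fix r :: real assume r: "r > 0"
    obtain N where N: "\<And>j k. j \<ge> N \<Longrightarrow> k \<ge> j \<Longrightarrow> norm (X k - X j) \<le> r / 2" using Cj[of "r/2"] r by auto
    have "norm (X j - abs_l2 f) < r" if j: "j \<ge> N" for j
    proof -
      have "ennreal ((norm (abs_l2 f - X j))\<^sup>2) \<le> ennreal ((r / 2)\<^sup>2)"
      proof -
        have "ennreal ((norm (abs_l2 f - X j))\<^sup>2)
            = (\<integral>\<^sup>+x. ennreal ((cmod (f x - rep_l2 (X j) x))\<^sup>2) \<partial>lborel)"
          unfolding ennreal_norm_diff_l2_rep
          by (rule nn_integral_cong_AE) (use rep_abs_l2[OF f] in eventually_elim, simp)
        also have "\<dots> \<le> ennreal ((r / 2)\<^sup>2)" using N[OF j] r by (intro est) auto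
        finally show ?thesis .
      qed
      then have "(norm (abs_l2 f - X j))\<^sup>2 \<le> (r / 2)\<^sup>2" by (simp add: ennreal_le_iff)
      then have "norm (abs_l2 f - X j) \<le> r / 2" using r by (intro power2_le_imp_le[of "norm (abs_l2 f - X j)"]) auto
      then show ?thesis using r by (simp add: norm_minus_commute)
    qed
    then show "\<exists>N. \<forall>j\<ge>N. norm (X j - abs_l2 f) < r" by blast
  qed
  then show ?thesis by (rule convergentI)
qed

instance l2 :: banach
proof
  fix X :: "nat \<Rightarrow> l2" assume C: "Cauchy X"
  have "\<exists>N. \<forall>n\<ge>N. dist (X n) (X N) < (1/2) ^ k" for k :: nat
    using metric_CauchyD[OF C, of "(1/2) ^ k"] by force
  then obtain N where N: "\<And>k n. n \<ge> N k \<Longrightarrow> dist (X n) (X (N k)) < (1/2) ^ k" by metis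
  \<comment> \<open>Strictly increasing and at least N k, so that X becomes fast Cauchy along
    r.\<close>
  define r where "r = rec_nat (N 0) (\<lambda>k m. max (Suc m) (N (Suc k)))"
  have r: "strict_mono r" by (rule strict_monoI_Suc) (simp add: r_def)
  have rN: "r k \<ge> N k" for k by (cases k) (simp_all add: r_def)
  \<comment> \<open>Both terms are compared with \<open>X (N (Suc k))\<close>, at distances below
    (1/2)^(k+1); the index shift by \<open>Suc\<close> pays for the factor 2 of the triangle
    inequality.\<close>
  have "norm ((X \<circ> r \<circ> Suc) (Suc k) - (X \<circ> r \<circ> Suc) k) \<le> (1/2) ^ k" for k
  proof -
    have "N (Suc k) \<le> r (Suc (Suc k))"
      using rN[of "Suc k"] strict_mono_less[OF r, of "Suc k" "Suc (Suc k)"] by simp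
    from N[OF this] N[OF rN[of "Suc k"]]
    have "dist (X (r (Suc (Suc k)))) (X (r (Suc k))) < (1/2) ^ Suc k + (1/2) ^ Suc k"
      using dist_triangle2[of "X (r (Suc (Suc k)))" "X (r (Suc k))" "X (N (Suc k))"] by linarith
    then show ?thesis by (simp add: dist_norm)
  qed
  then have conv: "AE x in lborel. convergent (\<lambda>k. rep_l2 ((X \<circ> r \<circ> Suc) k) x)"
    by (rule l2_fast_Cauchy_AE_convergent)
  have sm: "strict_mono (r \<circ> Suc)" using r by (auto simp: strict_mono_def)
  have "Cauchy (X \<circ> r \<circ> Suc)"
    using Cauchy_subseq_Cauchy[OF C sm] by (simp add: comp_assoc)
  then have "convergent (X \<circ> r \<circ> Suc)" by (rule l2_Cauchy_limit_if_AE_convergent[OF _ conv])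
  then obtain l where "(X \<circ> (r \<circ> Suc)) \<longlonglongrightarrow> l" by (auto simp: convergent_def comp_assoc)
  then show "convergent X" using Cauchy_converges_subseq[OF C sm] by (auto simp: convergent_def)
qed

section \<open>Functions on an interval as a closed subspace, and complex conjugation\<close>

lemma L2_interval_iff: "u \<in> L2_interval b \<longleftrightarrow> (AE x in lborel. x \<notin> {0<..<b} \<longrightarrow> rep_l2 u x = 0)"
  by (simp add: L2_interval_def)

lemma csubspace_L2_interval: "csubspace (L2_interval b)"
  unfolding csubspace_def
proof (intro conjI ballI allI)
  show "0 \<in> L2_interval b" using rep_zero_l2 unfolding L2_interval_iff by eventually_elim simp
  show "u + v \<in> L2_interval b" if "u \<in> L2_interval b" "v \<in> L2_interval b" for u v
    using rep_add_l2[of u v] that unfolding L2_interval_iff by eventually_elim simp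
  show "c *\<^sub>C u \<in> L2_interval b" if "u \<in> L2_interval b" for c u
    using rep_scaleC_l2[of c u] that unfolding L2_interval_iff by eventually_elim simp
qed

text \<open>The mass of the limit u outside the interval is at most
  \<open>(norm (X n - u))\<^sup>2\<close>, because X n vanishes there.\<close>

lemma closed_L2_interval: "closed (L2_interval b)"
  unfolding closed_sequential_limits
proof (intro allI impI, elim conjE)
  fix X u assume X: "\<forall>n. X n \<in> L2_interval b" and lim: "X \<longlonglongrightarrow> u"
  let ?N = "\<integral>\<^sup>+x. ennreal ((cmod (rep_l2 u x))\<^sup>2) * indicator (- {0<..<b}) x \<partial>lborel"
  have le: "?N \<le> ennreal ((norm (X n - u))\<^sup>2)" for n
    unfolding ennreal_norm_diff_l2_rep
  proof (rule nn_integral_mono_AE)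
    have "AE x in lborel. x \<notin> {0<..<b} \<longrightarrow> rep_l2 (X n) x = 0" using X by (simp add: L2_interval_iff)
    then show "AE x in lborel. ennreal ((cmod (rep_l2 u x))\<^sup>2) * indicator (- {0<..<b}) x
        \<le> ennreal ((cmod (rep_l2 (X n) x - rep_l2 u x))\<^sup>2)"
      by eventually_elim (auto simp: indicator_def)
  qed
  have "(\<lambda>n. ennreal ((norm (X n - u))\<^sup>2)) \<longlonglongrightarrow> ennreal ((norm (u - u))\<^sup>2)"
    by (intro tendsto_ennrealI tendsto_intros lim)
  then have "?N \<le> ennreal ((norm (u - u))\<^sup>2)" using le by (intro LIMSEQ_le_const) auto
  then have "?N = 0" by simp
  then have "AE x in lborel. ennreal ((cmod (rep_l2 u x))\<^sup>2) * indicator (- {0<..<b}) x = 0"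
    by (subst (asm) nn_integral_0_iff_AE) auto
  then show "u \<in> L2_interval b"
    unfolding L2_interval_iff by eventually_elim (auto simp: indicator_def split: if_splits)
qed

text \<open>Real-valued classes become the fixed points of this isometry, which makes reality a
  closed condition that can be checked by commuting the map with derivatives and traces.\<close>

definition conj_l2 :: "l2 \<Rightarrow> l2" where "conj_l2 u = abs_l2 (\<lambda>x. cnj (rep_l2 u x))"

lemma rep_conj_l2: "AE x in lborel. rep_l2 (conj_l2 u) x = cnj (rep_l2 u x)"
  unfolding conj_l2_def
proof (rule rep_abs_l2, rule sq_integrable_cong[OF sq_integrable_rep[of u]])
  show "(\<lambda>x. cnj (rep_l2 u x)) \<in> borel_measurable lborel"
    by (rule borel_measurable_continuous_on[of cnj]) (auto intro: continuous_intros)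
qed simp

lemma conj_diff_l2: "conj_l2 (u - v) = conj_l2 u - conj_l2 v"
  by (rule l2_eqI)
    (use rep_conj_l2[of "u - v"] rep_conj_l2[of u] rep_conj_l2[of v] rep_diff_l2[of u v]
      rep_diff_l2[of "conj_l2 u" "conj_l2 v"] in eventually_elim, simp)

lemma norm_conj_l2: "norm (conj_l2 u) = norm u"
proof -
  have "(norm (conj_l2 u))\<^sup>2 = (norm u)\<^sup>2"
    unfolding norm_l2_rep
    by (rule integral_cong_AE) (simp_all, use rep_conj_l2[of u] in eventually_elim, simp)
  then show ?thesis by (simp add: power2_eq_iff_nonneg)
qed

lemma continuous_conj_l2: "continuous_on UNIV conj_l2"
  unfolding continuous_on_iff by (auto simp: dist_norm norm_conj_l2 simp flip: conj_diff_l2)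

lemma conj_l2_in_L2_interval:
  assumes "u \<in> L2_interval b" shows "conj_l2 u \<in> L2_interval b"
  using assms rep_conj_l2[of u] unfolding L2_interval_iff by eventually_elim simp

lemma real_valued_iff: "real_valued u \<longleftrightarrow> (\<forall>e. conj_l2 (u $ e) = u $ e)"
proof -
  have "(AE x in lborel. rep_l2 v x \<in> \<real>) \<longleftrightarrow> conj_l2 v = v" for v
  proof
    assume r: "AE x in lborel. rep_l2 v x \<in> \<real>"
    show "conj_l2 v = v"
      by (rule l2_eqI) (use rep_conj_l2[of v] r in eventually_elim, simp add: Reals_cnj_iff)
  next
    assume a: "conj_l2 v = v"
    show "AE x in lborel. rep_l2 v x \<in> \<real>"
      using rep_conj_l2[of v, unfolded a] by eventually_elim (simp add: Reals_cnj_iff)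
  qed
  then show ?thesis by (simp add: real_valued_def)
qed

lemma closed_real_valued: "closed {u :: l2 ^ 'e::finite. real_valued u}"
proof -
  have "continuous_on UNIV (\<lambda>u :: l2 ^ 'e. conj_l2 (u $ e))" for e
    by (rule continuous_on_compose2[OF continuous_conj_l2]) (auto intro: continuous_intros)
  then have "closed {u :: l2 ^ 'e. \<forall>e. conj_l2 (u $ e) = u $ e}"
    by (intro closed_Collect_all closed_Collect_eq continuous_intros)
  then show ?thesis by (simp add: real_valued_iff)
qed

section \<open>Absolutely continuous functions\<close>

text \<open>Dynkin's argument: closed half-lines are stable under intersection and generate the
  Borel sets, so h has integral 0 over every Borel set.\<close>

lemma AE_zero_if_integrals_atMost_zero:
  fixes h :: "real \<Rightarrow> 'a::{banach, second_countable_topology}"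
  assumes h: "integrable lborel h" and 0: "\<And>y. (LINT x:{..y}|lborel. h x) = 0"
  shows "AE x in lborel. h x = 0"
proof -
  have [measurable]: "h \<in> borel_measurable lborel" using h by simp
  have si: "set_integrable lborel A h" if "A \<in> sets lborel" for A
    using integrable_mult_indicator[OF that h] by (simp add: set_integrable_def)
  \<comment> \<open>The total integral is what the step from a set to its complement uses.\<close>
  have all: "(LINT x|lborel. h x) = 0"
  proof -
    have "(\<lambda>n. LINT x:{..real n}|lborel. h x) \<longlonglongrightarrow> (LINT x:(\<Union>n. {..real n})|lborel. h x)"
      by (rule set_integral_cont_up) (auto simp: incseq_def intro!: si)
    moreover have "(\<Union>n. {..real n}) = UNIV"
      using real_arch_simple by auto
    ultimately have "(\<lambda>n. 0) \<longlonglongrightarrow> (LINT x:UNIV|lborel. h x)" by (simp add: 0)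
    then show ?thesis by (simp add: set_lebesgue_integral_def LIMSEQ_const_iff)
  qed
  have zero: "(LINT x:A|lborel. h x) = 0" if "A \<in> sigma_sets UNIV (range (\<lambda>a::real. {..a}))" for A
    using _ _ that
  proof (rule sigma_sets_induct_disjoint)
    show "Int_stable (range (\<lambda>a::real. {..a}))"
      by (auto simp: Int_stable_def min_def)
    show "(LINT x:A|lborel. h x) = 0" if "A \<in> range (\<lambda>a::real. {..a})" for A
      using that 0 by auto
    show "(LINT x:{}|lborel. h x) = 0" by (simp add: set_lebesgue_integral_def)
    show "(LINT x:UNIV - A|lborel. h x) = 0"
      if A: "A \<in> sigma_sets UNIV (range (\<lambda>a::real. {..a}))" and "(LINT x:A|lborel. h x) = 0" for A
    proof -
      have [measurable]: "A \<in> sets borel" using A by (simp add: borel_eq_atMost sets_measure_of)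
      have "(LINT x:A \<union> (UNIV - A)|lborel. h x) = (LINT x:A|lborel. h x) + (LINT x:UNIV - A|lborel. h x)"
        by (rule set_integral_Un; (rule si)?; measurable?)
      then show ?thesis using that(2) all by (simp add: set_lebesgue_integral_def)
    qed
    show "(LINT x:(\<Union>i. A i)|lborel. h x) = 0"
      if "disjoint_family A" and A: "range A \<subseteq> sigma_sets UNIV (range (\<lambda>a::real. {..a}))"
        and "\<And>i. (LINT x:A i|lborel. h x) = 0" for A :: "nat \<Rightarrow> real set"
    proof -
      have [measurable]: "A i \<in> sets borel" for i
        using A by (auto simp: borel_eq_atMost sets_measure_of)
      show ?thesis
        using that(1,3)
        by (subst lebesgue_integral_countable_add) (simp_all add: disjoint_family_on_def si)
    qed
  qed simp
  show ?thesis
  proof (rule sigma_finite_measure.density_zero[OF sigma_finite_lborel h])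
    fix A :: "real set" assume "A \<in> sets lborel"
    then show "(LINT x:A|lborel. h x) = 0" by (intro zero) (simp add: borel_eq_atMost sets_measure_of)
  qed
qed

text \<open>Absolute continuity on [0,b] in its integral form and with a chosen density f, so that
  differentiability almost everywhere never has to be discussed.\<close>

definition ac_on :: "real \<Rightarrow> (real \<Rightarrow> complex) \<Rightarrow> (real \<Rightarrow> complex) \<Rightarrow> bool"
  where "ac_on b F f \<longleftrightarrow>
    set_integrable lborel {0..b} f \<and> (\<forall>x\<in>{0..b}. F x = F 0 + (LINT t:{0..x}|lborel. f t))"

lemma ac_onD:
  assumes "ac_on b F f"
  shows "set_integrable lborel {0..b} f" "x \<in> {0..b} \<Longrightarrow> F x = F 0 + (LINT t:{0..x}|lborel. f t)"
  using assms unfolding ac_on_def by blast+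

lemma ac_on_primitive:
  assumes "set_integrable lborel {0..b} f"
  shows "ac_on b (\<lambda>x. c + (LINT t:{0..x}|lborel. f t)) f"
proof -
  have "(LINT t:{0..0::real}|lborel. f t) = 0"
    unfolding set_lebesgue_integral_def
    by (rule integral_eq_zero_AE) (use AE_lborel_singleton[of "0::real"] in eventually_elim, simp)
  then show ?thesis using assms by (simp add: ac_on_def)
qed

lemma set_integrable_subinterval:
  fixes f :: "real \<Rightarrow> complex"
  assumes "set_integrable lborel {0..b} f" "x \<in> {0..b}"
  shows "set_integrable lborel {0..x} f"
  using assms by (intro set_integrable_subset[OF assms(1)]) auto

lemma ac_on_continuous:
  assumes "ac_on b F f" shows "continuous_on {0..b} F"
proof -
  have "continuous_on {0..b} (\<lambda>x. F 0 + integral {0..x} f)"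
    by (intro continuous_intros indefinite_integral_continuous_1
        set_borel_integral_eq_integral(1)[OF ac_onD(1)[OF assms]])
  then show ?thesis
  proof (rule continuous_on_eq)
    fix x assume x: "x \<in> {0..b}"
    show "F 0 + integral {0..x} f = F x"
      using set_borel_integral_eq_integral(2)[OF set_integrable_subinterval[OF ac_onD(1)[OF assms] x]]
        ac_onD(2)[OF assms x] by simp
  qed
qed

lemma ac_on_C1:
  assumes "\<And>x. x \<in> {0..b} \<Longrightarrow> (F has_vector_derivative f x) (at x within {0..b})"
    and cont: "continuous_on {0..b} f"
  shows "ac_on b F f"
  unfolding ac_on_def
proof (intro conjI ballI)
  show "set_integrable lborel {0..b} f" by (rule borel_integrable_atLeastAtMost'[OF cont])
  fix x assume x: "x \<in> {0..b}"
  have "(LINT t:{0..x}|lborel. f t) = F x - F 0"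
    unfolding set_lebesgue_integral_def
  proof (rule integral_FTC_atLeastAtMost)
    show "(F has_vector_derivative f t) (at t within {0..x})" if "0 \<le> t" "t \<le> x" for t
      using assms(1)[of t] x that by (auto intro: has_vector_derivative_within_subset)
    show "continuous_on {0..x} f" using cont x by (auto intro: continuous_on_subset)
  qed (use x in simp)
  then show "F x = F 0 + (LINT t:{0..x}|lborel. f t)" by simp
qed

text \<open>An L2 class fixes its density only almost everywhere, so after each operation on classes
  the density is exchanged for the representative of the result; the end points form a null
  set.\<close>

lemma ac_on_cong_AE:
  assumes ac: "ac_on b F f" and FG: "\<And>x. x \<in> {0..b} \<Longrightarrow> F x = G x" and b: "b \<ge> 0"
    and ae: "AE x in lborel. x \<in> {0<..<b} \<longrightarrow> f x = g x" and [measurable]: "g \<in> borel_measurable lborel"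
  shows "ac_on b G g"
proof -
  have ae': "AE x in lborel. x \<in> {0..b} \<longrightarrow> f x = g x"
    using ae AE_lborel_singleton[of "0::real"] AE_lborel_singleton[of b]
    by eventually_elim (auto simp: less_le)
  have m: "(\<lambda>x. indicator {0..b} x *\<^sub>R f x) \<in> borel_measurable lborel"
    using ac_onD(1)[OF ac] by (auto simp: set_integrable_def)
  have "integrable lborel (\<lambda>x. indicator {0..b} x *\<^sub>R g x)"
  proof (subst integrable_cong_AE[OF _ m])
    show "AE x in lborel. indicator {0..b} x *\<^sub>R g x = indicator {0..b} x *\<^sub>R f x"
      using ae' by eventually_elim (auto simp: indicator_def)
    show "integrable lborel (\<lambda>x. indicator {0..b} x *\<^sub>R f x)"
      using ac_onD(1)[OF ac] by (simp add: set_integrable_def)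
  qed measurable
  moreover have "(LINT t:{0..x}|lborel. f t) = (LINT t:{0..x}|lborel. g t)" if x: "x \<in> {0..b}" for x
    unfolding set_lebesgue_integral_def
  proof (rule integral_cong_AE)
    show "(\<lambda>t. indicator {0..x} t *\<^sub>R f t) \<in> borel_measurable lborel"
      using set_integrable_subinterval[OF ac_onD(1)[OF ac] x] by (auto simp: set_integrable_def)
    show "AE t in lborel. indicator {0..x} t *\<^sub>R f t = indicator {0..x} t *\<^sub>R g t"
      using ae' by eventually_elim (use x in \<open>auto simp: indicator_def\<close>)
  qed measurable
  moreover have "G x = G 0 + (LINT t:{0..x}|lborel. f t)" if x: "x \<in> {0..b}" for x
    using ac_onD(2)[OF ac x] FG[OF x] FG[of 0] b by simp
  ultimately show ?thesis unfolding ac_on_def set_integrable_def by metis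
qed

lemma ac_on_add:
  assumes F: "ac_on b F f" and G: "ac_on b G g"
  shows "ac_on b (\<lambda>x. F x + G x) (\<lambda>x. f x + g x)"
  unfolding ac_on_def
proof (intro conjI ballI)
  show "set_integrable lborel {0..b} (\<lambda>x. f x + g x)"
    using ac_onD(1)[OF F] ac_onD(1)[OF G] by (rule set_integral_add)
  fix x assume x: "x \<in> {0..b}"
  show "F x + G x = F 0 + G 0 + (LINT t:{0..x}|lborel. f t + g t)"
    using ac_onD(2)[OF F x] ac_onD(2)[OF G x]
    by (subst set_integral_add(2)) (auto intro: set_integrable_subinterval[OF ac_onD(1) x] F G)
qed

lemma ac_on_cmult:
  assumes F: "ac_on b F f" shows "ac_on b (\<lambda>x. c * F x) (\<lambda>x. c * f x)"
  unfolding ac_on_def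
proof (intro conjI ballI)
  fix x assume x: "x \<in> {0..b}"
  show "c * F x = c * F 0 + (LINT t:{0..x}|lborel. c * f t)"
    by (subst ac_onD(2)[OF F x]) (simp add: distrib_left)
qed (use ac_onD(1)[OF F] in simp)

lemma ac_on_cnj:
  assumes F: "ac_on b F f" shows "ac_on b (\<lambda>x. cnj (F x)) (\<lambda>x. cnj (f x))"
  unfolding ac_on_def
proof (intro conjI ballI)
  have e: "(\<lambda>x. indicator A x *\<^sub>R cnj (f x)) = (\<lambda>x. cnj (indicator A x *\<^sub>R f x))" for A :: "real set"
    by (simp add: fun_eq_iff scaleR_conv_of_real)
  show "set_integrable lborel {0..b} (\<lambda>x. cnj (f x))"
    using ac_onD(1)[OF F] unfolding set_integrable_def e by (simp only: integrable_cnj)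
  fix x assume x: "x \<in> {0..b}"
  show "cnj (F x) = cnj (F 0) + (LINT t:{0..x}|lborel. cnj (f t))"
    using ac_onD(2)[OF F x] unfolding set_lebesgue_integral_def e by (simp only: Bochner_Integration.integral_cnj complex_cnj_add)
qed

text \<open>Fubini's theorem on the square \<open>[0,x]\<^sup>2\<close>, cut along its diagonal.\<close>

lemma integral_primitive_mult:
  fixes f g :: "real \<Rightarrow> complex"
  assumes f: "set_integrable lborel {0..x} f" and g: "set_integrable lborel {0..x} g" and x: "0 \<le> x"
  shows "(LINT t:{0..x}|lborel. f t * (LINT s:{0..t}|lborel. g s))
       + (LINT s:{0..x}|lborel. (LINT t:{0..s}|lborel. f t) * g s)
       = (LINT t:{0..x}|lborel. f t) * (LINT s:{0..x}|lborel. g s)"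
proof -
  define u where "u t = indicator {0..x} t *\<^sub>R f t" for t
  define v where "v s = indicator {0..x} s *\<^sub>R g s" for s
  have iu: "integrable lborel u" and iv: "integrable lborel v"
    using f g by (simp_all add: u_def[abs_def] v_def[abs_def] set_integrable_def)
  have [measurable]: "u \<in> borel_measurable borel" "v \<in> borel_measurable borel"
    using borel_measurable_integrable[OF iu] borel_measurable_integrable[OF iv] by simp_all
  let ?W = "\<lambda>t s. u t * v s"
  let ?W1 = "\<lambda>t s. if s \<le> t then u t * v s else 0"
  let ?W2 = "\<lambda>t s. if s \<le> t then 0 else u t * v s"
  have iW: "integrable (lborel \<Otimes>\<^sub>M lborel) (case_prod ?W)"
  proof (rule lborel_pair.Fubini_integrable)
    show "integrable lborel (\<lambda>t. LINT s|lborel. norm (case_prod ?W (t, s)))"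
      using iu iv by (simp add: norm_mult)
    show "AE t in lborel. integrable lborel (\<lambda>s. case_prod ?W (t, s))" using iv by simp
  qed measurable
  have iW1: "integrable (lborel \<Otimes>\<^sub>M lborel) (case_prod ?W1)"
    by (rule Bochner_Integration.integrable_bound[OF iW]) (measurable, auto)
  have iW2: "integrable (lborel \<Otimes>\<^sub>M lborel) (case_prod ?W2)"
    by (rule Bochner_Integration.integrable_bound[OF iW]) (measurable, auto)
  have "(LINT t|lborel. LINT s|lborel. ?W t s) = (LINT t|lborel. u t) * (LINT s|lborel. v s)" by simp
  then have W: "integral\<^sup>L (lborel \<Otimes>\<^sub>M lborel) (case_prod ?W) = (LINT t|lborel. u t) * (LINT s|lborel. v s)"
    using lborel_pair.integral_fst[OF iW] by simp
  have "(LINT s|lborel. ?W1 t s) = indicator {0..x} t *\<^sub>R (f t * (LINT s:{0..t}|lborel. g s))" for t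
  proof (cases "t \<in> {0..x}")
    case True
    then have "?W1 t s = f t * (indicator {0..t} s *\<^sub>R g s)" for s
      by (auto simp: u_def v_def indicator_def)
    then have "(LINT s|lborel. ?W1 t s) = (LINT s|lborel. f t * (indicator {0..t} s *\<^sub>R g s))" by (simp only:)
    also have "\<dots> = f t * (LINT s:{0..t}|lborel. g s)"
      unfolding set_lebesgue_integral_def by (rule integral_mult_right_zero)
    finally show ?thesis using True by simp
  qed (auto simp: u_def indicator_def cong: if_cong)
  then have W1: "integral\<^sup>L (lborel \<Otimes>\<^sub>M lborel) (case_prod ?W1)
      = (LINT t:{0..x}|lborel. f t * (LINT s:{0..t}|lborel. g s))"
    using lborel_pair.integral_fst[OF iW1] by (simp add: set_lebesgue_integral_def)
  have "(LINT t|lborel. ?W2 t s) = indicator {0..x} s *\<^sub>R ((LINT t:{0..s}|lborel. f t) * g s)" for s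
  proof (cases "s \<in> {0..x}")
    case True
    \<comment> \<open>The diagonal was given to \<open>?W1\<close>, so this section lacks the point
      t = s and agrees with the integrand on [0,s] only almost everywhere.\<close>
    have "(LINT t|lborel. ?W2 t s) = (LINT t|lborel. (indicator {0..s} t *\<^sub>R f t) * g s)"
    proof (rule integral_cong_AE)
      have "set_integrable lborel {0..s} f" using set_integrable_subinterval[OF f True] .
      then have [measurable]: "(\<lambda>t. indicator {0..s} t *\<^sub>R f t) \<in> borel_measurable borel"
        using borel_measurable_integrable by (fastforce simp: set_integrable_def)
      show "(\<lambda>t. (indicator {0..s} t *\<^sub>R f t) * g s) \<in> borel_measurable lborel" by measurable
      show "AE t in lborel. ?W2 t s = (indicator {0..s} t *\<^sub>R f t) * g s"
        using AE_lborel_singleton[of s]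
        by eventually_elim (use True in \<open>auto simp: u_def v_def indicator_def\<close>)
    qed measurable
    also have "\<dots> = (LINT t:{0..s}|lborel. f t) * g s"
      unfolding set_lebesgue_integral_def by (rule integral_mult_left_zero)
    finally show ?thesis using True by simp
  qed (auto simp: v_def indicator_def cong: if_cong)
  then have W2: "integral\<^sup>L (lborel \<Otimes>\<^sub>M lborel) (case_prod ?W2)
      = (LINT s:{0..x}|lborel. (LINT t:{0..s}|lborel. f t) * g s)"
    using lborel_pair.integral_snd[OF iW2] by (simp add: set_lebesgue_integral_def)
  have "integral\<^sup>L (lborel \<Otimes>\<^sub>M lborel) (case_prod ?W1) + integral\<^sup>L (lborel \<Otimes>\<^sub>M lborel) (case_prod ?W2)
      = integral\<^sup>L (lborel \<Otimes>\<^sub>M lborel) (case_prod ?W)"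
    unfolding Bochner_Integration.integral_add[OF iW1 iW2, symmetric]
    by (rule Bochner_Integration.integral_cong) auto
  then show ?thesis
    unfolding W W1 W2 by (simp only: set_lebesgue_integral_def u_def[abs_def] v_def[abs_def])
qed

lemma set_integrable_mult_continuous:
  fixes f G :: "real \<Rightarrow> complex"
  assumes f: "set_integrable lborel {0..b} f" and G: "continuous_on {0..b} G"
  shows "set_integrable lborel {0..b} (\<lambda>x. f x * G x)"
proof -
  obtain K where "\<forall>y\<in>G ` {0..b}. norm y \<le> K"
    using compact_imp_bounded[OF compact_continuous_image[OF G compact_Icc]] unfolding bounded_iff by blast
  then have K: "norm (G x) \<le> K" if "x \<in> {0..b}" for x using that by blast
  have [measurable]: "(\<lambda>x. indicator {0..b} x *\<^sub>R f x) \<in> borel_measurable borel"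
    "(\<lambda>x. indicator {0..b} x *\<^sub>R G x) \<in> borel_measurable borel"
    using f borel_integrable_atLeastAtMost'[OF G] borel_measurable_integrable
    by (fastforce simp: set_integrable_def)+
  have "integrable lborel (\<lambda>x. (indicator {0..b} x *\<^sub>R f x) * (indicator {0..b} x *\<^sub>R G x))"
  proof (rule Bochner_Integration.integrable_bound)
    show "integrable lborel (\<lambda>x. K *\<^sub>R (indicator {0..b} x *\<^sub>R f x))"
      using f unfolding set_integrable_def by (rule integrable_scaleR_right)
    show "AE x in lborel. norm ((indicator {0..b} x *\<^sub>R f x) * (indicator {0..b} x *\<^sub>R G x))
        \<le> norm (K *\<^sub>R (indicator {0..b} x *\<^sub>R f x))"
    proof (rule AE_I2)
      fix x
      have "norm (G x) \<le> \<bar>K\<bar>" if "x \<in> {0..b}" using K[OF that] by simp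
      then show "norm ((indicator {0..b} x *\<^sub>R f x) * (indicator {0..b} x *\<^sub>R G x))
        \<le> norm (K *\<^sub>R (indicator {0..b} x *\<^sub>R f x))"
        by (auto simp: indicator_def norm_mult mult.commute[of "norm (f x)"] intro: mult_right_mono)
    qed
  qed measurable
  also have "(\<lambda>x. (indicator {0..b} x *\<^sub>R f x) * (indicator {0..b} x *\<^sub>R G x))
      = (\<lambda>x. indicator {0..b} x *\<^sub>R (f x * G x))"
    by (auto simp: indicator_def)
  finally show ?thesis by (simp add: set_integrable_def)
qed

lemma set_integral_interval_cong:
  fixes f g :: "real \<Rightarrow> complex"
  assumes "\<And>t. t \<in> {0..x} \<Longrightarrow> f t = g t"
  shows "(LINT t:{0..x}|lborel. f t) = (LINT t:{0..x}|lborel. g t)"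
proof -
  have "indicator {0..x} t *\<^sub>R f t = indicator {0..x} t *\<^sub>R g t" for t
    using assms[of t] by (cases "t \<in> {0..x}") auto
  then show ?thesis by (simp only: set_lebesgue_integral_def)
qed

text \<open>Integration by parts with neither factor C1. Splitting off the initial values leaves two
  primitives vanishing at 0, and for these the product formula is Fubini's theorem on a
  square.\<close>

lemma ac_on_mult:
  assumes F: "ac_on b F f" and G: "ac_on b G g"
  shows "ac_on b (\<lambda>x. F x * G x) (\<lambda>x. f x * G x + F x * g x)"
  unfolding ac_on_def
proof (intro conjI ballI)
  have i1: "set_integrable lborel {0..b} (\<lambda>x. f x * G x)"
    by (rule set_integrable_mult_continuous[OF ac_onD(1)[OF F] ac_on_continuous[OF G]])
  have "set_integrable lborel {0..b} (\<lambda>x. g x * F x)"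
    by (rule set_integrable_mult_continuous[OF ac_onD(1)[OF G] ac_on_continuous[OF F]])
  then have i2: "set_integrable lborel {0..b} (\<lambda>x. F x * g x)" by (simp only: mult.commute)
  show "set_integrable lborel {0..b} (\<lambda>x. f x * G x + F x * g x)"
    using i1 i2 by (rule set_integral_add)
  fix x assume x: "x \<in> {0..b}"
  note fx = set_integrable_subinterval[OF ac_onD(1)[OF F] x]
  note gx = set_integrable_subinterval[OF ac_onD(1)[OF G] x]
  define \<Phi> where "\<Phi> t = (LINT s:{0..t}|lborel. f s)" for t
  define \<Gamma> where "\<Gamma> t = (LINT s:{0..t}|lborel. g s)" for t
  have FG: "F t = F 0 + \<Phi> t" "G t = G 0 + \<Gamma> t" if "t \<in> {0..x}" for t
    using ac_onD(2)[OF F, of t] ac_onD(2)[OF G, of t] that x by (auto simp: \<Phi>_def \<Gamma>_def)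
  have c\<Gamma>: "continuous_on {0..x} (\<lambda>t. G t - G 0)" and c\<Phi>: "continuous_on {0..x} (\<lambda>t. F t - F 0)"
    using ac_on_continuous[OF G] ac_on_continuous[OF F] x
    by (auto intro!: continuous_intros elim: continuous_on_subset)
  have j1: "set_integrable lborel {0..x} (\<lambda>t. f t * (G t - G 0))"
    by (rule set_integrable_mult_continuous[OF fx c\<Gamma>])
  have j2: "set_integrable lborel {0..x} (\<lambda>t. (F t - F 0) * g t)"
    using set_integrable_mult_continuous[OF gx c\<Phi>] by (simp only: mult.commute)
  have xx: "0 \<le> x" "x \<in> {0..x}" using x by auto
  have "(LINT t:{0..x}|lborel. f t * G t + F t * g t)
      = (LINT t:{0..x}|lborel. (f t * (G t - G 0) + (F t - F 0) * g t) + (f t * G 0 + F 0 * g t))"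
    by (intro arg_cong[of _ _ "set_lebesgue_integral lborel {0..x}"] ext) (simp add: algebra_simps)
  also have "\<dots> = (LINT t:{0..x}|lborel. f t * (G t - G 0)) + (LINT t:{0..x}|lborel. (F t - F 0) * g t)
      + ((LINT t:{0..x}|lborel. f t) * G 0 + F 0 * (LINT t:{0..x}|lborel. g t))"
  proof -
    have k1: "set_integrable lborel {0..x} (\<lambda>t. f t * G 0)" and k2: "set_integrable lborel {0..x} (\<lambda>t. F 0 * g t)"
      using fx gx by simp_all
    show ?thesis
      unfolding set_integral_add(2)[OF set_integral_add(1)[OF j1 j2] set_integral_add(1)[OF k1 k2]]
        set_integral_add(2)[OF j1 j2] set_integral_add(2)[OF k1 k2]
      by (simp only: set_integral_mult_left set_integral_mult_right)
  qed
  finally have sum: "(LINT t:{0..x}|lborel. f t * G t + F t * g t)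
      = (LINT t:{0..x}|lborel. f t * (G t - G 0)) + (LINT t:{0..x}|lborel. (F t - F 0) * g t)
      + (\<Phi> x * G 0 + F 0 * \<Gamma> x)" by (simp only: \<Phi>_def \<Gamma>_def)
  have FG': "F t - F 0 = \<Phi> t" "G t - G 0 = \<Gamma> t" if "t \<in> {0..x}" for t
    unfolding FG[OF that] by (simp_all only: add_diff_cancel_left')
  have s1: "(LINT t:{0..x}|lborel. f t * (G t - G 0)) = (LINT t:{0..x}|lborel. f t * \<Gamma> t)"
    by (rule set_integral_interval_cong) (simp only: FG'(2))
  have s2: "(LINT t:{0..x}|lborel. (F t - F 0) * g t) = (LINT t:{0..x}|lborel. \<Phi> t * g t)"
    by (rule set_integral_interval_cong) (simp only: FG'(1))
  have "(LINT t:{0..x}|lborel. f t * \<Gamma> t) + (LINT t:{0..x}|lborel. \<Phi> t * g t) = \<Phi> x * \<Gamma> x"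
    unfolding \<Phi>_def \<Gamma>_def by (rule integral_primitive_mult[OF fx gx xx(1)])
  then have e: "(LINT t:{0..x}|lborel. f t * G t + F t * g t)
      = \<Phi> x * \<Gamma> x + (\<Phi> x * G 0 + F 0 * \<Gamma> x)"
    unfolding sum s1 s2 by (simp only:)
  show "F x * G x = F 0 * G 0 + (LINT t:{0..x}|lborel. f t * G t + F t * g t)"
    unfolding e FG(1)[OF xx(2)] FG(2)[OF xx(2)] by algebra
qed

text \<open>The inclusion of L2 in L1 on a bounded interval, read off from pairing f with the square
  integrable indicator function.\<close>

lemma sq_integrable_imp_set_integrable:
  assumes "sq_integrable f" shows "set_integrable lborel {x..y} f"
proof -
  have "sq_integrable (\<lambda>t. indicator {x..y} t)"
    unfolding sq_integrable_def
  proof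
    have e: "(cmod (indicator {x..y} t))\<^sup>2 = indicat_real {x..y} t" for t :: real
      by (simp add: indicator_def)
    show "integrable lborel (\<lambda>t. (cmod (indicator {x..y} t))\<^sup>2)"
      unfolding e by (intro integrable_real_indicator) (auto simp: emeasure_lborel_Icc_eq)
  qed measurable
  from integrable_mult_cnj[OF assms this]
  have "integrable lborel (\<lambda>t. f t * cnj (indicator {x..y} t))" .
  also have "(\<lambda>t. f t * cnj (indicator {x..y} t)) = (\<lambda>t. indicator {x..y} t *\<^sub>R f t)"
    by (auto simp: indicator_def)
  finally show ?thesis by (simp add: set_integrable_def)
qed

text \<open>Mean zero is what makes the primitive vanish again to the right of the support. The
  margins -1 and b + 1 put the support into the interior of the interval of integration, so that the
  derivative there is two-sided.\<close>

lemma test_function_primitive: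
  fixes \<psi> :: "real \<Rightarrow> complex"
  assumes cont: "continuous_on UNIV \<psi>" and supp: "\<And>x. x \<notin> {s..t} \<Longrightarrow> \<psi> x = 0" "0 < s" "t < b"
    and mean: "integral {-1..b + 1} \<psi> = 0"
  shows "test_function b (\<lambda>x. integral {-1..x} \<psi>) \<psi>"
proof -
  have int: "\<psi> integrable_on {x..y}" for x y
    by (intro integrable_continuous_interval continuous_on_subset[OF cont]) auto
  have zero: "integral {x..y} \<psi> = 0" if "y < s \<or> x > t" for x y
  proof -
    have "integral {x..y} \<psi> = integral {x..y} (\<lambda>_. 0)"
      by (rule Henstock_Kurzweil_Integration.integral_cong) (use that supp in auto)
    then show ?thesis by simp
  qed
  have out: "integral {-1..x} \<psi> = 0" if x: "x \<notin> {s..t}" for x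
  proof (cases "x < s")
    case False
    then have xt: "x > t" "x \<ge> s" using x by auto
    show ?thesis
    proof (cases "x \<le> b + 1")
      case True
      have "integral {-1..x} \<psi> + integral {x..b + 1} \<psi> = integral {-1..b + 1} \<psi>"
        by (rule Henstock_Kurzweil_Integration.integral_combine) (use xt supp True int in auto)
      then show ?thesis using zero[of "b + 1" x] xt mean by simp
    next
      case F: False
      show ?thesis
      \<comment> \<open>The sign of b is open here; if the interval is empty, so is the support of
        \<psi>.\<close>
      proof (cases "b + 1 \<ge> -1")
        case True
        have "integral {-1..b + 1} \<psi> + integral {b + 1..x} \<psi> = integral {-1..x} \<psi>"
          by (rule Henstock_Kurzweil_Integration.integral_combine) (use F True int in auto)
        then show ?thesis using zero[of x "b + 1"] supp mean by simp
      qed (use zero[of x "-1"] supp in auto)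
    qed
  qed (simp add: zero)
  have der: "((\<lambda>x. integral {-1..x} \<psi>) has_vector_derivative \<psi> x) (at x)" for x
  proof (cases "x \<in> {s..t}")
    case True
    have d: "((\<lambda>u. integral {-1..u} \<psi>) has_vector_derivative \<psi> x) (at x within {-1..b + 1})"
      by (rule integral_has_vector_derivative) (use True supp in \<open>auto intro: continuous_on_subset[OF cont]\<close>)
    have "x \<in> interior {-1..b + 1}" using True supp by (simp add: interior_atLeastAtMost_real)
    from d[unfolded at_within_interior[OF this]] show ?thesis .
  next
    case False
    have "((\<lambda>x. 0) has_vector_derivative \<psi> x) (at x)"
      using supp(1)[OF False] by (simp add: has_vector_derivative_const)
    then show ?thesis
    proof (rule has_vector_derivative_transform_within_open)
      show "open (- {s..t})" by (simp add: open_Compl)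
      show "x \<in> - {s..t}" using False by simp
    qed (simp add: out)
  qed
  show ?thesis
    unfolding test_function_def using der cont out supp by blast
qed

text \<open>A continuous approximation of the indicator of \<open>(0,y)\<close> with compact support in \<open>(0,y)\<close>.\<close>

definition trapezoid :: "nat \<Rightarrow> real \<Rightarrow> real \<Rightarrow> real"
  where "trapezoid n y x = max 0 (min 1 (min (real n * x - 1) (real n * (y - x) - 1)))"

lemma trapezoid_bounds: "0 \<le> trapezoid n y x" "trapezoid n y x \<le> 1"
  by (auto simp: trapezoid_def)

lemma continuous_trapezoid: "continuous_on S (trapezoid n y)"
  unfolding trapezoid_def[abs_def] by (intro continuous_intros)

text \<open>The offset -1 in both ramps clears a margin 1 / n at either end, which makes the support
  compact in (0,y).\<close>

lemma trapezoid_support: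
  assumes "n > 0" "x \<notin> {1 / real n..y - 1 / real n}" shows "trapezoid n y x = 0"
proof -
  have "real n * x < 1 \<or> real n * (y - x) < 1"
    using assms by (auto simp: field_simps)
  then show ?thesis by (auto simp: trapezoid_def)
qed

lemma trapezoid_tendsto: "(\<lambda>n. trapezoid n y x) \<longlonglongrightarrow> indicator {0<..<y} x"
proof (cases "x \<in> {0<..<y}")
  case True
  define m where "m = min x (y - x)"
  have m: "m > 0" "m \<le> x" "m \<le> y - x" using True by (auto simp: m_def)
  have ev: "\<forall>\<^sub>F n in sequentially. real n > 2 / m"
    using filterlim_real_sequentially by (simp add: filterlim_at_top_dense)
  have "\<forall>\<^sub>F n in sequentially. trapezoid n y x = 1"
    using ev
  proof eventually_elim
    case (elim n)
    then have "real n * m > 2" using m by (simp add: divide_less_eq)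
    moreover have "real n * m \<le> real n * x" "real n * m \<le> real n * (y - x)"
      using m by (auto intro: mult_left_mono)
    ultimately show ?case by (simp add: trapezoid_def)
  qed
  then show ?thesis using True by (simp add: tendsto_eventually)
next
  case False
  have "trapezoid n y x = 0" for n
  proof -
    have "x \<le> 0 \<or> y - x \<le> 0" using False by auto
    then have "real n * x \<le> 0 \<or> real n * (y - x) \<le> 0" by (auto intro: mult_nonneg_nonpos)
    then show ?thesis by (auto simp: trapezoid_def)
  qed
  then show ?thesis using False by simp
qed

lemma integral_trapezoid_tendsto:
  fixes h :: "real \<Rightarrow> complex"
  assumes h: "integrable lborel h"
  shows "(\<lambda>n. LINT x|lborel. h x * of_real (trapezoid n y x)) \<longlonglongrightarrow> (LINT x:{0<..<y}|lborel. h x)"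
  unfolding set_lebesgue_integral_def
proof (rule integral_dominated_convergence[where w = "\<lambda>x. norm (h x)"])
  have [measurable]: "trapezoid n y \<in> borel_measurable borel" for n
    by (intro borel_measurable_continuous_onI continuous_trapezoid)
  have [measurable]: "h \<in> borel_measurable borel" using borel_measurable_integrable[OF h] by simp
  show "(\<lambda>x. h x * of_real (trapezoid n y x)) \<in> borel_measurable lborel" for n by measurable
  show "(\<lambda>x. indicator {0<..<y} x *\<^sub>R h x) \<in> borel_measurable lborel" by measurable
  show "AE x in lborel. norm (h x * of_real (trapezoid n y x)) \<le> norm (h x)" for n
    using trapezoid_bounds[of n y] by (auto simp: norm_mult intro!: mult_left_le)
  show "AE x in lborel. (\<lambda>n. h x * of_real (trapezoid n y x)) \<longlonglongrightarrow> indicator {0<..<y} x *\<^sub>R h x"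
  proof (rule AE_I2)
    fix x
    have "(\<lambda>n. h x * of_real (trapezoid n y x)) \<longlonglongrightarrow> h x * of_real (indicator {0<..<y} x)"
      by (intro tendsto_mult tendsto_const tendsto_of_real trapezoid_tendsto)
    then show "(\<lambda>n. h x * of_real (trapezoid n y x)) \<longlonglongrightarrow> indicator {0<..<y} x *\<^sub>R h x"
      by (simp add: scaleR_conv_of_real mult.commute)
  qed
qed (use h in simp)

text \<open>A combination of two trapezoids with mean zero is the derivative of a test function.
  Comparing the trapezoids on (0,y) with one fixed trapezoid on (0,b) shows that f and a constant c
  have the same integrals against all of them; letting n grow gives equal integrals over every
  (0,y).\<close>

lemma du_bois_reymond:
  fixes f :: "real \<Rightarrow> complex"
  assumes b: "b > 0" and f: "set_integrable lborel {0<..<b} f"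
    and test: "\<And>\<phi> \<phi>'. test_function b \<phi> \<phi>' \<Longrightarrow> (LINT x:{0<..<b}|lborel. f x * \<phi>' x) = 0"
  shows "\<exists>c. AE x in lborel. x \<in> {0<..<b} \<longrightarrow> f x = c"
proof -
  define g where "g x = indicator {0<..<b} x *\<^sub>R f x" for x
  have g: "integrable lborel g" using f by (simp add: set_integrable_def g_def[abs_def])
  define \<tau> where "\<tau> n y x = complex_of_real (trapezoid n y x)" for n y x
  have cont\<tau>: "continuous_on S (\<tau> n y)" for S n y
    unfolding \<tau>_def[abs_def] by (intro continuous_intros continuous_trapezoid)
  have supp\<tau>: "\<tau> n y x = 0" if "n > 0" "x \<notin> {1 / real n..y - 1 / real n}" for n y x
    using trapezoid_support[OF that] by (simp add: \<tau>_def)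
  define k where "k n y = integral {-1..b + 1} (\<tau> n y)" for n y
  have k: "k n y = (LINT x:{0<..<b}|lborel. \<tau> n y x)" if n: "n > 0" and y: "y \<le> b" for n y
  proof -
    have "k n y = (LINT x:{-1..b + 1}|lborel. \<tau> n y x)"
      unfolding k_def
      by (rule set_borel_integral_eq_integral(2)[symmetric]) (rule borel_integrable_atLeastAtMost'[OF cont\<tau>])
    also have "\<dots> = (LINT x:{0<..<b}|lborel. \<tau> n y x)"
      unfolding set_lebesgue_integral_def
    proof (rule Bochner_Integration.integral_cong)
      fix x
      have "\<tau> n y x = 0" if "x \<notin> {0<..<b}"
      proof (rule supp\<tau>[OF n])
        have "1 / real n > 0" using n by simp
        then show "x \<notin> {1 / real n..y - 1 / real n}" using that y by (auto simp del: zero_less_divide_1_iff)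
      qed
      then show "indicator {-1..b + 1} x *\<^sub>R \<tau> n y x = indicator {0<..<b} x *\<^sub>R \<tau> n y x"
        by (auto simp: indicator_def)
    qed simp
    finally show ?thesis .
  qed
  have i1: "integrable lborel (\<lambda>x. indicator {0<..<b} x :: complex)"
  proof -
    have "set_integrable lborel {0<..<b} (\<lambda>x. 1 :: complex)"
      by (rule set_integrable_subset[OF borel_integrable_atLeastAtMost'[of 0 b]]) auto
    then have "integrable lborel (\<lambda>x. indicator {0<..<b} x *\<^sub>R (1 :: complex))"
      by (simp only: set_integrable_def)
    also have "(\<lambda>x. indicator {0<..<b} x *\<^sub>R (1 :: complex)) = (\<lambda>x. indicator {0<..<b} x)"
      by (auto simp: indicator_def)
    finally show ?thesis .
  qed
  have k_lim: "(\<lambda>n. k n b) \<longlonglongrightarrow> complex_of_real b"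
  proof (rule Lim_transform_eventually)
    have "(LINT x:{0<..<b}|lborel. (indicator {0<..<b} x :: complex)) = of_real b"
    proof -
      have "(LINT x:{0<..<b}|lborel. (indicator {0<..<b} x :: complex)) = (LINT x:{0<..<b}|lborel. 1)"
        unfolding set_lebesgue_integral_def by (rule Bochner_Integration.integral_cong) (auto simp: indicator_def)
      also have "\<dots> = of_real b"
        using b by (simp add: set_lebesgue_integral_def scaleR_conv_of_real)
      finally show ?thesis .
    qed
    with integral_trapezoid_tendsto[OF i1, of b]
    show "(\<lambda>n. LINT x|lborel. indicator {0<..<b} x * complex_of_real (trapezoid n b x)) \<longlonglongrightarrow> complex_of_real b" by simp
    show "\<forall>\<^sub>F n in sequentially. (LINT x|lborel. indicator {0<..<b} x * complex_of_real (trapezoid n b x)) = k n b"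
      using eventually_gt_at_top[of 0]
    proof eventually_elim
      case (elim n)
      show ?case
        unfolding k[OF elim order_refl] set_lebesgue_integral_def \<tau>_def
        by (rule Bochner_Integration.integral_cong) (auto simp: indicator_def)
    qed
  qed
  have "\<forall>\<^sub>F n in sequentially. k n b \<noteq> 0"
    using tendsto_imp_eventually_ne[OF k_lim, of 0] b by simp
  then have "\<forall>\<^sub>F n in sequentially. k n b \<noteq> 0 \<and> n > 0"
    using eventually_gt_at_top[of 0] by (rule eventually_conj)
  then obtain N where N: "k N b \<noteq> 0" "N > 0" by (auto simp: eventually_sequentially)
  \<comment> \<open>The mean of f against the reference trapezoid, whose own integral is nonzero for
    a suitable N because these integrals tend to b > 0.\<close>
  define c where "c = (LINT x|lborel. g x * \<tau> N b x) / k N b"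
  have int_g\<tau>: "integrable lborel (\<lambda>x. g x * \<tau> n y x)" for n y
  proof (rule Bochner_Integration.integrable_bound[OF g])
    have [measurable]: "\<tau> n y \<in> borel_measurable borel"
      by (intro borel_measurable_continuous_onI cont\<tau>)
    have [measurable]: "g \<in> borel_measurable borel" using borel_measurable_integrable[OF g] by simp
    show "(\<lambda>x. g x * \<tau> n y x) \<in> borel_measurable lborel" by measurable
    show "AE x in lborel. norm (g x * \<tau> n y x) \<le> norm (g x)"
      using trapezoid_bounds[of n y] by (auto simp: norm_mult \<tau>_def intro!: mult_left_le)
  qed
  have key: "(LINT x|lborel. g x * \<tau> n y x) = c * k n y" if n: "n > 0" and y: "y \<le> b" for n y
  proof -
    \<comment> \<open>Chosen so that \<psi> has mean zero.\<close>
    define q where "q = k n y / k N b"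
    define \<psi> where "\<psi> x = \<tau> n y x - q * \<tau> N b x" for x
    define d where "d = min (1 / real n) (1 / real N)"
    have d: "d > 0" using n N by (simp add: d_def)
    have "test_function b (\<lambda>x. integral {-1..x} \<psi>) \<psi>"
    proof (rule test_function_primitive)
      show "continuous_on UNIV \<psi>" unfolding \<psi>_def[abs_def] by (intro continuous_intros cont\<tau>)
      show "\<psi> x = 0" if "x \<notin> {d..b - d}" for x
      proof -
        have "x \<notin> {1 / real n..y - 1 / real n}" "x \<notin> {1 / real N..b - 1 / real N}"
          using that y by (auto simp: d_def)
        then show ?thesis using supp\<tau>[OF n] supp\<tau>[OF N(2)] by (simp add: \<psi>_def)
      qed
      have int: "\<tau> n y integrable_on {-1..b + 1}" for n y
        by (intro integrable_continuous_interval cont\<tau>)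
      have "integral {-1..b + 1} \<psi> = k n y - q * k N b"
        unfolding \<psi>_def[abs_def] k_def
        by (subst Henstock_Kurzweil_Integration.integral_diff)
          (use int in \<open>auto intro!: integrable_continuous_interval continuous_intros cont\<tau>\<close>)
      then show "integral {-1..b + 1} \<psi> = 0" using N by (simp add: q_def)
    qed (use d in auto)
    from test[OF this] have "(LINT x|lborel. g x * \<tau> n y x - q * (g x * \<tau> N b x)) = 0"
      by (simp add: set_lebesgue_integral_def g_def \<psi>_def algebra_simps)
    then have "(LINT x|lborel. g x * \<tau> n y x) = q * (LINT x|lborel. g x * \<tau> N b x)"
      by (subst (asm) Bochner_Integration.integral_diff) (use int_g\<tau> in auto)
    then show ?thesis by (simp add: q_def c_def)
  qed
  define h where "h x = g x - c * indicator {0<..<b} x" for x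
  have h: "integrable lborel h"
    unfolding h_def by (intro Bochner_Integration.integrable_diff g integrable_mult_right i1)
  have h0: "(LINT x|lborel. h x * of_real (trapezoid n y x)) = 0" if n: "n > 0" and y: "y \<le> b" for n y
  proof -
    have e: "h x * of_real (trapezoid n y x) = g x * \<tau> n y x - c * (indicator {0<..<b} x *\<^sub>R \<tau> n y x)" for x
      by (simp add: h_def \<tau>_def left_diff_distrib indicator_def)
    have "set_integrable lborel {0<..<b} (\<tau> n y)"
      by (rule set_integrable_subset[OF borel_integrable_atLeastAtMost'[OF cont\<tau>, of 0 b]]) auto
    then have i: "integrable lborel (\<lambda>x. indicator {0<..<b} x *\<^sub>R \<tau> n y x)"
      by (simp add: set_integrable_def)
    have "(LINT x|lborel. h x * of_real (trapezoid n y x))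
        = (LINT x|lborel. g x * \<tau> n y x) - c * (LINT x:{0<..<b}|lborel. \<tau> n y x)"
      unfolding e set_lebesgue_integral_def
      by (subst Bochner_Integration.integral_diff[OF int_g\<tau> integrable_mult_right[OF i]])
        (simp only: integral_mult_right_zero)
    then show ?thesis using key[OF that] k[OF that] by simp
  qed
  have hy: "(LINT x:{0<..<y}|lborel. h x) = 0" if "y \<le> b" for y
  proof (rule LIMSEQ_unique[OF integral_trapezoid_tendsto[OF h]])
    show "(\<lambda>n. LINT x|lborel. h x * of_real (trapezoid n y x)) \<longlonglongrightarrow> 0"
      by (rule tendsto_eventually) (use eventually_gt_at_top[of 0] in eventually_elim, simp add: h0 that)
  qed
  have "AE x in lborel. h x = 0"
  proof (rule AE_zero_if_integrals_atMost_zero[OF h])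
    fix y
    have [measurable]: "h \<in> borel_measurable borel" using borel_measurable_integrable[OF h] by simp
    have "(LINT x:{..y}|lborel. h x) = (LINT x:{0<..<min y b}|lborel. h x)"
      unfolding set_lebesgue_integral_def
    proof (rule integral_cong_AE)
      show "AE x in lborel. indicator {..y} x *\<^sub>R h x = indicator {0<..<min y b} x *\<^sub>R h x"
        using AE_lborel_singleton[of y]
        by eventually_elim (auto simp: indicator_def h_def g_def)
    qed measurable
    then show "(LINT x:{..y}|lborel. h x) = 0" using hy[of "min y b"] by simp
  qed
  then have "AE x in lborel. x \<in> {0<..<b} \<longrightarrow> f x = c"
    by eventually_elim (auto simp: h_def g_def)
  then show ?thesis ..
qed

section \<open>Weak derivatives and traces on an interval\<close>

text \<open>The nonnegative continuous function \<open>norm (F x - G x)\<close> has integral 0 and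
  so vanishes, at the end points too. For this reason boundary traces are well defined.\<close>

lemma continuous_AE_eq:
  fixes F G :: "real \<Rightarrow> complex"
  assumes b: "b > 0" and F: "continuous_on {0..b} F" and G: "continuous_on {0..b} G"
    and ae: "AE x in lborel. x \<in> {0<..<b} \<longrightarrow> F x = G x" and x: "x \<in> {0..b}"
  shows "F x = G x"
proof -
  have c: "continuous_on {0..b} (\<lambda>x. norm (F x - G x))" by (intro continuous_intros F G)
  have "(LINT x:{0..b}|lborel. norm (F x - G x)) = 0"
    unfolding set_lebesgue_integral_def
  proof (rule integral_eq_zero_AE)
    show "AE x in lborel. indicator {0..b} x *\<^sub>R norm (F x - G x) = 0"
      using ae AE_lborel_singleton[of "0::real"] AE_lborel_singleton[of b]
      by eventually_elim (auto simp: indicator_def)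
  qed
  then have "integral {0..b} (\<lambda>x. norm (F x - G x)) = 0"
    using set_borel_integral_eq_integral(2)[OF borel_integrable_atLeastAtMost'[OF c]] by simp
  then have "\<forall>x\<in>{0..b}. norm (F x - G x) = 0"
    using integral_eq_0_iff[OF c b] by simp
  then show ?thesis using x by simp
qed

text \<open>\<open>u \<in> H\<^sup>1(0,b)\<close> has weak derivative \<open>v\<close> and continuous representative \<open>F\<close>.\<close>

definition h1_rep :: "real \<Rightarrow> l2 \<Rightarrow> l2 \<Rightarrow> (real \<Rightarrow> complex) \<Rightarrow> bool"
  where "h1_rep b u v F \<longleftrightarrow> u \<in> L2_interval b \<and> v \<in> L2_interval b \<and> ac_on b F (rep_l2 v) \<and>
    (AE x in lborel. x \<in> {0<..<b} \<longrightarrow> rep_l2 u x = F x)"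

lemma h1_repD:
  assumes "h1_rep b u v F"
  shows "u \<in> L2_interval b" "v \<in> L2_interval b" "ac_on b F (rep_l2 v)"
    "AE x in lborel. x \<in> {0<..<b} \<longrightarrow> rep_l2 u x = F x" "continuous_on {0..b} F"
  using assms ac_on_continuous by (auto simp: h1_rep_def)

lemma AE_zero_if_primitive_zero:
  fixes b :: real
  assumes f: "set_integrable lborel {0..b} f" and z: "\<And>x. x \<in> {0..b} \<Longrightarrow> (LINT t:{0..x}|lborel. f t) = (0::complex)"
  shows "AE x in lborel. x \<in> {0..b} \<longrightarrow> f x = 0"
proof -
  let ?h = "\<lambda>x. indicator {0..b} x *\<^sub>R f x"
  have "AE x in lborel. ?h x = 0"
  proof (rule AE_zero_if_integrals_atMost_zero[where h = ?h])
    show "integrable lborel ?h" using f by (simp add: set_integrable_def)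
    fix y
    have "indicator {..y} x *\<^sub>R ?h x = indicator {0..min y b} x *\<^sub>R f x" for x
      by (auto simp: indicator_def)
    then have "(LINT x:{..y}|lborel. ?h x) = (LINT t:{0..min y b}|lborel. f t)"
      by (simp only: set_lebesgue_integral_def)
    also have "\<dots> = 0"
    proof (cases "min y b \<ge> 0")
      case True
      then show ?thesis by (intro z) auto
    next
      case False
      then have "{0..min y b} = {}" by auto
      then show ?thesis by (simp only: set_lebesgue_integral_def) simp
    qed
    finally show "(LINT x:{..y}|lborel. ?h x) = 0" .
  qed
  then show ?thesis by eventually_elim (auto simp: indicator_def)
qed

text \<open>Continuity fixes F on [0,b]; the two densities then have the same primitive and agree
  inside, and outside both vanish by membership in \<open>L2_interval b\<close>.\<close>

lemma h1_rep_unique: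
  assumes b: "b > 0" and 1: "h1_rep b u v F" and 2: "h1_rep b u v' F'"
  shows "v = v'" and "x \<in> {0..b} \<Longrightarrow> F x = F' x"
proof -
  have FF: "F x = F' x" if "x \<in> {0..b}" for x
  proof (rule continuous_AE_eq[OF b h1_repD(5)[OF 1] h1_repD(5)[OF 2] _ that])
    show "AE x in lborel. x \<in> {0<..<b} \<longrightarrow> F x = F' x"
      using h1_repD(4)[OF 1] h1_repD(4)[OF 2] by eventually_elim simp
  qed
  then show "x \<in> {0..b} \<Longrightarrow> F x = F' x" .
  have i: "set_integrable lborel {0..b} (rep_l2 v)" "set_integrable lborel {0..b} (rep_l2 v')"
    using ac_onD(1)[OF h1_repD(3)[OF 1]] ac_onD(1)[OF h1_repD(3)[OF 2]] .
  have "AE x in lborel. x \<in> {0..b} \<longrightarrow> rep_l2 v x - rep_l2 v' x = 0"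
  proof (rule AE_zero_if_primitive_zero)
    show "set_integrable lborel {0..b} (\<lambda>x. rep_l2 v x - rep_l2 v' x)"
      using i by (rule set_integral_diff(1))
    fix x assume x: "x \<in> {0..b}"
    have "(LINT t:{0..x}|lborel. rep_l2 v t) = (LINT t:{0..x}|lborel. rep_l2 v' t)"
      using ac_onD(2)[OF h1_repD(3)[OF 1] x] ac_onD(2)[OF h1_repD(3)[OF 2] x] FF[OF x] FF[of 0] b by simp
    then show "(LINT t:{0..x}|lborel. rep_l2 v t - rep_l2 v' t) = 0"
      by (simp add: set_integral_diff(2)[OF set_integrable_subinterval[OF i(1) x] set_integrable_subinterval[OF i(2) x]])
  qed
  then have "AE x in lborel. rep_l2 v x = rep_l2 v' x"
    using h1_repD(2)[OF 1, unfolded L2_interval_iff] h1_repD(2)[OF 2, unfolded L2_interval_iff]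
    by eventually_elim force
  then show "v = v'" by (rule l2_eqI)
qed

lemma set_integral_cong_AE_closed_interval:
  fixes f g :: "real \<Rightarrow> complex"
  assumes "set_integrable lborel {0..b} f" "set_integrable lborel {0..b} g"
    and ae: "AE x in lborel. x \<in> {0<..<b} \<longrightarrow> f x = g x"
  shows "(LINT x:{0..b}|lborel. f x) = (LINT x:{0..b}|lborel. g x)"
  unfolding set_lebesgue_integral_def
proof (rule integral_cong_AE)
  show "AE x in lborel. indicator {0..b} x *\<^sub>R f x = indicator {0..b} x *\<^sub>R g x"
    using ae AE_lborel_singleton[of "0::real"] AE_lborel_singleton[of b]
    by eventually_elim (auto simp: indicator_def)
qed (use assms borel_measurable_integrable in \<open>auto simp: set_integrable_def\<close>)

lemma set_integral_open_eq_closed_interval: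
  fixes f :: "real \<Rightarrow> complex"
  assumes "set_integrable lborel {0..b} f"
  shows "(LINT x:{0<..<b}|lborel. f x) = (LINT x:{0..b}|lborel. f x)"
  unfolding set_lebesgue_integral_def
proof (rule integral_cong_AE)
  have "set_integrable lborel {0<..<b} f" by (rule set_integrable_subset[OF assms]) auto
  then show "(\<lambda>x. indicator {0<..<b} x *\<^sub>R f x) \<in> borel_measurable lborel"
    using borel_measurable_integrable by (auto simp: set_integrable_def)
  show "AE x in lborel. indicator {0<..<b} x *\<^sub>R f x = indicator {0..b} x *\<^sub>R f x"
    using AE_lborel_singleton[of "0::real"] AE_lborel_singleton[of b]
    by eventually_elim (auto simp: indicator_def)
qed (use assms borel_measurable_integrable in \<open>auto simp: set_integrable_def\<close>)

lemma rep_l2_set_integrable: "set_integrable lborel {x..y} (rep_l2 u)"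
  by (rule sq_integrable_imp_set_integrable[OF sq_integrable_rep])

lemma continuous_on_test_function: "test_function b \<phi> \<phi>' \<Longrightarrow> continuous_on S \<phi>"
  by (intro continuous_at_imp_continuous_on ballI has_vector_derivative_continuous)
    (auto simp: test_function_def)

lemma ac_on_test_function:
  assumes \<phi>: "test_function b \<phi> \<phi>'" and b: "b > 0" and F: "ac_on b F f"
  shows "(LINT x:{0..b}|lborel. F x * \<phi>' x) = - (LINT x:{0..b}|lborel. f x * \<phi> x)"
proof -
  have c: "continuous_on {0..b} \<phi>'" using \<phi> by (auto simp: test_function_def intro: continuous_on_subset)
  have ac\<phi>: "ac_on b \<phi> \<phi>'"
    using \<phi> by (intro ac_on_C1[OF _ c]) (auto simp: test_function_def intro: has_vector_derivative_at_within)
  obtain s t where "0 < s" "t < b" "\<forall>x. x \<notin> {s..t} \<longrightarrow> \<phi> x = 0"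
    using \<phi> unfolding test_function_def by blast
  then have 0: "\<phi> 0 = 0" "\<phi> b = 0" by auto
  have "F b * \<phi> b = F 0 * \<phi> 0 + (LINT x:{0..b}|lborel. f x * \<phi> x + F x * \<phi>' x)"
    by (rule ac_onD(2)[OF ac_on_mult[OF F ac\<phi>]]) (use b in simp)
  then have e: "(LINT x:{0..b}|lborel. f x * \<phi> x + F x * \<phi>' x) = 0" by (simp add: 0)
  have i1: "set_integrable lborel {0..b} (\<lambda>x. f x * \<phi> x)"
    by (rule set_integrable_mult_continuous[OF ac_onD(1)[OF F] ac_on_continuous[OF ac\<phi>]])
  have i2: "set_integrable lborel {0..b} (\<lambda>x. F x * \<phi>' x)"
    by (rule borel_integrable_atLeastAtMost') (intro continuous_intros ac_on_continuous[OF F] c)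
  show ?thesis using e unfolding set_integral_add(2)[OF i1 i2] by (simp add: add_eq_0_iff)
qed

lemma h1_rep_imp_weak_derivative:
  assumes b: "b > 0" and h: "h1_rep b u v F"
  shows "has_weak_derivative b u v"
  unfolding has_weak_derivative_def
proof (intro conjI allI impI h1_repD(1,2)[OF h])
  fix \<phi> \<phi>' assume \<phi>: "test_function b \<phi> \<phi>'"
  have c: "continuous_on {0..b} \<phi>'" using \<phi> by (auto simp: test_function_def intro: continuous_on_subset)
  have c0: "continuous_on {0..b} \<phi>" by (rule continuous_on_test_function[OF \<phi>])
  have i1: "set_integrable lborel {0..b} (\<lambda>x. rep_l2 u x * \<phi>' x)"
    by (rule set_integrable_mult_continuous[OF rep_l2_set_integrable c])
  have i2: "set_integrable lborel {0..b} (\<lambda>x. F x * \<phi>' x)"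
    by (rule borel_integrable_atLeastAtMost') (intro continuous_intros h1_repD(5)[OF h] c)
  have i3: "set_integrable lborel {0..b} (\<lambda>x. rep_l2 v x * \<phi> x)"
    by (rule set_integrable_mult_continuous[OF rep_l2_set_integrable c0])
  have "(LINT x:{0<..<b}|lborel. rep_l2 u x * \<phi>' x) = (LINT x:{0..b}|lborel. F x * \<phi>' x)"
    unfolding set_integral_open_eq_closed_interval[OF i1]
    by (rule set_integral_cong_AE_closed_interval[OF i1 i2]) (use h1_repD(4)[OF h] in eventually_elim, simp)
  also have "\<dots> = - (LINT x:{0..b}|lborel. rep_l2 v x * \<phi> x)"
    by (rule ac_on_test_function[OF \<phi> b h1_repD(3)[OF h]])
  finally show "(LINT x:{0<..<b}|lborel. rep_l2 u x * \<phi>' x) = - (LINT x:{0<..<b}|lborel. rep_l2 v x * \<phi> x)"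
    unfolding set_integral_open_eq_closed_interval[OF i3] .
qed

text \<open>The difference of u and the primitive of v has weak derivative 0, hence is constant by
  the lemma of du Bois-Reymond. This leads from the weak formulation to functions with boundary
  values.\<close>

lemma weak_derivative_imp_h1_rep:
  assumes b: "b > 0" and w: "has_weak_derivative b u v"
  shows "\<exists>F. h1_rep b u v F"
proof -
  define F0 where "F0 x = 0 + (LINT t:{0..x}|lborel. rep_l2 v t)" for x
  have ac0: "ac_on b F0 (rep_l2 v)"
    unfolding F0_def by (rule ac_on_primitive[OF rep_l2_set_integrable])
  have iF0: "set_integrable lborel {0..b} F0"
    by (rule borel_integrable_atLeastAtMost'[OF ac_on_continuous[OF ac0]])
  have i: "set_integrable lborel {0..b} (\<lambda>x. rep_l2 u x - F0 x)"
    by (rule set_integral_diff(1)[OF rep_l2_set_integrable iF0])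
  have "\<exists>c. AE x in lborel. x \<in> {0<..<b} \<longrightarrow> rep_l2 u x - F0 x = c"
  proof (rule du_bois_reymond[OF b])
    show "set_integrable lborel {0<..<b} (\<lambda>x. rep_l2 u x - F0 x)"
      by (rule set_integrable_subset[OF i]) auto
    fix \<phi> \<phi>' assume \<phi>: "test_function b \<phi> \<phi>'"
    have c: "continuous_on {0..b} \<phi>'" using \<phi> by (auto simp: test_function_def intro: continuous_on_subset)
    have c0: "continuous_on {0..b} \<phi>" by (rule continuous_on_test_function[OF \<phi>])
    have i1: "set_integrable lborel {0..b} (\<lambda>x. rep_l2 u x * \<phi>' x)"
      by (rule set_integrable_mult_continuous[OF rep_l2_set_integrable c])
    have i2: "set_integrable lborel {0..b} (\<lambda>x. F0 x * \<phi>' x)"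
      by (rule set_integrable_mult_continuous[OF iF0 c])
    have i3: "set_integrable lborel {0..b} (\<lambda>x. rep_l2 v x * \<phi> x)"
      by (rule set_integrable_mult_continuous[OF rep_l2_set_integrable c0])
    have i4: "set_integrable lborel {0..b} (\<lambda>x. rep_l2 u x * \<phi>' x - F0 x * \<phi>' x)"
      by (rule set_integral_diff(1)[OF i1 i2])
    have "(LINT x:{0<..<b}|lborel. rep_l2 u x * \<phi>' x) = - (LINT x:{0<..<b}|lborel. rep_l2 v x * \<phi> x)"
      using w \<phi> by (simp add: has_weak_derivative_def)
    then have "(LINT x:{0..b}|lborel. rep_l2 u x * \<phi>' x) = (LINT x:{0..b}|lborel. F0 x * \<phi>' x)"
      unfolding set_integral_open_eq_closed_interval[OF i1] set_integral_open_eq_closed_interval[OF i3]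
        ac_on_test_function[OF \<phi> b ac0] .
    then have "(LINT x:{0..b}|lborel. rep_l2 u x * \<phi>' x - F0 x * \<phi>' x) = 0"
      unfolding set_integral_diff(2)[OF i1 i2] by simp
    then show "(LINT x:{0<..<b}|lborel. (rep_l2 u x - F0 x) * \<phi>' x) = 0"
      unfolding left_diff_distrib set_integral_open_eq_closed_interval[OF i4] .
  qed
  then obtain c where c: "AE x in lborel. x \<in> {0<..<b} \<longrightarrow> rep_l2 u x - F0 x = c" by blast
  let ?F = "\<lambda>x. c + (LINT t:{0..x}|lborel. rep_l2 v t)"
  have "h1_rep b u v (\<lambda>x. c + (LINT t:{0..x}|lborel. rep_l2 v t))"
    unfolding h1_rep_def
  proof (intro conjI)
    show "AE x in lborel. x \<in> {0<..<b} \<longrightarrow> rep_l2 u x = c + (LINT t:{0..x}|lborel. rep_l2 v t)"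
      using c by eventually_elim (simp add: F0_def diff_eq_eq)
  qed (use w in \<open>auto simp: has_weak_derivative_def intro: ac_on_primitive rep_l2_set_integrable\<close>)
  then show ?thesis by (intro exI[of _ ?F])
qed

text \<open>Evaluates the definite description; together with \<open>trace_at_eq\<close> it lets
  computations on an edge use one explicit representative F.\<close>

lemma weak_derivative_eq:
  assumes b: "b > 0" and h: "h1_rep b u v F" shows "weak_derivative b u = v"
  unfolding weak_derivative_def
proof (rule the_equality)
  show "has_weak_derivative b u v" by (rule h1_rep_imp_weak_derivative[OF b h])
  fix v' assume "has_weak_derivative b u v'"
  then obtain F' where "h1_rep b u v' F'" using weak_derivative_imp_h1_rep[OF b] by blast
  then show "v' = v" using h1_rep_unique(1)[OF b _ h] by blast
qed

lemma H1_interval_iff: "b > 0 \<Longrightarrow> u \<in> H1_interval b \<longleftrightarrow> (\<exists>v F. h1_rep b u v F)"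
  unfolding H1_interval_def using h1_rep_imp_weak_derivative weak_derivative_imp_h1_rep by blast

lemma h1_rep_exists:
  assumes "b > 0" "u \<in> H1_interval b" obtains F where "h1_rep b u (weak_derivative b u) F"
  using assms H1_interval_iff[OF assms(1)] weak_derivative_eq[OF assms(1)] by blast

lemma trace_at_eq:
  assumes b: "b > 0" and h: "h1_rep b u v F" and x: "x \<in> {0..b}" shows "trace_at b u x = F x"
  unfolding trace_at_def
proof (rule the_equality)
  have "AE s in lborel. s \<in> {0<..<b} \<longrightarrow> F s = rep_l2 u s"
    using h1_repD(4)[OF h] by eventually_elim simp
  then show "\<exists>g. continuous_on {0..b} g \<and> (AE s in lborel. s \<in> {0<..<b} \<longrightarrow> g s = rep_l2 u s) \<and> F x = g x"
    using h1_repD(5)[OF h] by blast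
  fix y assume "\<exists>g. continuous_on {0..b} g \<and> (AE s in lborel. s \<in> {0<..<b} \<longrightarrow> g s = rep_l2 u s) \<and> y = g x"
  then obtain g where g: "continuous_on {0..b} g" "AE s in lborel. s \<in> {0<..<b} \<longrightarrow> g s = rep_l2 u s" "y = g x"
    by blast
  have "AE s in lborel. s \<in> {0<..<b} \<longrightarrow> g s = F s"
    using g(2) h1_repD(4)[OF h] by eventually_elim simp
  then show "y = F x" using continuous_AE_eq[OF b g(1) h1_repD(5)[OF h] _ x] g(3) by simp
qed

section \<open>Linear operations, conjugation and Green's formula for representatives\<close>

lemma h1_rep_add:
  assumes b: "b > 0" and 1: "h1_rep b u v F" and 2: "h1_rep b u' v' F'"
  shows "h1_rep b (u + u') (v + v') (\<lambda>x. F x + F' x)"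
  unfolding h1_rep_def
proof (intro conjI)
  note cs = csubspace_L2_interval[of b]
  show "u + u' \<in> L2_interval b" "v + v' \<in> L2_interval b"
    using h1_repD(1,2)[OF 1] h1_repD(1,2)[OF 2] cs by (auto simp: csubspace_def)
  show "ac_on b (\<lambda>x. F x + F' x) (rep_l2 (v + v'))"
  proof (rule ac_on_cong_AE[OF ac_on_add[OF h1_repD(3)[OF 1] h1_repD(3)[OF 2]] refl])
    show "AE x in lborel. x \<in> {0<..<b} \<longrightarrow> rep_l2 v x + rep_l2 v' x = rep_l2 (v + v') x"
      using rep_add_l2[of v v'] by eventually_elim simp
  qed (use b in simp_all)
  show "AE x in lborel. x \<in> {0<..<b} \<longrightarrow> rep_l2 (u + u') x = F x + F' x"
    using rep_add_l2[of u u'] h1_repD(4)[OF 1] h1_repD(4)[OF 2] by eventually_elim simp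
qed

lemma h1_rep_scaleC:
  assumes b: "b > 0" and 1: "h1_rep b u v F"
  shows "h1_rep b (c *\<^sub>C u) (c *\<^sub>C v) (\<lambda>x. c * F x)"
  unfolding h1_rep_def
proof (intro conjI)
  show "c *\<^sub>C u \<in> L2_interval b" "c *\<^sub>C v \<in> L2_interval b"
    using h1_repD(1,2)[OF 1] csubspace_scaleC[OF csubspace_L2_interval] by auto
  show "ac_on b (\<lambda>x. c * F x) (rep_l2 (c *\<^sub>C v))"
  proof (rule ac_on_cong_AE[OF ac_on_cmult[OF h1_repD(3)[OF 1]] refl])
    show "AE x in lborel. x \<in> {0<..<b} \<longrightarrow> c * rep_l2 v x = rep_l2 (c *\<^sub>C v) x"
      using rep_scaleC_l2[of c v] by eventually_elim simp
  qed (use b in simp_all)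
  show "AE x in lborel. x \<in> {0<..<b} \<longrightarrow> rep_l2 (c *\<^sub>C u) x = c * F x"
    using rep_scaleC_l2[of c u] h1_repD(4)[OF 1] by eventually_elim simp
qed

lemma h1_rep_conj:
  assumes b: "b > 0" and 1: "h1_rep b u v F"
  shows "h1_rep b (conj_l2 u) (conj_l2 v) (\<lambda>x. cnj (F x))"
  unfolding h1_rep_def
proof (intro conjI)
  show "conj_l2 u \<in> L2_interval b" "conj_l2 v \<in> L2_interval b"
    using h1_repD(1,2)[OF 1] conj_l2_in_L2_interval by auto
  show "ac_on b (\<lambda>x. cnj (F x)) (rep_l2 (conj_l2 v))"
  proof (rule ac_on_cong_AE[OF ac_on_cnj[OF h1_repD(3)[OF 1]] refl])
    show "AE x in lborel. x \<in> {0<..<b} \<longrightarrow> cnj (rep_l2 v x) = rep_l2 (conj_l2 v) x"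
      using rep_conj_l2[of v] by eventually_elim simp
  qed (use b in simp_all)
  show "AE x in lborel. x \<in> {0<..<b} \<longrightarrow> rep_l2 (conj_l2 u) x = cnj (F x)"
    using rep_conj_l2[of u] h1_repD(4)[OF 1] by eventually_elim simp
qed

lemma cinner_L2_interval:
  assumes u: "u \<in> L2_interval b" and F: "AE x in lborel. x \<in> {0<..<b} \<longrightarrow> rep_l2 u x = F x"
    and G: "AE x in lborel. x \<in> {0<..<b} \<longrightarrow> rep_l2 v x = G x"
    and i: "set_integrable lborel {0..b} (\<lambda>x. F x * cnj (G x))"
  shows "cinner u v = (LINT x:{0..b}|lborel. F x * cnj (G x))"
  unfolding cinner_l2_rep set_lebesgue_integral_def
proof (rule integral_cong_AE)
  show "(\<lambda>x. rep_l2 u x * cnj (rep_l2 v x)) \<in> borel_measurable lborel"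
    by (rule borel_measurable_integrable[OF integrable_mult_cnj[OF sq_integrable_rep sq_integrable_rep]])
  show "(\<lambda>x. indicator {0..b} x *\<^sub>R (F x * cnj (G x))) \<in> borel_measurable lborel"
    using i borel_measurable_integrable by (auto simp: set_integrable_def)
  have "AE x in lborel. x \<notin> {0<..<b} \<longrightarrow> rep_l2 u x = 0" using u by (simp add: L2_interval_iff)
  then show "AE x in lborel. rep_l2 u x * cnj (rep_l2 v x) = indicator {0..b} x *\<^sub>R (F x * cnj (G x))"
    using F G AE_lborel_singleton[of "0::real"] AE_lborel_singleton[of b]
    by eventually_elim (auto simp: indicator_def)
qed

text \<open>The product rule for F and the conjugate of G, taken from 0 to b.\<close>

lemma h1_rep_green:
  assumes b: "b > 0" and 1: "h1_rep b u v F" and 2: "h1_rep b w z G"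
  shows "cinner v w + cinner u z = F b * cnj (G b) - F 0 * cnj (G 0)"
proof -
  have acG: "ac_on b (\<lambda>x. cnj (G x)) (\<lambda>x. cnj (rep_l2 z x))" by (rule ac_on_cnj[OF h1_repD(3)[OF 2]])
  have i1: "set_integrable lborel {0..b} (\<lambda>x. rep_l2 v x * cnj (G x))"
    by (rule set_integrable_mult_continuous[OF rep_l2_set_integrable ac_on_continuous[OF acG]])
  have i2: "set_integrable lborel {0..b} (\<lambda>x. F x * cnj (rep_l2 z x))"
    using set_integrable_mult_continuous[OF ac_onD(1)[OF acG] h1_repD(5)[OF 1]] by (simp only: mult.commute)
  have "cinner v w = (LINT x:{0..b}|lborel. rep_l2 v x * cnj (G x))"
    by (rule cinner_L2_interval[OF h1_repD(2)[OF 1] _ h1_repD(4)[OF 2] i1]) simp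
  moreover have "cinner u z = (LINT x:{0..b}|lborel. F x * cnj (rep_l2 z x))"
    by (rule cinner_L2_interval[OF h1_repD(1)[OF 1] h1_repD(4)[OF 1] _ i2]) simp
  moreover have "F b * cnj (G b) = F 0 * cnj (G 0)
      + (LINT x:{0..b}|lborel. rep_l2 v x * cnj (G x) + F x * cnj (rep_l2 z x))"
    by (rule ac_onD(2)[OF ac_on_mult[OF h1_repD(3)[OF 1] acG]]) (use b in simp)
  ultimately show ?thesis unfolding set_integral_add(2)[OF i1 i2] by simp
qed

lemma L2_interval_of_continuous:
  fixes F :: "real \<Rightarrow> complex"
  assumes F: "continuous_on {0..b} F"
  shows "\<exists>u\<in>L2_interval b. AE x in lborel. x \<in> {0<..<b} \<longrightarrow> rep_l2 u x = F x"
proof -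
  define f where "f x = indicator {0<..<b} x *\<^sub>R F x" for x
  have "sq_integrable f"
    unfolding sq_integrable_def
  proof
    have "set_integrable lborel {0<..<b} F"
      by (rule set_integrable_subset[OF borel_integrable_atLeastAtMost'[OF F]]) auto
    then have "integrable lborel f" by (simp add: set_integrable_def f_def[abs_def])
    then show "f \<in> borel_measurable lborel" by (rule borel_measurable_integrable)
    have "continuous_on {0..b} (\<lambda>x. (cmod (F x))\<^sup>2)" by (intro continuous_intros F)
    then have "set_integrable lborel {0<..<b} (\<lambda>x. (cmod (F x))\<^sup>2)"
      by (intro set_integrable_subset[OF borel_integrable_atLeastAtMost']) auto
    moreover have "indicator {0<..<b} x *\<^sub>R (cmod (F x))\<^sup>2 = (cmod (f x))\<^sup>2" for x
      by (simp add: f_def indicator_def)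
    ultimately show "integrable lborel (\<lambda>x. (cmod (f x))\<^sup>2)" by (simp add: set_integrable_def)
  qed
  then have ae: "AE x in lborel. rep_l2 (abs_l2 f) x = f x" by (rule rep_abs_l2)
  have "abs_l2 f \<in> L2_interval b"
    unfolding L2_interval_iff using ae by eventually_elim (simp add: f_def)
  moreover have "AE x in lborel. x \<in> {0<..<b} \<longrightarrow> rep_l2 (abs_l2 f) x = F x"
    using ae by eventually_elim (simp add: f_def)
  ultimately show ?thesis by blast
qed

text \<open>Variation of constants with integrating factor exp (m x). The source f is merely square
  integrable, so the equation is obtained from the product rule for absolutely continuous
  functions.\<close>

lemma first_order_ivp:
  assumes b: "b > 0" and f: "f \<in> L2_interval b"
  shows "\<exists>u F. h1_rep b u (m *\<^sub>C u + f) F \<and> F 0 = c"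
proof -
  define E where "E x = exp (m * of_real x)" for x :: real
  define p where "p x = rep_l2 f x * exp (- m * of_real x)" for x :: real
  define G where "G x = c + (LINT t:{0..x}|lborel. p t)" for x
  have acE: "ac_on b E (\<lambda>x. m * E x)"
  proof (rule ac_on_C1)
    show "(E has_vector_derivative m * E x) (at x within {0..b})" for x
    proof -
      have "((\<lambda>z. exp (m * z)) has_field_derivative m * exp (m * of_real x)) (at (of_real x))"
        by (auto intro!: derivative_eq_intros)
      from has_vector_derivative_real_field[OF this]
      show ?thesis by (auto simp: E_def[abs_def] intro: has_vector_derivative_at_within)
    qed
    show "continuous_on {0..b} (\<lambda>x. m * E x)" unfolding E_def by (intro continuous_intros)
  qed
  have ip: "set_integrable lborel {0..b} p"
    unfolding p_def by (rule set_integrable_mult_continuous[OF rep_l2_set_integrable]) (intro continuous_intros)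
  have acG: "ac_on b G p" unfolding G_def[abs_def] by (rule ac_on_primitive[OF ip])
  define F where "F x = E x * G x" for x
  have acF: "ac_on b F (\<lambda>x. m * E x * G x + E x * p x)"
    unfolding F_def[abs_def] by (rule ac_on_mult[OF acE acG])
  obtain u where u: "u \<in> L2_interval b" "AE x in lborel. x \<in> {0<..<b} \<longrightarrow> rep_l2 u x = F x"
    using L2_interval_of_continuous[OF ac_on_continuous[OF acF]] by blast
  have Ep: "E x * p x = rep_l2 f x" for x
    by (simp add: E_def p_def exp_minus field_simps)
  have v: "m *\<^sub>C u + f \<in> L2_interval b"
    using u(1) f csubspace_L2_interval[of b] by (simp add: csubspace_def)
  have "ac_on b F (rep_l2 (m *\<^sub>C u + f))"
  proof (rule ac_on_cong_AE[OF acF refl])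
    show "AE x in lborel. x \<in> {0<..<b} \<longrightarrow> m * E x * G x + E x * p x = rep_l2 (m *\<^sub>C u + f) x"
      using u(2) rep_add_l2[of "m *\<^sub>C u" f] rep_scaleC_l2[of m u]
      by eventually_elim (simp add: Ep F_def)
  qed (use b in simp_all)
  moreover have "F 0 = c"
    using ac_onD(2)[OF acG, of 0] b by (simp add: F_def E_def) (simp add: G_def set_lebesgue_integral_def)
  ultimately show ?thesis using u v by (auto simp: h1_rep_def)
qed

text \<open>At a minimum point |F|^2 is at most its mean, hence at most (norm u)^2 / b; from there
  to y it changes by the integral of 2 Re (v conj F), split by Young's inequality with weight
  \<epsilon>. The free small factor at \<open>norm v\<close> allows absorption later.\<close>

lemma trace_estimate:
  assumes b: "b > 0" and h: "h1_rep b u v F" and e: "\<epsilon> > 0" and y: "y \<in> {0..b}"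
  shows "(cmod (F y))\<^sup>2 \<le> (norm u)\<^sup>2 / b + (\<epsilon> * (norm v)\<^sup>2 + (norm u)\<^sup>2 / \<epsilon>)"
proof -
  have contF: "continuous_on {0..b} F" by (rule h1_repD(5)[OF h])
  have contF2: "continuous_on {0..b} (\<lambda>x. (cmod (F x))\<^sup>2)" by (intro continuous_intros contF)
  have iu: "integrable lborel (\<lambda>x. (cmod (rep_l2 u x))\<^sup>2)" and iv: "integrable lborel (\<lambda>x. (cmod (rep_l2 v x))\<^sup>2)"
    using sq_integrable_rep by (auto simp: sq_integrable_def)
  have aeF: "AE x in lborel. x \<in> {0..b} \<longrightarrow> rep_l2 u x = F x"
    using h1_repD(4)[OF h] AE_lborel_singleton[of "0::real"] AE_lborel_singleton[of b]
    by eventually_elim auto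
  obtain x where x: "x \<in> {0..b}" and min: "\<And>z. z \<in> {0..b} \<Longrightarrow> (cmod (F x))\<^sup>2 \<le> (cmod (F z))\<^sup>2"
    using continuous_attains_inf[OF compact_Icc _ contF2] b by auto
  have "b * (cmod (F x))\<^sup>2 = (LINT z|lborel. indicator {0..b} z * (cmod (F x))\<^sup>2)"
    using b by simp
  also have "\<dots> \<le> (LINT z|lborel. (cmod (rep_l2 u z))\<^sup>2)"
  proof (rule integral_mono_AE[OF _ iu])
    show "integrable lborel (\<lambda>z. indicator {0..b} z * (cmod (F x))\<^sup>2)"
      by (intro integrable_mult_left integrable_real_indicator) (auto simp: emeasure_lborel_Icc_eq)
    show "AE z in lborel. indicator {0..b} z * (cmod (F x))\<^sup>2 \<le> (cmod (rep_l2 u z))\<^sup>2"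
      using aeF by eventually_elim (use min in \<open>auto simp: indicator_def\<close>)
  qed
  finally have Fx: "(cmod (F x))\<^sup>2 \<le> (norm u)\<^sup>2 / b"
    using b by (simp add: norm_l2_rep le_divide_eq mult.commute)
  define n where "n z = rep_l2 v z * cnj (F z) + F z * cnj (rep_l2 v z)" for z
  have acN: "ac_on b (\<lambda>z. F z * cnj (F z)) n"
    unfolding n_def[abs_def] by (rule ac_on_mult[OF h1_repD(3)[OF h] ac_on_cnj[OF h1_repD(3)[OF h]]])
  have iy: "integrable lborel (\<lambda>z. indicator {0..y} z *\<^sub>R n z)" and ix: "integrable lborel (\<lambda>z. indicator {0..x} z *\<^sub>R n z)"
    using set_integrable_subinterval[OF ac_onD(1)[OF acN]] x y by (auto simp: set_integrable_def)
  have "F y * cnj (F y) - F x * cnj (F x) = (LINT z:{0..y}|lborel. n z) - (LINT z:{0..x}|lborel. n z)"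
    unfolding ac_onD(2)[OF acN y] ac_onD(2)[OF acN x] by simp
  also have "\<dots> = (LINT z|lborel. indicator {0..y} z *\<^sub>R n z - indicator {0..x} z *\<^sub>R n z)"
    unfolding set_lebesgue_integral_def by (rule Bochner_Integration.integral_diff[OF iy ix, symmetric])
  finally have "cmod (F y * cnj (F y) - F x * cnj (F x))
      = cmod (LINT z|lborel. indicator {0..y} z *\<^sub>R n z - indicator {0..x} z *\<^sub>R n z)" by simp
  also have "\<dots> \<le> (LINT z|lborel. cmod (indicator {0..y} z *\<^sub>R n z - indicator {0..x} z *\<^sub>R n z))"
    by (rule integral_norm_bound)
  also have "\<dots> \<le> (LINT z|lborel. \<epsilon> * (cmod (rep_l2 v z))\<^sup>2 + (1 / \<epsilon>) * (cmod (rep_l2 u z))\<^sup>2)"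
  proof (rule integral_mono_AE)
    show "integrable lborel (\<lambda>z. cmod (indicator {0..y} z *\<^sub>R n z - indicator {0..x} z *\<^sub>R n z))"
      by (intro integrable_norm Bochner_Integration.integrable_diff ix iy)
    show "integrable lborel (\<lambda>z. \<epsilon> * (cmod (rep_l2 v z))\<^sup>2 + (1 / \<epsilon>) * (cmod (rep_l2 u z))\<^sup>2)"
      by (intro Bochner_Integration.integrable_add integrable_mult_right iu iv)
    show "AE z in lborel. cmod (indicator {0..y} z *\<^sub>R n z - indicator {0..x} z *\<^sub>R n z)
        \<le> \<epsilon> * (cmod (rep_l2 v z))\<^sup>2 + (1 / \<epsilon>) * (cmod (rep_l2 u z))\<^sup>2"
      using aeF
    proof eventually_elim
      case (elim z)
      define p q where "p = cmod (rep_l2 v z)" and "q = cmod (rep_l2 u z)"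
      have W: "2 * (p * q) \<le> \<epsilon> * p\<^sup>2 + (1 / \<epsilon>) * q\<^sup>2"
      proof -
        have "0 \<le> (\<epsilon> * p - q)\<^sup>2 / \<epsilon>" using e by simp
        also have "\<dots> = \<epsilon> * p\<^sup>2 + (1 / \<epsilon>) * q\<^sup>2 - 2 * (p * q)"
          using e by (simp add: power2_eq_square field_simps)
        finally show ?thesis by simp
      qed
      have W0: "0 \<le> \<epsilon> * p\<^sup>2 + (1 / \<epsilon>) * q\<^sup>2" using e by simp
      show ?case
      proof (cases "z \<in> {0..b}")
        case True
        \<comment> \<open>The two indicators differ by at most 1 whichever of x and y is larger, so
          their order need not be distinguished.\<close>
        have "cmod (indicator {0..y} z *\<^sub>R n z - indicator {0..x} z *\<^sub>R n z) \<le> cmod (n z)"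
          by (simp add: indicator_def)
        also have "\<dots> \<le> cmod (rep_l2 v z * cnj (F z)) + cmod (F z * cnj (rep_l2 v z))"
          unfolding n_def by (rule norm_triangle_ineq)
        also have "\<dots> = 2 * (p * q)" using elim True by (simp add: norm_mult p_def q_def)
        finally show ?thesis using W by (simp add: p_def q_def)
      next
        case False
        then have "z \<notin> {0..y}" "z \<notin> {0..x}" using x y by auto
        then show ?thesis using W0 by (simp add: p_def q_def)
      qed
    qed
  qed
  also have "\<dots> = \<epsilon> * (norm v)\<^sup>2 + (norm u)\<^sup>2 / \<epsilon>"
    unfolding norm_l2_rep
    by (subst Bochner_Integration.integral_add) (use iu iv in auto)
  finally have d: "cmod (F y * cnj (F y) - F x * cnj (F x)) \<le> \<epsilon> * (norm v)\<^sup>2 + (norm u)\<^sup>2 / \<epsilon>" .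
  have "(cmod (F y))\<^sup>2 - (cmod (F x))\<^sup>2 = Re (F y * cnj (F y) - F x * cnj (F x))"
    by (simp only: complex_norm_square[symmetric] of_real_diff[symmetric] Re_complex_of_real)
  also have "\<dots> \<le> cmod (F y * cnj (F y) - F x * cnj (F x))" by (rule complex_Re_le_cmod)
  finally show ?thesis using d Fx by linarith
qed

context
  fixes b :: real
  assumes b: "b > 0"
begin

section \<open>Derivatives, traces and initial value problems on one edge\<close>

lemma H1_interval_add:
  assumes u: "u \<in> H1_interval b" and v: "v \<in> H1_interval b"
  shows "u + v \<in> H1_interval b" "weak_derivative b (u + v) = weak_derivative b u + weak_derivative b v"
    "x \<in> {0..b} \<Longrightarrow> trace_at b (u + v) x = trace_at b u x + trace_at b v x"
proof -
  obtain F where F: "h1_rep b u (weak_derivative b u) F" using h1_rep_exists[OF b u] .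
  obtain G where G: "h1_rep b v (weak_derivative b v) G" using h1_rep_exists[OF b v] .
  note s = h1_rep_add[OF b F G]
  show "u + v \<in> H1_interval b" using H1_interval_iff[OF b] s by blast
  show "weak_derivative b (u + v) = weak_derivative b u + weak_derivative b v"
    by (rule weak_derivative_eq[OF b s])
  show "x \<in> {0..b} \<Longrightarrow> trace_at b (u + v) x = trace_at b u x + trace_at b v x"
    by (simp add: trace_at_eq[OF b s] trace_at_eq[OF b F] trace_at_eq[OF b G])
qed

lemma H1_interval_scaleC:
  assumes u: "u \<in> H1_interval b"
  shows "c *\<^sub>C u \<in> H1_interval b" "weak_derivative b (c *\<^sub>C u) = c *\<^sub>C weak_derivative b u"
    "x \<in> {0..b} \<Longrightarrow> trace_at b (c *\<^sub>C u) x = c * trace_at b u x"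
proof -
  obtain F where F: "h1_rep b u (weak_derivative b u) F" using h1_rep_exists[OF b u] .
  note s = h1_rep_scaleC[OF b F]
  show "c *\<^sub>C u \<in> H1_interval b" using H1_interval_iff[OF b] s by blast
  show "weak_derivative b (c *\<^sub>C u) = c *\<^sub>C weak_derivative b u"
    by (rule weak_derivative_eq[OF b s])
  show "x \<in> {0..b} \<Longrightarrow> trace_at b (c *\<^sub>C u) x = c * trace_at b u x"
    by (simp add: trace_at_eq[OF b s] trace_at_eq[OF b F])
qed

lemma H1_interval_conj:
  assumes u: "u \<in> H1_interval b"
  shows "conj_l2 u \<in> H1_interval b" "weak_derivative b (conj_l2 u) = conj_l2 (weak_derivative b u)"
    "x \<in> {0..b} \<Longrightarrow> trace_at b (conj_l2 u) x = cnj (trace_at b u x)"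
proof -
  obtain F where F: "h1_rep b u (weak_derivative b u) F" using h1_rep_exists[OF b u] .
  note s = h1_rep_conj[OF b F]
  show "conj_l2 u \<in> H1_interval b" using H1_interval_iff[OF b] s by blast
  show "weak_derivative b (conj_l2 u) = conj_l2 (weak_derivative b u)"
    by (rule weak_derivative_eq[OF b s])
  show "x \<in> {0..b} \<Longrightarrow> trace_at b (conj_l2 u) x = cnj (trace_at b u x)"
    by (simp add: trace_at_eq[OF b s] trace_at_eq[OF b F])
qed

lemma H1_interval_L2:
  assumes u: "u \<in> H1_interval b" shows "u \<in> L2_interval b" "weak_derivative b u \<in> L2_interval b"
proof -
  obtain F where "h1_rep b u (weak_derivative b u) F" using h1_rep_exists[OF b u] .
  then show "u \<in> L2_interval b" "weak_derivative b u \<in> L2_interval b" by (rule h1_repD)+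
qed

lemma H2_intervalD: "u \<in> H2_interval b \<Longrightarrow> u \<in> H1_interval b" "u \<in> H2_interval b \<Longrightarrow> weak_derivative b u \<in> H1_interval b"
  by (auto simp: H2_interval_def)

lemma H2_interval_add: "u \<in> H2_interval b \<Longrightarrow> v \<in> H2_interval b \<Longrightarrow> u + v \<in> H2_interval b"
  by (simp add: H2_interval_def H1_interval_add)

lemma H2_interval_scaleC: "u \<in> H2_interval b \<Longrightarrow> c *\<^sub>C u \<in> H2_interval b"
  by (simp add: H2_interval_def H1_interval_scaleC)

lemma H2_interval_conj: "u \<in> H2_interval b \<Longrightarrow> conj_l2 u \<in> H2_interval b"
  by (simp add: H2_interval_def H1_interval_conj)

lemma zero_in_H1_interval: "0 \<in> H1_interval b"
proof -
  have "h1_rep b 0 0 (\<lambda>_. 0)"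
    unfolding h1_rep_def
  proof (intro conjI)
    show "0 \<in> L2_interval b" "0 \<in> L2_interval b" using csubspace_L2_interval[of b] by (auto simp: csubspace_def)
    show "AE x in lborel. x \<in> {0<..<b} \<longrightarrow> rep_l2 0 x = 0" using rep_zero_l2 by eventually_elim simp
    have "ac_on b (\<lambda>_. 0) (\<lambda>_. 0)" by (rule ac_on_C1) auto
    then show "ac_on b (\<lambda>_. 0) (rep_l2 0)"
      by (rule ac_on_cong_AE) (use b rep_zero_l2 in \<open>auto elim!: eventually_mono\<close>)
  qed
  then show ?thesis using H1_interval_iff[OF b] by blast
qed

lemma weak_derivative_zero: "weak_derivative b 0 = 0"
proof -
  have z: "0 *\<^sub>C u = 0" for u :: l2 using scaleC_of_real[of 0 u] by simp
  show ?thesis using H1_interval_scaleC(2)[OF zero_in_H1_interval, of 0] by (simp add: z)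
qed

lemma transport_ivp:
  assumes f: "f \<in> L2_interval b"
  shows "\<exists>u\<in>H1_interval b. \<mu> *\<^sub>R u - (- weak_derivative b u) = f \<and> trace_at b u 0 = c"
proof -
  obtain u F where u: "h1_rep b u (complex_of_real (- \<mu>) *\<^sub>C u + f) F" "F 0 = c"
    using first_order_ivp[OF b f] by blast
  have "u \<in> H1_interval b" using H1_interval_iff[OF b] u by blast
  moreover have "weak_derivative b u = - \<mu> *\<^sub>R u + f"
    using weak_derivative_eq[OF b u(1)] by (simp only: scaleC_of_real)
  moreover have "trace_at b u 0 = c" using trace_at_eq[OF b u(1), of 0] u(2) b by simp
  ultimately show ?thesis by (intro bexI[of _ u]) auto
qed

text \<open>The factorisation \<open>u'' - m\<^sup>2 u = (\<partial> - m)(\<partial> + m) u\<close> with \<open>m\<^sup>2 = \<mu>\<close> reduces the second order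
  problem to two problems of first order.\<close>

lemma diffusion_ivp:
  assumes f: "f \<in> L2_interval b" and \<mu>: "\<mu> \<ge> 0"
  shows "\<exists>u\<in>H2_interval b. \<mu> *\<^sub>R u - weak_derivative b (weak_derivative b u) = f \<and>
    trace_at b u 0 = c0 \<and> trace_at b (weak_derivative b u) 0 = c1"
proof -
  define m where "m = sqrt \<mu>"
  have mm: "m * m = \<mu>" using \<mu> by (simp add: m_def)
  have "- f \<in> L2_interval b"
    using subspace_neg[OF csubspace_imp_subspace[OF csubspace_L2_interval] f] .
  \<comment> \<open>The unknown of the first factor is w = u' + m u: it solves w' = m w - f and
    starts at c1 + m c0.\<close>
  then obtain w W where w: "h1_rep b w (complex_of_real m *\<^sub>C w + - f) W" "W 0 = c1 + of_real m * c0"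
    using first_order_ivp[OF b] by blast
  obtain u F where u: "h1_rep b u (complex_of_real (- m) *\<^sub>C u + w) F" "F 0 = c0"
    using first_order_ivp[OF b h1_repD(1)[OF w(1)]] by blast
  define u' where "u' = complex_of_real (- m) *\<^sub>C u + w"
  define F' where "F' x = complex_of_real (- m) * F x + W x" for x
  have wu: "weak_derivative b u = u'" unfolding u'_def by (rule weak_derivative_eq[OF b u(1)])
  have u1: "h1_rep b u' (complex_of_real (- m) *\<^sub>C u' + (complex_of_real m *\<^sub>C w + - f)) F'"
    using h1_rep_add[OF b h1_rep_scaleC[OF b u(1), of "complex_of_real (- m)"] w(1)]
    unfolding u'_def F'_def[abs_def] .
  have "weak_derivative b u' = - m *\<^sub>R u' + (m *\<^sub>R w + - f)"
    using weak_derivative_eq[OF b u1] by (simp only: scaleC_of_real)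
  also have "\<dots> = \<mu> *\<^sub>R u - f"
    by (simp add: u'_def scaleC_of_real scaleR_add_right scaleR_diff_right mm[symmetric] del: of_real_minus)
  finally have wu': "weak_derivative b u' = \<mu> *\<^sub>R u - f" .
  have "u \<in> H2_interval b"
    unfolding H2_interval_def using H1_interval_iff[OF b] u(1) u1 wu by blast
  moreover have "\<mu> *\<^sub>R u - weak_derivative b (weak_derivative b u) = f" by (simp add: wu wu')
  moreover have "trace_at b u 0 = c0" using trace_at_eq[OF b u(1), of 0] u(2) b by simp
  moreover have "trace_at b (weak_derivative b u) 0 = c1"
    using trace_at_eq[OF b u1, of 0] u(2) w(2) b by (simp add: wu F'_def)
  ultimately show ?thesis by blast
qed

lemma diffusion_green:
  assumes u: "u \<in> H2_interval b"
  defines "u' \<equiv> weak_derivative b u"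
  shows "cinner (weak_derivative b u') u + cinner u' u' =
    trace_at b u' b * cnj (trace_at b u b) - trace_at b u' 0 * cnj (trace_at b u 0)"
proof -
  obtain F where F: "h1_rep b u u' F" using h1_rep_exists[OF b H2_intervalD(1)[OF u]] by (auto simp: u'_def)
  obtain F' where F': "h1_rep b u' (weak_derivative b u') F'"
    using h1_rep_exists[OF b H2_intervalD(2)[OF u]] by (auto simp: u'_def)
  show ?thesis
    using h1_rep_green[OF b F' F] trace_at_eq[OF b F] trace_at_eq[OF b F'] b by simp
qed

lemma transport_green:
  assumes u: "u \<in> H1_interval b"
  shows "2 * Re (cinner (weak_derivative b u) u) = (cmod (trace_at b u b))\<^sup>2 - (cmod (trace_at b u 0))\<^sup>2"
proof -
  obtain F where F: "h1_rep b u (weak_derivative b u) F" using h1_rep_exists[OF b u] .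
  have g: "cinner (weak_derivative b u) u + cinner u (weak_derivative b u)
      = F b * cnj (F b) - F 0 * cnj (F 0)" by (rule h1_rep_green[OF b F F])
  have "Re (cinner u (weak_derivative b u)) = Re (cinner (weak_derivative b u) u)"
    by (simp add: Re_cinner inner_commute)
  then have "2 * Re (cinner (weak_derivative b u) u) = Re (F b * cnj (F b) - F 0 * cnj (F 0))"
    unfolding g[symmetric] by simp
  also have "\<dots> = (cmod (F b))\<^sup>2 - (cmod (F 0))\<^sup>2"
    by (simp only: complex_norm_square[symmetric] of_real_diff[symmetric] Re_complex_of_real)
  finally show ?thesis using trace_at_eq[OF b F] b by simp
qed

lemma H1_trace_estimate:
  assumes "u \<in> H1_interval b" "\<epsilon> > 0" "y \<in> {0..b}"
  shows "(cmod (trace_at b u y))\<^sup>2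
    \<le> (norm u)\<^sup>2 / b + (\<epsilon> * (norm (weak_derivative b u))\<^sup>2 + (norm u)\<^sup>2 / \<epsilon>)"
proof -
  obtain F where F: "h1_rep b u (weak_derivative b u) F" using h1_rep_exists[OF b assms(1)] .
  show ?thesis unfolding trace_at_eq[OF b F assms(3)] by (rule trace_estimate[OF b F assms(2,3)])
qed

end

lemma conj_scaleR_l2: "conj_l2 (r *\<^sub>R u) = r *\<^sub>R conj_l2 u"
  unfolding scaleC_of_real[symmetric]
  by (rule l2_eqI)
    (use rep_conj_l2[of "complex_of_real r *\<^sub>C u"] rep_conj_l2[of u] rep_scaleC_l2[of "of_real r" u]
      rep_scaleC_l2[of "of_real r" "conj_l2 u"] in eventually_elim, simp)

section \<open>The operator on the graph\<close>

lemma csubspace_L2_graph: "csubspace (L2_graph a)"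
  using csubspace_L2_interval[unfolded csubspace_def]
  unfolding csubspace_def L2_graph_def by (simp add: scaleC_vec_def)

lemma closed_L2_graph: "closed (L2_graph a)"
proof -
  have "closed {u :: l2 ^ 'a. u $ e \<in> L2_interval (a e)}" for e
  proof -
    have "closed ((\<lambda>u :: l2 ^ 'a. u $ e) -` L2_interval (a e))"
      by (rule continuous_closed_vimage[OF closed_L2_interval]) (auto intro: continuous_intros)
    then show ?thesis by (simp add: vimage_def)
  qed
  then show ?thesis unfolding L2_graph_def by (intro closed_Collect_all)
qed

text \<open>The maximal domain, without boundary conditions: the boundary form is linear on it, so
  the conditions can be imposed afterwards by linear algebra.\<close>

definition graph_max :: "('e::finite \<Rightarrow> real) \<Rightarrow> 'e set \<Rightarrow> (l2 ^ 'e) set"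
  where "graph_max a Ed = {u. (\<forall>e\<in>Ed. u $ e \<in> H2_interval (a e)) \<and> (\<forall>e\<in>- Ed. u $ e \<in> H1_interval (a e))}"

definition boundary_form ::
    "('e::finite \<Rightarrow> real) \<Rightarrow> 'e set \<Rightarrow> complex ^ ('e + 'e + 'e) ^ ('e + 'e + 'e) \<Rightarrow>
      complex ^ ('e + 'e + 'e) ^ ('e + 'e + 'e) \<Rightarrow> l2 ^ 'e \<Rightarrow> complex ^ ('e + 'e + 'e)"
  where "boundary_form a Ed P L u = (mat 1 - P) *v bderivs a Ed u + (L + P) *v bvalues a Ed u"

text \<open>Cauchy data at the left end points. Placing them in the index type of the boundary
  vectors makes visible that there are as many data as boundary conditions.\<close>

definition initial_data :: "('e::finite \<Rightarrow> real) \<Rightarrow> 'e set \<Rightarrow> l2 ^ 'e \<Rightarrow> complex ^ ('e + 'e + 'e)"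
  where "initial_data a Ed u = (\<chi> k. case k of
      Inl e \<Rightarrow> if e \<in> Ed then trace_at (a e) (u $ e) 0 else 0
    | Inr (Inl e) \<Rightarrow> if e \<in> Ed then trace_at (a e) (weak_derivative (a e) (u $ e)) 0 else 0
    | Inr (Inr e) \<Rightarrow> if e \<in> Ed then 0 else trace_at (a e) (u $ e) 0)"

lemma graph_domain_eq: "graph_domain a Ed P L = {u \<in> graph_max a Ed. boundary_form a Ed P L u = 0}"
  by (auto simp: graph_domain_def graph_max_def boundary_form_def)

lemma vec_sum3_eqI:
  fixes x y :: "'c ^ ('e::finite + 'e + 'e)"
  assumes "\<And>e. x $ Inl e = y $ Inl e" "\<And>e. x $ Inr (Inl e) = y $ Inr (Inl e)" "\<And>e. x $ Inr (Inr e) = y $ Inr (Inr e)"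
  shows "x = y"
  unfolding vec_eq_iff
proof
  fix k :: "'e + 'e + 'e"
  show "x $ k = y $ k"
  proof (cases k)
    case (Inr j)
    then show ?thesis using assms by (cases j) auto
  qed (simp add: assms)
qed

lemma matrix_vector_scaleC: "M *v (c *\<^sub>C x) = c *\<^sub>C (M *v (x :: complex ^ 'n))"
  by (simp add: vec_eq_iff matrix_vector_mult_def scaleC_vec_def scaleC_complex_def sum_distrib_left mult_ac)

context
  fixes a :: "'e::finite \<Rightarrow> real" and Ed :: "'e set"
  assumes lengths: "\<And>e. a e > 0"
begin

section \<open>Linearity of the operator and of the boundary data\<close>

lemma lengths_nonneg: "0 \<le> a e"
  using lengths[of e] by simp

lemma graph_maxD:
  assumes "u \<in> graph_max a Ed"
  shows "e \<in> Ed \<Longrightarrow> u $ e \<in> H2_interval (a e)" "u $ e \<in> H1_interval (a e)"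
    "e \<in> Ed \<Longrightarrow> weak_derivative (a e) (u $ e) \<in> H1_interval (a e)"
  using assms H2_intervalD[OF lengths] by (auto simp: graph_max_def)

lemma graph_max_add:
  assumes "u \<in> graph_max a Ed" "v \<in> graph_max a Ed"
  shows "u + v \<in> graph_max a Ed" "graph_operator a Ed (u + v) = graph_operator a Ed u + graph_operator a Ed v"
    "bvalues a Ed (u + v) = bvalues a Ed u + bvalues a Ed v"
    "bderivs a Ed (u + v) = bderivs a Ed u + bderivs a Ed v"
    "initial_data a Ed (u + v) = initial_data a Ed u + initial_data a Ed v"
proof -
  note D = graph_maxD[OF assms(1)] graph_maxD[OF assms(2)]
  note A = H1_interval_add[OF lengths]
  show "u + v \<in> graph_max a Ed"
    using assms by (auto simp: graph_max_def H2_interval_add[OF lengths] A)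
  show "graph_operator a Ed (u + v) = graph_operator a Ed u + graph_operator a Ed v"
    by (simp add: graph_operator_def vec_eq_iff A D)
  show "bvalues a Ed (u + v) = bvalues a Ed u + bvalues a Ed v"
    by (rule vec_sum3_eqI) (simp_all add: bvalues_def A D lengths_nonneg add_divide_distrib)
  show "bderivs a Ed (u + v) = bderivs a Ed u + bderivs a Ed v"
    by (rule vec_sum3_eqI) (simp_all add: bderivs_def A D lengths_nonneg add_divide_distrib diff_divide_distrib)
  show "initial_data a Ed (u + v) = initial_data a Ed u + initial_data a Ed v"
    by (rule vec_sum3_eqI) (simp_all add: initial_data_def A D lengths_nonneg)
qed

lemma graph_max_scaleC:
  assumes "u \<in> graph_max a Ed"
  shows "c *\<^sub>C u \<in> graph_max a Ed" "graph_operator a Ed (c *\<^sub>C u) = c *\<^sub>C graph_operator a Ed u"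
    "bvalues a Ed (c *\<^sub>C u) = c *\<^sub>C bvalues a Ed u"
    "bderivs a Ed (c *\<^sub>C u) = c *\<^sub>C bderivs a Ed u"
    "initial_data a Ed (c *\<^sub>C u) = c *\<^sub>C initial_data a Ed u"
proof -
  note D = graph_maxD[OF assms(1)]
  note A = H1_interval_scaleC[OF lengths]
  have comp: "(c *\<^sub>C u) $ e = c *\<^sub>C (u $ e)" for e by (simp add: scaleC_vec_def)
  have compc: "(c *\<^sub>C x) $ k = c * x $ k" for x :: "complex ^ ('e + 'e + 'e)" and k
    by (simp add: scaleC_vec_def scaleC_complex_def)
  have minus: "- (c *\<^sub>C x) = c *\<^sub>C (- x)" for x :: l2
    using scaleC_diff_right[of c 0 x] scaleC_diff_right[of c 0 0] by simp
  show "c *\<^sub>C u \<in> graph_max a Ed"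
    using assms by (auto simp: graph_max_def comp H2_interval_scaleC[OF lengths] A)
  show "graph_operator a Ed (c *\<^sub>C u) = c *\<^sub>C graph_operator a Ed u"
    by (simp add: graph_operator_def vec_eq_iff comp A D scaleC_vec_def minus)
  show "bvalues a Ed (c *\<^sub>C u) = c *\<^sub>C bvalues a Ed u"
    by (rule vec_sum3_eqI) (simp_all add: bvalues_def compc comp A D lengths_nonneg distrib_left)
  show "bderivs a Ed (c *\<^sub>C u) = c *\<^sub>C bderivs a Ed u"
    by (rule vec_sum3_eqI) (simp_all add: bderivs_def compc comp A D lengths_nonneg right_diff_distrib)
  show "initial_data a Ed (c *\<^sub>C u) = c *\<^sub>C initial_data a Ed u"
    by (rule vec_sum3_eqI) (simp_all add: initial_data_def compc comp A D lengths_nonneg)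
qed

lemma boundary_form_add:
  "u \<in> graph_max a Ed \<Longrightarrow> v \<in> graph_max a Ed \<Longrightarrow>
    boundary_form a Ed P L (u + v) = boundary_form a Ed P L u + boundary_form a Ed P L v"
  by (simp add: boundary_form_def graph_max_add matrix_vector_right_distrib)

lemma boundary_form_scaleC:
  "u \<in> graph_max a Ed \<Longrightarrow> boundary_form a Ed P L (c *\<^sub>C u) = c *\<^sub>C boundary_form a Ed P L u"
  by (simp add: boundary_form_def graph_max_scaleC matrix_vector_scaleC scaleC_add_right)

lemma csubspace_graph_max: "csubspace (graph_max a Ed)"
  unfolding csubspace_def
proof (intro conjI ballI allI)
  show "0 \<in> graph_max a Ed"
    by (simp add: graph_max_def H2_interval_def zero_in_H1_interval lengths weak_derivative_zero)
qed (rule graph_max_add(1), assumption+, rule graph_max_scaleC(1))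

lemma graph_max_sub_L2: "graph_max a Ed \<subseteq> L2_graph a"
  unfolding L2_graph_def using H1_interval_L2(1)[OF lengths graph_maxD(2)] by blast

lemma graph_operator_in_L2:
  assumes u: "u \<in> graph_max a Ed" shows "graph_operator a Ed u \<in> L2_graph a"
proof -
  have "weak_derivative (a e) (weak_derivative (a e) (u $ e)) \<in> L2_interval (a e)" if "e \<in> Ed" for e
    by (rule H1_interval_L2(2)[OF lengths graph_maxD(3)[OF u that]])
  moreover have "- weak_derivative (a e) (u $ e) \<in> L2_interval (a e)" for e
    by (rule subspace_neg[OF csubspace_imp_subspace[OF csubspace_L2_interval]
          H1_interval_L2(2)[OF lengths graph_maxD(2)[OF u]]])
  ultimately show ?thesis by (simp add: L2_graph_def graph_operator_def)
qed

lemma linear_operator_graph: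
  "linear_operator_in (L2_graph a) (graph_domain a Ed P L) (graph_operator a Ed)"
proof -
  have z: "c *\<^sub>C (0 :: complex ^ ('e + 'e + 'e)) = 0" for c
    by (simp add: vec_eq_iff scaleC_vec_def scaleC_complex_def)
  have z': "0 *\<^sub>C x = 0" for x :: "complex ^ ('e + 'e + 'e)"
    by (simp add: vec_eq_iff scaleC_vec_def scaleC_complex_def)
  have "0 \<in> graph_max a Ed" using csubspace_graph_max by (simp add: csubspace_def)
  moreover have "0 *\<^sub>C u = 0" for u :: "l2 ^ 'e" using scaleC_of_real[of 0 u] by simp
  ultimately have "boundary_form a Ed P L 0 = 0"
    using boundary_form_scaleC[of 0 P L 0] by (simp add: z')
  then have "csubspace (graph_domain a Ed P L)"
    using csubspace_graph_max unfolding graph_domain_eq csubspace_def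
    by (auto simp: boundary_form_add boundary_form_scaleC z)
  then show ?thesis
    unfolding linear_operator_in_def
    using graph_max_sub_L2 graph_operator_in_L2 graph_max_add(2) graph_max_scaleC(2)
    by (auto simp: graph_domain_eq)
qed

end

section \<open>The boundary condition and the quadratic form\<close>

lemma csubspace_boundary_space: "csubspace (boundary_space Ed)"
  by (auto simp: csubspace_def boundary_space_def scaleC_vec_def scaleC_complex_def)

lemma boundary_matrix_mult: "boundary_matrix Ed M \<Longrightarrow> M *v x \<in> boundary_space Ed"
  by (auto simp: boundary_matrix_def boundary_space_def matrix_vector_mult_def intro!: sum.neutral)

lemma bvalues_in: "bvalues a Ed u \<in> boundary_space Ed"
  and bderivs_in: "bderivs a Ed u \<in> boundary_space Ed"
  by (auto simp: boundary_space_def boundary_index_def bvalues_def bderivs_def split: sum.splits)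

lemma boundary_form_in:
  assumes "boundary_matrix Ed P" "boundary_matrix Ed L"
  shows "boundary_form a Ed P L u \<in> boundary_space Ed"
proof -
  have s: "subspace (boundary_space Ed)" by (rule csubspace_imp_subspace[OF csubspace_boundary_space])
  show ?thesis
    unfolding boundary_form_def matrix_vector_mult_diff_rdistrib matrix_vector_mult_add_rdistrib
      matrix_vector_mul_lid
    by (intro subspace_add[OF s] subspace_diff[OF s] bderivs_in boundary_matrix_mult assms)
qed

lemma sum_UNIV_sum_type:
  fixes g :: "'a::finite + 'b::finite \<Rightarrow> 'c::comm_monoid_add"
  shows "(\<Sum>i\<in>UNIV. g i) = (\<Sum>i\<in>UNIV. g (Inl i)) + (\<Sum>i\<in>UNIV. g (Inr i))"
  using sum.Plus[of "UNIV :: 'a set" "UNIV :: 'b set" g] by (simp add: comp_def)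

lemma cinner_boundary_sum:
  fixes x y :: "complex ^ ('e::finite + 'e + 'e)"
  shows "cinner x y = (\<Sum>e\<in>UNIV. cinner (x $ Inl e) (y $ Inl e)
    + (cinner (x $ Inr (Inl e)) (y $ Inr (Inl e)) + cinner (x $ Inr (Inr e)) (y $ Inr (Inr e))))"
  by (simp add: cinner_vec_def sum_UNIV_sum_type sum.distrib)

text \<open>The boundary condition forces \<open>bvalues\<close> into \<open>Ker P\<close> and determines the component of
  \<open>bderivs\<close> in \<open>Ker P\<close>.\<close>

lemma boundary_pairing:
  assumes P: "orthogonal_projector Ed P" and L: "operator_on_kernel Ed P L"
    and u: "boundary_form a Ed P L u = 0"
  shows "cinner (bderivs a Ed u) (bvalues a Ed u) = - cinner (L *v bvalues a Ed u) (bvalues a Ed u)"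
proof -
  define v where "v = bvalues a Ed u"
  define w where "w = bderivs a Ed u"
  have v: "v \<in> boundary_space Ed" and w: "w \<in> boundary_space Ed"
    by (simp_all add: v_def w_def bvalues_in bderivs_in)
  have s: "subspace (boundary_space Ed)" by (rule csubspace_imp_subspace[OF csubspace_boundary_space])
  have bP: "boundary_matrix Ed P" and PP: "P *v (P *v x) = P *v x" for x
    using P by (auto simp: orthogonal_projector_def matrix_vector_mul_assoc)
  have LP: "L *v (P *v v) = 0" using L v by (simp add: operator_on_kernel_def)
  have Pv: "P *v v \<in> boundary_space Ed" by (rule boundary_matrix_mult[OF bP])
  have bc: "w - P *v w + (L *v v + P *v v) = 0"
    using u by (simp add: boundary_form_def v_def w_def matrix_vector_mult_diff_rdistrib
        matrix_vector_mult_add_rdistrib)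
  have ker: "P *v (v - P *v v) = 0" by (simp add: matrix_vector_mult_diff_distrib PP)
  \<comment> \<open>L is known to preserve Ker P only, so it is applied to the component v - P v; as
    L P v = 0, the result is L v.\<close>
  have "P *v (L *v (v - P *v v)) = 0"
    using L ker subspace_diff[OF s v Pv] by (simp add: operator_on_kernel_def)
  then have PLv: "P *v (L *v v) = 0" by (simp add: matrix_vector_mult_diff_distrib LP)
  \<comment> \<open>Applying P removes both w - P w and L v from the condition and leaves P v =
    0.\<close>
  have "P *v (w - P *v w + (L *v v + P *v v)) = 0" unfolding bc by simp
  then have Pv0: "P *v v = 0"
    by (simp add: matrix_vector_right_distrib matrix_vector_mult_diff_distrib PP PLv)
  have w': "w = P *v w - L *v v" using bc by (simp add: Pv0 algebra_simps add_eq_0_iff)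
  have "cinner (P *v w) v = cinner w (P *v v)" using P v w by (simp add: orthogonal_projector_def)
  also have "\<dots> = 0" by (simp add: Pv0 cinner_vec_def cinner_complex_def)
  finally have "cinner (P *v w) v = 0" .
  moreover have "cinner (x - y) v = cinner x v - cinner y v" for x y
    using cinner_add_left[of "x - y" y v] by simp
  ultimately have "cinner w v = - cinner (L *v v) v" by (subst w') simp
  then show ?thesis by (simp only: v_def w_def)
qed

context
  fixes a :: "'e::finite \<Rightarrow> real" and Ed :: "'e set"
  assumes lengths: "\<And>e. a e > 0"
begin

text \<open>Green's formula edge by edge: a diffusion edge leaves \<open>- (norm u')\<^sup>2\<close>
  behind, a transport edge nothing but boundary terms.\<close>

lemma Re_graph_form:
  assumes u: "u \<in> graph_max a Ed"
  shows "Re (cinner (graph_operator a Ed u) u) =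
    Re (cinner (bderivs a Ed u) (bvalues a Ed u)) - (\<Sum>e\<in>Ed. (norm (weak_derivative (a e) (u $ e)))\<^sup>2)"
proof -
  define du where "du e = weak_derivative (a e) (u $ e)" for e
  have edge: "Re (cinner (graph_operator a Ed u $ e) (u $ e)) =
      Re (cinner (bderivs a Ed u $ Inl e) (bvalues a Ed u $ Inl e)
      + (cinner (bderivs a Ed u $ Inr (Inl e)) (bvalues a Ed u $ Inr (Inl e))
      + cinner (bderivs a Ed u $ Inr (Inr e)) (bvalues a Ed u $ Inr (Inr e))))
      - (if e \<in> Ed then (norm (du e))\<^sup>2 else 0)" for e
  proof (cases "e \<in> Ed")
    case True
    have g: "cinner (weak_derivative (a e) (du e)) (u $ e) + cinner (du e) (du e) =
        trace_at (a e) (du e) (a e) * cnj (trace_at (a e) (u $ e) (a e))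
        - trace_at (a e) (du e) 0 * cnj (trace_at (a e) (u $ e) 0)"
      unfolding du_def by (rule diffusion_green[OF lengths graph_maxD(1)[OF lengths u True]])
    have "Re (cinner (weak_derivative (a e) (du e)) (u $ e)) =
        Re (trace_at (a e) (du e) (a e) * cnj (trace_at (a e) (u $ e) (a e))
        - trace_at (a e) (du e) 0 * cnj (trace_at (a e) (u $ e) 0)) - (norm (du e))\<^sup>2"
      unfolding g[symmetric] by (simp add: Re_cinner power2_norm_eq_inner)
    then show ?thesis
      using True by (simp add: graph_operator_def bderivs_def bvalues_def cinner_complex_def du_def)
  next
    case False
    define p q where "p = trace_at (a e) (u $ e) (a e)" and "q = trace_at (a e) (u $ e) 0"
    have t: "2 * Re (cinner (du e) (u $ e)) = (cmod p)\<^sup>2 - (cmod q)\<^sup>2"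
      unfolding du_def p_def q_def by (rule transport_green[OF lengths graph_maxD(2)[OF lengths u]])
    have neg: "Re (cinner (- du e) (u $ e)) = - Re (cinner (du e) (u $ e))"
      by (simp add: Re_cinner)
    have s2: "complex_of_real (sqrt 2) * complex_of_real (sqrt 2) = 2"
      by (simp flip: of_real_mult)
    \<comment> \<open>Re ((q - p) conj (p + q)) = |q|^2 - |p|^2, and the two factors 1 / sqrt 2
      supply the 1/2 that arises from integrating u' conj u.\<close>
    have "cinner ((- p + q) / complex_of_real (sqrt 2)) ((p + q) / complex_of_real (sqrt 2))
        = (- p + q) * cnj (p + q) / (complex_of_real (sqrt 2) * complex_of_real (sqrt 2))"
      by (simp add: cinner_complex_def)
    also have "\<dots> = (- p + q) * cnj (p + q) / 2" unfolding s2 ..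
    finally have "Re (cinner ((- p + q) / complex_of_real (sqrt 2)) ((p + q) / complex_of_real (sqrt 2)))
        = Re ((- p + q) * cnj (p + q)) / 2" by (simp only: Re_divide_numeral)
    also have "\<dots> = ((cmod q)\<^sup>2 - (cmod p)\<^sup>2) / 2"
      unfolding cmod_power2 by (simp add: field_simps power2_eq_square)
    finally have "Re (cinner ((- p + q) / complex_of_real (sqrt 2)) ((p + q) / complex_of_real (sqrt 2)))
        = Re (cinner (- du e) (u $ e))" using t neg by simp
    then show ?thesis
      using False by (simp add: graph_operator_def bderivs_def bvalues_def cinner_complex_def
          du_def p_def q_def)
  qed
  have "Re (cinner (graph_operator a Ed u) u) = (\<Sum>e\<in>UNIV. Re (cinner (graph_operator a Ed u $ e) (u $ e)))"
    by (simp add: cinner_vec_def)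
  also have "\<dots> = Re (cinner (bderivs a Ed u) (bvalues a Ed u)) - (\<Sum>e\<in>UNIV. if e \<in> Ed then (norm (du e))\<^sup>2 else 0)"
    unfolding edge cinner_boundary_sum sum_subtractf Re_sum by (simp only:)
  also have "(\<Sum>e\<in>UNIV. if e \<in> Ed then (norm (du e))\<^sup>2 else 0) = (\<Sum>e\<in>Ed. (norm (du e))\<^sup>2)"
    by (simp add: sum.If_cases)
  finally show ?thesis by (simp only: du_def)
qed

text \<open>The constant that results from the trace estimate with \<open>\<epsilon> = 1 / (2 \<omega> + 1)\<close>; it vanishes for
  \<open>\<omega> = 0\<close>, which gives the contractive case.\<close>

definition growth_constant :: "real \<Rightarrow> real"
  where "growth_constant \<omega> = (\<Sum>e\<in>UNIV. 2 * \<omega> * (1 / a e + (2 * \<omega> + 1)))"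

lemma growth_constant_nonneg: "\<omega> \<ge> 0 \<Longrightarrow> growth_constant \<omega> \<ge> 0"
  unfolding growth_constant_def using less_imp_le[OF lengths] by (intro sum_nonneg) simp

text \<open>A diffusion edge contributes two end values, each estimated with the same \<epsilon>;
  the resulting multiple 2 \<omega> \<epsilon> of the squared norm of u' is at most what the form
  itself takes away.\<close>

lemma Re_graph_form_le:
  assumes P: "orthogonal_projector Ed P" and L: "operator_on_kernel Ed P L" and \<omega>: "\<omega> \<ge> 0"
    and bound: "\<And>x. x \<in> boundary_space Ed \<Longrightarrow> - Re (cinner (L *v x) x) \<le>
        \<omega> * ((\<Sum>e\<in>Ed. (cmod (x $ Inl e))\<^sup>2) + (\<Sum>e\<in>Ed. (cmod (x $ Inr (Inl e)))\<^sup>2))"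
    and u: "u \<in> graph_domain a Ed P L"
  shows "Re (cinner (graph_operator a Ed u) u) \<le> growth_constant \<omega> * (norm u)\<^sup>2"
proof -
  have um: "u \<in> graph_max a Ed" and bf: "boundary_form a Ed P L u = 0"
    using u by (auto simp: graph_domain_eq)
  define v where "v = bvalues a Ed u"
  define du where "du e = weak_derivative (a e) (u $ e)" for e
  \<comment> \<open>Makes 2 \<omega> \<epsilon> <= 1 and stays positive at \<omega> = 0.\<close>
  define \<epsilon> where "\<epsilon> = 1 / (2 * \<omega> + 1)"
  have \<epsilon>: "\<epsilon> > 0" "1 / \<epsilon> = 2 * \<omega> + 1" "2 * \<omega> * \<epsilon> \<le> 1" using \<omega> by (auto simp: \<epsilon>_def divide_simps)
  have tr: "(cmod (trace_at (a e) (u $ e) y))\<^sup>2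
      \<le> (1 / a e + (2 * \<omega> + 1)) * (norm (u $ e))\<^sup>2 + \<epsilon> * (norm (du e))\<^sup>2" if "y \<in> {0..a e}" for e y
  proof -
    have "(cmod (trace_at (a e) (u $ e) y))\<^sup>2
        \<le> (norm (u $ e))\<^sup>2 / a e + (\<epsilon> * (norm (du e))\<^sup>2 + (norm (u $ e))\<^sup>2 / \<epsilon>)"
      unfolding du_def by (rule H1_trace_estimate[OF lengths graph_maxD(2)[OF lengths um] \<epsilon>(1) that])
    also have "\<dots> = (norm (u $ e))\<^sup>2 * (1 / a e) + (\<epsilon> * (norm (du e))\<^sup>2 + (norm (u $ e))\<^sup>2 * (1 / \<epsilon>))" by simp
    also have "\<dots> = (1 / a e + (2 * \<omega> + 1)) * (norm (u $ e))\<^sup>2 + \<epsilon> * (norm (du e))\<^sup>2"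
      unfolding \<epsilon>(2) by (simp add: distrib_right distrib_left mult.commute)
    finally show ?thesis .
  qed
  have "Re (cinner (graph_operator a Ed u) u) = - Re (cinner (L *v v) v) - (\<Sum>e\<in>Ed. (norm (du e))\<^sup>2)"
    unfolding Re_graph_form[OF um] boundary_pairing[OF P L bf] v_def du_def by simp
  also have "- Re (cinner (L *v v) v) \<le>
      \<omega> * ((\<Sum>e\<in>Ed. (cmod (v $ Inl e))\<^sup>2) + (\<Sum>e\<in>Ed. (cmod (v $ Inr (Inl e)))\<^sup>2))"
    by (rule bound) (simp add: v_def bvalues_in)
  also have "\<dots> = (\<Sum>e\<in>Ed. \<omega> * ((cmod (v $ Inl e))\<^sup>2 + (cmod (v $ Inr (Inl e)))\<^sup>2))"
    by (simp add: sum_distrib_left sum.distrib distrib_left)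
  finally have "Re (cinner (graph_operator a Ed u) u) \<le>
      (\<Sum>e\<in>Ed. \<omega> * ((cmod (v $ Inl e))\<^sup>2 + (cmod (v $ Inr (Inl e)))\<^sup>2) - (norm (du e))\<^sup>2)"
    by (simp add: sum_subtractf)
  also have "\<dots> \<le> (\<Sum>e\<in>Ed. (2 * \<omega> * (1 / a e + (2 * \<omega> + 1))) * (norm u)\<^sup>2)"
  proof (rule sum_mono)
    fix e assume e: "e \<in> Ed"
    define K where "K = 1 / a e + (2 * \<omega> + 1)"
    have K: "K \<ge> 0" using lengths[of e] \<omega> by (simp add: K_def)
    have "(cmod (v $ Inl e))\<^sup>2 + (cmod (v $ Inr (Inl e)))\<^sup>2 \<le> 2 * (K * (norm (u $ e))\<^sup>2 + \<epsilon> * (norm (du e))\<^sup>2)"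
      using tr[of "a e" e] tr[of 0 e] lengths[of e] e by (simp add: v_def bvalues_def K_def)
    then have "\<omega> * ((cmod (v $ Inl e))\<^sup>2 + (cmod (v $ Inr (Inl e)))\<^sup>2)
        \<le> \<omega> * (2 * (K * (norm (u $ e))\<^sup>2 + \<epsilon> * (norm (du e))\<^sup>2))"
      using \<omega> by (rule mult_left_mono)
    also have "\<dots> = (2 * \<omega> * K) * (norm (u $ e))\<^sup>2 + (2 * \<omega> * \<epsilon>) * (norm (du e))\<^sup>2"
      by (simp add: algebra_simps)
    also have "\<dots> \<le> (2 * \<omega> * K) * (norm u)\<^sup>2 + 1 * (norm (du e))\<^sup>2"
      using \<omega> K \<epsilon> Finite_Cartesian_Product.norm_nth_le[of u e] by (intro add_mono mult_mono power_mono) auto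
    finally show "\<omega> * ((cmod (v $ Inl e))\<^sup>2 + (cmod (v $ Inr (Inl e)))\<^sup>2) - (norm (du e))\<^sup>2
        \<le> (2 * \<omega> * (1 / a e + (2 * \<omega> + 1))) * (norm u)\<^sup>2"
      by (simp add: K_def)
  qed
  \<comment> \<open>Nonnegative terms of the transport edges are added so that the constant does not
    depend on \<open>Ed\<close>.\<close>
  also have "\<dots> \<le> (\<Sum>e\<in>UNIV. (2 * \<omega> * (1 / a e + (2 * \<omega> + 1))) * (norm u)\<^sup>2)"
    using less_imp_le[OF lengths] \<omega> by (intro sum_mono2) auto
  also have "\<dots> = growth_constant \<omega> * (norm u)\<^sup>2"
    by (simp add: growth_constant_def sum_distrib_right)
  finally show ?thesis .
qed

end

lemma scaleC_scaleR: "c *\<^sub>C r *\<^sub>R x = r *\<^sub>R c *\<^sub>C x"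
  by (simp add: scaleC_of_real[symmetric] scaleC_scaleC mult.commute)

lemma scaleR_scaleC: "(r *\<^sub>R c) *\<^sub>C x = r *\<^sub>R c *\<^sub>C x"
  by (simp add: scaleR_conv_of_real scaleC_scaleC[symmetric] scaleC_of_real)

text \<open>Weak derivatives and traces are definite descriptions, known to be linear only on the
  maximal domain. Linear combinations therefore carry their membership in S along.\<close>

lemma linear_on_combination:
  fixes \<phi> :: "'a::complex_inner \<Rightarrow> 'b::complex_inner"
  assumes S: "csubspace S"
    and add: "\<And>x y. x \<in> S \<Longrightarrow> y \<in> S \<Longrightarrow> \<phi> (x + y) = \<phi> x + \<phi> y"
    and scale: "\<And>c x. x \<in> S \<Longrightarrow> \<phi> (c *\<^sub>C x) = c *\<^sub>C \<phi> x"
    and u: "\<And>k. k \<in> K \<Longrightarrow> u k \<in> S"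
  shows "(\<Sum>k\<in>K. c k *\<^sub>C u k) \<in> S \<and> \<phi> (\<Sum>k\<in>K. c k *\<^sub>C u k) = (\<Sum>k\<in>K. c k *\<^sub>C \<phi> (u k))"
proof -
  have 0: "0 \<in> S" using S by (simp add: csubspace_def)
  have "0 *\<^sub>C x = 0" for x :: 'a using scaleC_of_real[of 0 x] by simp
  moreover have "0 *\<^sub>C y = 0" for y :: 'b using scaleC_of_real[of 0 y] by simp
  ultimately have \<phi>0: "\<phi> 0 = 0" using scale[OF 0, of 0] by simp
  show ?thesis
    using u
  proof (induction K rule: infinite_finite_induct)
    case (insert k K)
    then have IH: "(\<Sum>k\<in>K. c k *\<^sub>C u k) \<in> S" "\<phi> (\<Sum>k\<in>K. c k *\<^sub>C u k) = (\<Sum>k\<in>K. c k *\<^sub>C \<phi> (u k))"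
      by simp_all
    have k: "u k \<in> S" "c k *\<^sub>C u k \<in> S" using insert.prems csubspace_scaleC[OF S] by auto
    have "c k *\<^sub>C u k + (\<Sum>k\<in>K. c k *\<^sub>C u k) \<in> S" using S k(2) IH(1) by (simp add: csubspace_def)
    then show ?case using insert.hyps add[OF k(2) IH(1)] by (simp add: IH(2) scale[OF k(1)])
  qed (simp_all add: 0 \<phi>0)
qed

lemma real_entries_cnj:
  fixes M :: "complex ^ 'n ^ 'm"
  assumes "real_entries M"
  shows "M *v (\<chi> k. cnj (x $ k)) = (\<chi> k. cnj ((M *v x) $ k))"
proof -
  have "cnj (M $ j $ k) = M $ j $ k" for j k
    using assms by (simp add: real_entries_def Reals_cnj_iff)
  then show ?thesis by (simp add: vec_eq_iff matrix_vector_mult_def)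
qed

context
  fixes a :: "'e::finite \<Rightarrow> real" and Ed :: "'e set"
  assumes lengths: "\<And>e. a e > 0"
begin

text \<open>Without boundary conditions the edges decouple, and the equation is solved on each with
  prescribed data at its left end.\<close>

lemma graph_ivp:
  assumes f: "f \<in> L2_graph a" and \<mu>: "\<mu> > 0"
  shows "\<exists>u\<in>graph_max a Ed. \<mu> *\<^sub>R u - graph_operator a Ed u = f \<and>
    (\<forall>k\<in>boundary_index Ed. initial_data a Ed u $ k = c k)"
proof -
  have fe: "f $ e \<in> L2_interval (a e)" for e using f by (simp add: L2_graph_def)
  define Q where "Q e w \<longleftrightarrow> (if e \<in> Ed
    then w \<in> H2_interval (a e) \<and> \<mu> *\<^sub>R w - weak_derivative (a e) (weak_derivative (a e) w) = f $ e \<and>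
      trace_at (a e) w 0 = c (Inl e) \<and> trace_at (a e) (weak_derivative (a e) w) 0 = c (Inr (Inl e))
    else w \<in> H1_interval (a e) \<and> \<mu> *\<^sub>R w - (- weak_derivative (a e) w) = f $ e \<and>
      trace_at (a e) w 0 = c (Inr (Inr e)))" for e w
  have "\<forall>e. \<exists>w. Q e w"
  proof
    fix e show "\<exists>w. Q e w"
    proof (cases "e \<in> Ed")
      case True
      then show ?thesis
        using diffusion_ivp[OF lengths fe less_imp_le[OF \<mu>], of e "c (Inl e)" "c (Inr (Inl e))"]
        unfolding Q_def by auto
    next
      case False
      then show ?thesis
        using transport_ivp[OF lengths fe, of e \<mu> "c (Inr (Inr e))"] unfolding Q_def by auto
    qed
  qed
  from choice[OF this] obtain w where w: "\<And>e. Q e (w e)" by blast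
  have w1: "w e \<in> H2_interval (a e)"
      "\<mu> *\<^sub>R w e - weak_derivative (a e) (weak_derivative (a e) (w e)) = f $ e"
      "trace_at (a e) (w e) 0 = c (Inl e)"
      "trace_at (a e) (weak_derivative (a e) (w e)) 0 = c (Inr (Inl e))" if "e \<in> Ed" for e
    using w[of e] that by (simp_all add: Q_def)
  have w2: "w e \<in> H1_interval (a e)"
      "\<mu> *\<^sub>R w e - (- weak_derivative (a e) (w e)) = f $ e"
      "trace_at (a e) (w e) 0 = c (Inr (Inr e))" if "e \<notin> Ed" for e
    using w[of e] that by (simp_all add: Q_def)
  define u where "u = (\<chi> e. w e)"
  have "u \<in> graph_max a Ed" using w1(1) w2(1) by (simp add: graph_max_def u_def)
  moreover have "\<mu> *\<^sub>R u - graph_operator a Ed u = f"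
    unfolding vec_eq_iff
  proof
    fix e show "(\<mu> *\<^sub>R u - graph_operator a Ed u) $ e = f $ e"
      using w1(2)[of e] w2(2)[of e] by (simp add: u_def graph_operator_def)
  qed
  moreover have "\<forall>k\<in>boundary_index Ed. initial_data a Ed u $ k = c k"
    by (auto simp: boundary_index_def initial_data_def u_def w1(3,4) w2(3))
  ultimately show ?thesis by blast
qed

text \<open>The solutions of \<open>\<mu> u = A u\<close> without boundary conditions are parametrised by their initial
  data, and there are as many of these as boundary conditions. By dissipativity the boundary form is
  injective on these solutions, hence onto.\<close>

lemma graph_resolvent_surjective:
  fixes P L
  assumes bm: "boundary_matrix Ed P" "boundary_matrix Ed L"
    and dis: "\<And>u. u \<in> graph_domain a Ed P L \<Longrightarrow> Re (cinner (graph_operator a Ed u) u) \<le> \<omega> * (norm u)\<^sup>2"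
    and \<omega>: "\<omega> \<ge> 0" and \<mu>: "\<mu> > \<omega>" and f: "f \<in> L2_graph a"
  shows "\<exists>u\<in>graph_domain a Ed P L. \<mu> *\<^sub>R u - graph_operator a Ed u = f"
proof -
  let ?A = "graph_operator a Ed" and ?B = "boundary_form a Ed P L" and ?I = "initial_data a Ed"
  have \<mu>0: "\<mu> > 0" using \<omega> \<mu> by simp
  note cs = csubspace_graph_max[where a = a and Ed = Ed, OF lengths]
  have zero: "(0 :: l2 ^ 'e) \<in> L2_graph a" using csubspace_L2_graph[of a] by (simp add: csubspace_def)
  have "\<forall>j. \<exists>u. u \<in> graph_max a Ed \<and> \<mu> *\<^sub>R u - ?A u = 0 \<and>
      (\<forall>k\<in>boundary_index Ed. ?I u $ k = (if k = j then 1 else 0))"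
  proof
    fix j
    from graph_ivp[OF zero \<mu>0, of "\<lambda>k. if k = j then 1 else 0"]
    show "\<exists>u. u \<in> graph_max a Ed \<and> \<mu> *\<^sub>R u - ?A u = 0 \<and>
      (\<forall>k\<in>boundary_index Ed. ?I u $ k = (if k = j then 1 else 0))" by blast
  qed
  then obtain u where u: "\<And>j. u j \<in> graph_max a Ed" "\<And>j. \<mu> *\<^sub>R u j - ?A (u j) = 0"
    "\<And>j k. k \<in> boundary_index Ed \<Longrightarrow> ?I (u j) $ k = (if k = j then 1 else 0)" by metis
  \<comment> \<open>The solution of the homogeneous equation with initial data c.\<close>
  define U where "U c = (\<Sum>j\<in>UNIV. c $ j *\<^sub>C u j)" for c :: "complex ^ ('e + 'e + 'e)"
  note add = graph_max_add[where a = a and Ed = Ed, OF lengths]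
    and scale = graph_max_scaleC[where a = a and Ed = Ed, OF lengths]
    and B_add = boundary_form_add[where a = a and Ed = Ed and P = P and L = L, OF lengths]
    and B_scale = boundary_form_scaleC[where a = a and Ed = Ed and P = P and L = L, OF lengths]
  have AU_conj: "U c \<in> graph_max a Ed \<and> ?A (U c) = (\<Sum>j\<in>UNIV. c $ j *\<^sub>C ?A (u j))" for c
    unfolding U_def by (rule linear_on_combination[OF cs add(2) scale(2) u(1)])
  have BU_conj: "U c \<in> graph_max a Ed \<and> ?B (U c) = (\<Sum>j\<in>UNIV. c $ j *\<^sub>C ?B (u j))" for c
    unfolding U_def by (rule linear_on_combination[OF cs B_add B_scale u(1)])
  have IU_conj: "U c \<in> graph_max a Ed \<and> ?I (U c) = (\<Sum>j\<in>UNIV. c $ j *\<^sub>C ?I (u j))" for c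
    unfolding U_def by (rule linear_on_combination[OF cs add(5) scale(5) u(1)])
  note U = AU_conj[THEN conjunct1] and AU = AU_conj[THEN conjunct2]
    and BU = BU_conj[THEN conjunct2] and IU = IU_conj[THEN conjunct2]
  have AU': "?A (U c) = \<mu> *\<^sub>R U c" for c
  proof -
    have "?A (u j) = \<mu> *\<^sub>R u j" for j using u(2)[of j] by simp
    then show ?thesis
      unfolding AU by (simp add: U_def scaleR_sum_right scaleC_scaleR)
  qed
  have IU': "?I (U c) $ k = c $ k" if "k \<in> boundary_index Ed" for c k
    using that by (simp add: IU u(3) scaleC_vec_def scaleC_complex_def if_distrib cong: if_cong)
  \<comment> \<open>The boundary form vanishes at indices outside \<open>boundary_index Ed\<close>.
    Adding the coordinates of c there completes it to an endomorphism of the full coordinate space,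
    where injectivity implies surjectivity.\<close>
  define R where "R c = (\<chi> k. if k \<in> boundary_index Ed then 0 else c $ k)" for c :: "complex ^ ('e + 'e + 'e)"
  define \<Phi> where "\<Phi> c = ?B (U c) + R c" for c
  have Bin: "?B v $ k = 0" if "k \<notin> boundary_index Ed" for v k
    using boundary_form_in[OF bm, of a v] that by (simp add: boundary_space_def)
  have lin: "linear \<Phi>"
  proof (rule linearI)
    fix c d :: "complex ^ ('e + 'e + 'e)" and r :: real
    show "\<Phi> (c + d) = \<Phi> c + \<Phi> d"
      by (simp add: \<Phi>_def BU scaleC_add_left sum.distrib R_def vec_eq_iff)
    show "\<Phi> (r *\<^sub>R c) = r *\<^sub>R \<Phi> c"
      by (simp add: \<Phi>_def BU R_def scaleR_sum_right scaleR_add_right scaleR_scaleC vec_eq_iff)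
  qed
  have comp: "?B (U c) = x \<and> (\<forall>k. k \<notin> boundary_index Ed \<longrightarrow> c $ k = 0)"
    if "\<Phi> c = x" "x \<in> boundary_space Ed" for c x
  proof -
    have out: "c $ k = 0" if k: "k \<notin> boundary_index Ed" for k
    proof -
      have "\<Phi> c $ k = 0" using \<open>\<Phi> c = x\<close> \<open>x \<in> boundary_space Ed\<close> k by (simp add: boundary_space_def)
      then show ?thesis using k by (simp add: \<Phi>_def R_def Bin)
    qed
    then have "R c = 0" by (simp add: R_def vec_eq_iff)
    then show ?thesis using \<open>\<Phi> c = x\<close> out by (simp add: \<Phi>_def)
  qed
  have "inj \<Phi>"
    unfolding linear_injective_0[OF lin]
  proof (intro allI impI)
    fix c assume c: "\<Phi> c = 0"
    have "0 \<in> boundary_space Ed" using csubspace_boundary_space by (auto simp: csubspace_def)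
    then have B0: "?B (U c) = 0" and out: "\<And>k. k \<notin> boundary_index Ed \<Longrightarrow> c $ k = 0"
      using comp[OF c] by auto
    have "U c \<in> graph_domain a Ed P L" using U B0 by (simp add: graph_domain_eq)
    \<comment> \<open>A solution of A u = \<mu> u in the domain violates the dissipativity bound for
      \<mu> > \<omega> unless it is 0; its initial data then vanish too.\<close>
    from dis[OF this] have "\<mu> * (norm (U c))\<^sup>2 \<le> \<omega> * (norm (U c))\<^sup>2"
      by (simp add: AU' Re_cinner power2_norm_eq_inner)
    then have U0: "U c = 0" using \<mu> by (simp add: mult_le_cancel_right)
    have "?I 0 = 0"
    proof -
      have "(0 :: l2 ^ 'e) \<in> graph_max a Ed" using cs by (simp add: csubspace_def)
      from add(5)[OF this this] show ?thesis by simp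
    qed
    then have "c $ k = 0" if "k \<in> boundary_index Ed" for k using IU'[OF that, of c] U0 by simp
    then have "c $ k = 0" for k using out by blast
    then show "c = 0" by (simp add: vec_eq_iff)
  qed
  then have surj: "surj \<Phi>" by (rule linear_injective_imp_surjective[OF lin]) (rule refl)
  obtain v where v: "v \<in> graph_max a Ed" "\<mu> *\<^sub>R v - ?A v = f"
    using graph_ivp[OF f \<mu>0] by blast
  obtain c where c: "\<Phi> c = - ?B v" using surj by (metis surjD)
  have "- ?B v \<in> boundary_space Ed"
    by (rule subspace_neg[OF csubspace_imp_subspace[OF csubspace_boundary_space] boundary_form_in[OF bm]])
  then have "?B (U c) = - ?B v" using comp[OF c] by blast
  then have "v + U c \<in> graph_domain a Ed P L"
    using v(1) U by (simp add: graph_domain_eq add(1) B_add)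
  moreover have "\<mu> *\<^sub>R (v + U c) - ?A (v + U c) = f"
    using v(2) by (simp add: add(2)[OF v(1) U] AU' scaleR_add_right)
  ultimately show ?thesis by blast
qed

section \<open>Complex conjugation on the graph\<close>

definition conj_graph :: "l2 ^ 'e \<Rightarrow> l2 ^ 'e" where "conj_graph u = (\<chi> e. conj_l2 (u $ e))"

text \<open>Derivatives and traces commute with conjugation, and so do real matrices; hence the
  boundary form of the conjugate is the conjugate of the boundary form.\<close>

lemma conj_graph_domain:
  assumes P: "real_entries P" and L: "real_entries L" and u: "u \<in> graph_domain a Ed P L"
  shows "conj_graph u \<in> graph_domain a Ed P L"
    and "graph_operator a Ed (conj_graph u) = conj_graph (graph_operator a Ed u)"
proof -
  have um: "u \<in> graph_max a Ed" and bf: "boundary_form a Ed P L u = 0"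
    using u by (auto simp: graph_domain_eq)
  note D = graph_maxD[OF lengths um] and C = H1_interval_conj[OF lengths]
  note nn = less_imp_le[OF lengths]
  have uminus: "conj_l2 (- x) = - conj_l2 x" for x
    using conj_scaleR_l2[of "-1" x] by simp
  have c: "conj_graph u \<in> graph_max a Ed"
    using um by (auto simp: graph_max_def conj_graph_def H2_interval_conj[OF lengths] C)
  show "graph_operator a Ed (conj_graph u) = conj_graph (graph_operator a Ed u)"
    by (simp add: graph_operator_def conj_graph_def vec_eq_iff C D uminus)
  have bv: "bvalues a Ed (conj_graph u) = (\<chi> k. cnj (bvalues a Ed u $ k))"
    by (rule vec_sum3_eqI) (simp_all add: bvalues_def conj_graph_def C D nn)
  have bd: "bderivs a Ed (conj_graph u) = (\<chi> k. cnj (bderivs a Ed u $ k))"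
    by (rule vec_sum3_eqI) (simp_all add: bderivs_def conj_graph_def C D nn)
  have "boundary_form a Ed P L (conj_graph u) = (\<chi> k. cnj (boundary_form a Ed P L u $ k))"
    unfolding boundary_form_def bv bd matrix_vector_mult_diff_rdistrib matrix_vector_mult_add_rdistrib
      matrix_vector_mul_lid real_entries_cnj[OF P] real_entries_cnj[OF L]
    by (simp add: vec_eq_iff)
  then have "boundary_form a Ed P L (conj_graph u) = 0" by (simp add: bf vec_eq_iff)
  then show "conj_graph u \<in> graph_domain a Ed P L" using c by (simp add: graph_domain_eq)
qed

lemma real_valued_iff_conj_graph: "real_valued u \<longleftrightarrow> conj_graph u = u"
  by (auto simp: real_valued_iff conj_graph_def vec_eq_iff)

text \<open>The defect w = conj u - u solves A w = \<mu> w, and for \<mu> > \<omega> dissipativity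
  leaves only w = 0.\<close>

lemma graph_resolvent_real:
  assumes P: "real_entries P" and L: "real_entries L"
    and dis: "\<And>u. u \<in> graph_domain a Ed P L \<Longrightarrow> Re (cinner (graph_operator a Ed u) u) \<le> \<omega> * (norm u)\<^sup>2"
    and \<mu>: "\<mu> > \<omega>" and u: "u \<in> graph_domain a Ed P L"
    and real: "real_valued (\<mu> *\<^sub>R u - graph_operator a Ed u)"
  shows "real_valued u"
proof -
  let ?A = "graph_operator a Ed"
  note c = conj_graph_domain[OF P L u]
  have diff: "conj_graph (x - y) = conj_graph x - conj_graph y" for x y
    by (simp add: conj_graph_def vec_eq_iff conj_diff_l2)
  have scale: "conj_graph (r *\<^sub>R x) = r *\<^sub>R conj_graph x" for r x
    by (simp add: conj_graph_def vec_eq_iff conj_scaleR_l2)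
  note lin = linear_operator_graph[where a = a and Ed = Ed and P = P and L = L, OF lengths]
  have sD: "subspace (graph_domain a Ed P L)"
    using lin csubspace_imp_subspace by (auto simp: linear_operator_in_def)
  define w where "w = conj_graph u - u"
  have w: "w \<in> graph_domain a Ed P L" unfolding w_def by (rule subspace_diff[OF sD c(1) u])
  have "?A (w + u) = ?A w + ?A u" using lin w u by (simp add: linear_operator_in_def)
  then have Aw: "?A w = conj_graph (?A u) - ?A u" using c(2) by (simp add: w_def)
  have "conj_graph (\<mu> *\<^sub>R u - ?A u) = \<mu> *\<^sub>R u - ?A u"
    using real by (simp only: real_valued_iff_conj_graph)
  then have "\<mu> *\<^sub>R conj_graph u - conj_graph (?A u) = \<mu> *\<^sub>R u - ?A u"
    by (simp only: diff scale)
  then have "?A w = \<mu> *\<^sub>R w"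
    unfolding Aw unfolding w_def scaleR_diff_right by (simp add: algebra_simps)
  then have "\<mu> * (norm w)\<^sup>2 \<le> \<omega> * (norm w)\<^sup>2"
    using dis[OF w] by (simp add: Re_cinner power2_norm_eq_inner)
  then have "w = 0" using \<mu> by (simp add: mult_le_cancel_right)
  then show ?thesis by (simp add: real_valued_iff_conj_graph w_def)
qed

text \<open>\<omega> stays a parameter because the main result uses these conclusions twice: with
  the given \<omega>, and with \<omega> = 0 when -L is dissipative.\<close>

lemma graph_lumer_phillips:
  assumes P: "orthogonal_projector Ed P" and L: "operator_on_kernel Ed P L" and \<omega>: "\<omega> \<ge> 0"
    and bound: "\<And>x. x \<in> boundary_space Ed \<Longrightarrow> - Re (cinner (L *v x) x) \<le>
        \<omega> * ((\<Sum>e\<in>Ed. (cmod (x $ Inl e))\<^sup>2) + (\<Sum>e\<in>Ed. (cmod (x $ Inr (Inl e)))\<^sup>2))"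
  defines "\<gamma> \<equiv> growth_constant a \<omega>"
  shows "quasi_m_dissipative_with \<gamma> (L2_graph a) (graph_domain a Ed P L) (graph_operator a Ed)"
    and "\<exists>T. C0_semigroup (L2_graph a) T \<and>
      is_generator (L2_graph a) T (graph_domain a Ed P L) (graph_operator a Ed) \<and>
      growth_bounded \<gamma> (L2_graph a) T"
    and "\<lbrakk>real_entries P; real_entries L; C0_semigroup (L2_graph a) T;
      is_generator (L2_graph a) T (graph_domain a Ed P L) (graph_operator a Ed)\<rbrakk> \<Longrightarrow>
      real_semigroup (L2_graph a) T"
proof -
  have \<gamma>: "\<gamma> \<ge> 0" unfolding \<gamma>_def by (rule growth_constant_nonneg[OF lengths \<omega>])
  have bm: "boundary_matrix Ed P" "boundary_matrix Ed L"
    using P L by (auto simp: orthogonal_projector_def operator_on_kernel_def)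
  have dis: "Re (cinner (graph_operator a Ed u) u) \<le> \<gamma> * (norm u)\<^sup>2" if "u \<in> graph_domain a Ed P L" for u
    unfolding \<gamma>_def by (rule Re_graph_form_le[OF lengths P L \<omega> bound that])
  have surj: "\<exists>u\<in>graph_domain a Ed P L. \<mu> *\<^sub>R u - graph_operator a Ed u = f"
    if "\<mu> > \<gamma>" "f \<in> L2_graph a" for \<mu> f
    by (rule graph_resolvent_surjective[OF bm _ \<gamma> that]) (rule dis)
  note lin = linear_operator_graph[where a = a and Ed = Ed and P = P and L = L, OF lengths]
  note LP = lumer_phillips[OF closed_L2_graph csubspace_L2_graph lin, where \<omega> = \<gamma>]
  show "quasi_m_dissipative_with \<gamma> (L2_graph a) (graph_domain a Ed P L) (graph_operator a Ed)"
    by (rule LP(1)) (fact dis, fact surj)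
  show "\<exists>T. C0_semigroup (L2_graph a) T \<and>
      is_generator (L2_graph a) T (graph_domain a Ed P L) (graph_operator a Ed) \<and>
      growth_bounded \<gamma> (L2_graph a) T"
    by (rule LP(2)) (fact dis, fact surj)
  assume re: "real_entries P" "real_entries L" and T: "C0_semigroup (L2_graph a) T"
      "is_generator (L2_graph a) T (graph_domain a Ed P L) (graph_operator a Ed)"
  show "real_semigroup (L2_graph a) T"
    unfolding real_semigroup_def
  proof (intro allI impI ballI)
    fix t :: real and u assume t: "t \<ge> 0" and u: "u \<in> L2_graph a" "real_valued u"
    have "T t u \<in> {u. real_valued u}"
    proof (rule LP(3)[OF _ _ T closed_real_valued _ _ t u(1)])
      show "r *\<^sub>R u \<in> {u. real_valued u}" if "u \<in> {u. real_valued u}" for r and u :: "l2 ^ 'e"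
        using that by (simp add: real_valued_iff conj_scaleR_l2)
      show "v \<in> {u. real_valued u}" if "\<mu> > \<gamma>" "v \<in> graph_domain a Ed P L"
        "\<mu> *\<^sub>R v - graph_operator a Ed v \<in> {u. real_valued u}" for \<mu> v
        using graph_resolvent_real[OF re dis that(1,2)] that(3) by simp
    qed (use u dis surj in auto)
    then show "real_valued (T t u)" by simp
  qed
qed

end

theorem theorem4p1:
  fixes a :: "'e::finite \<Rightarrow> real" and Ed :: "'e set"
    and P L :: "complex ^ ('e + 'e + 'e) ^ ('e + 'e + 'e)" and \<omega> :: real
  assumes lengths: "\<And>e. a e > 0"
    and P: "orthogonal_projector Ed P"
    and L: "operator_on_kernel Ed P L"
    and \<omega>: "\<omega> \<ge> 0"
    and bound: "\<And>x. x \<in> boundary_space Ed \<Longrightarrow>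
      - Re (cinner (L *v x) x) \<le>
        \<omega> * ((\<Sum>e\<in>Ed. (cmod (x $ Inl e))\<^sup>2) + (\<Sum>e\<in>Ed. (cmod (x $ Inr (Inl e)))\<^sup>2))"
  shows "quasi_m_dissipative (L2_graph a) (graph_domain a Ed P L) (graph_operator a Ed) \<and>
    (dissipative (boundary_space Ed) (boundary_space Ed) (\<lambda>x. - (L *v x)) \<longrightarrow>
      m_dissipative (L2_graph a) (graph_domain a Ed P L) (graph_operator a Ed)) \<and>
    (\<exists>T. C0_semigroup (L2_graph a) T \<and>
      is_generator (L2_graph a) T (graph_domain a Ed P L) (graph_operator a Ed) \<and>
      quasi_contractive (L2_graph a) T \<and>
      (dissipative (boundary_space Ed) (boundary_space Ed) (\<lambda>x. - (L *v x)) \<longrightarrow>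
        contractive (L2_graph a) T)) \<and>
    (real_entries P \<and> real_entries L \<longrightarrow>
      (\<forall>T. C0_semigroup (L2_graph a) T \<and>
        is_generator (L2_graph a) T (graph_domain a Ed P L) (graph_operator a Ed) \<longrightarrow>
        real_semigroup (L2_graph a) T))"
proof -
  let ?H = "L2_graph a" and ?D = "graph_domain a Ed P L" and ?A = "graph_operator a Ed"
  note LP = graph_lumer_phillips[where a = a and Ed = Ed and P = P and L = L, OF lengths P L]
  note general = LP[where \<omega> = \<omega>, OF \<omega> bound]
  obtain T where T: "C0_semigroup ?H T" "is_generator ?H T ?D ?A"
    "growth_bounded (growth_constant a \<omega>) ?H T"
    using general(2) by blast
  have contr: "quasi_m_dissipative_with 0 ?H ?D ?A" "\<exists>S. C0_semigroup ?H S \<and> is_generator ?H S ?D ?A \<and> growth_bounded 0 ?H S"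
    if "dissipative (boundary_space Ed) (boundary_space Ed) (\<lambda>x. - (L *v x))"
  proof -
    \<comment> \<open>Dissipativity of -L is the hypothesis on L with \<omega> = 0.\<close>
    have b0: "- Re (cinner (L *v x) x) \<le>
        0 * ((\<Sum>e\<in>Ed. (cmod (x $ Inl e))\<^sup>2) + (\<Sum>e\<in>Ed. (cmod (x $ Inr (Inl e)))\<^sup>2))"
      if "x \<in> boundary_space Ed" for x
      using \<open>dissipative _ _ _\<close> that
      by (auto simp: dissipative_def quasi_dissipative_with_def Re_cinner)
    have "growth_constant a 0 = 0" by (simp add: growth_constant_def[OF lengths])
    then show "quasi_m_dissipative_with 0 ?H ?D ?A"
      "\<exists>S. C0_semigroup ?H S \<and> is_generator ?H S ?D ?A \<and> growth_bounded 0 ?H S"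
      using LP(1,2)[where \<omega> = 0, OF order_refl b0] by simp_all
  qed
  have "\<exists>T. C0_semigroup ?H T \<and> is_generator ?H T ?D ?A \<and> quasi_contractive ?H T \<and>
      (dissipative (boundary_space Ed) (boundary_space Ed) (\<lambda>x. - (L *v x)) \<longrightarrow> contractive ?H T)"
  \<comment> \<open>One and the same semigroup has to be quasi-contractive and, if -L is
    dissipative, contractive; the witness is therefore chosen after deciding whether -L is
    dissipative.\<close>
  proof (cases "dissipative (boundary_space Ed) (boundary_space Ed) (\<lambda>x. - (L *v x))")
    case True
    then show ?thesis using contr(2) unfolding quasi_contractive_def contractive_def by blast
  next
    case False
    then show ?thesis using T unfolding quasi_contractive_def by blast
  qed
  then show ?thesis
    using general(1,3) contr(1) unfolding quasi_m_dissipative_def m_dissipative_def by blast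
qed

end
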